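(* Let $\gamma>0$, let $u_\gamma\in X_\gamma$ be the minimizer of $\mathcal F_\gamma$ over $X_\gamma$, and let $p_\gamma\in K_\gamma$ be a maximizer of the dual problem $$\sup_{p\in K_\gamma}\Bigl\{-\tfrac12\|\operatorname{div}p\|_{L^2(\Omega)}^2-\int_\Omega f\,\operatorname{div}p\,dx-\int_\Omega\varphi_\gamma^*(x,|p(x)|)\,dx\Bigr\}.$$ Then $$\operatorname{div}p_\gamma=u_\gamma-f\quad\text{in }L^2(\Omega),\qquad p_\gamma(x)\in\partial_z\Phi_\gamma(x,\nabla u_\gamma(x))\quad\text{for a.e. }x\in\Omega,$$ where $\Phi_\gamma(x,z):=\varphi_\gamma(x,|z|)$. The latter inclusion is equivalent to the following, pointwise a.e. in $\Omega$: if $\nabla u_\gamma(x)\ne0$, then $$p_\gamma(x)=a(x)\frac{\nabla u_\gamma(x)}{|\nabla u_\gamma(x)|},\qquad a(x)\in\partial_t\varphi_\gamma(x,|\nabla u_\gamma(x)|),$$ and if $\nabla u_\gamma(x)=0$, then $|p_\gamma(x)|\le\alpha$.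
   Context: $\Omega\subset\mathbb R^N$ is a bounded Lipschitz domain, $f\in L^2(\Omega)$, $\alpha>0$ is fixed, and $\kappa\in L^\infty(\Omega)$ is fixed with $0<\kappa_-\le\kappa(x)\le\kappa_+<\infty$ for a.e. $x\in\Omega$. With $\log^+r:=\max\{0,\log r\}$ for $r>0$ and $\log^+0:=0$, $$\varphi_\gamma(x,t):=\alpha t\Bigl(1+\gamma\log^+\frac{t}{\kappa(x)}\Bigr)\ (t\ge0),\qquad \varphi_\gamma^*(x,s):=\sup_{t\ge0}\{st-\varphi_\gamma(x,t)\}\ (s\ge0).$$ $L^{\varphi_\gamma^*}(\Omega;\mathbb R^N)$ is the set of measurable $p:\Omega\to\mathbb R^N$ with $\int_\Omega\varphi_\gamma^*(x,\lambda|p(x)|)\,dx<\infty$ for some $\lambda>0$. $X_\gamma:=\{u\in L^2(\Omega)\cap W^{1,1}(\Omega):\int_\Omega\varphi_\gamma(x,|\nabla u|)\,dx<\infty\}$ and $\mathcal F_\gamma(u):=\frac12\|u-f\|_{L^2(\Omega)}^2+\int_\Omega\varphi_\gamma(x,|\nabla u|)\,dx$ for $u\in X_\gamma$; it has a unique minimizer. With $\operatorname{div}$ in the distributional sense, $$K_\gamma:=\Bigl\{p\in L^{\varphi_\gamma^*}(\Omega;\mathbb R^N):\ \operatorname{div}p\in L^2(\Omega)\text{ and }\int_\Omega p\cdot\nabla u\,dx=-\int_\Omega(\operatorname{div}p)\,u\,dx\ \text{for all }u\in X_\gamma\Bigr\}.$$ $\partial_z,\partial_t$ denote convex subdifferentials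 in the indicated variable ($\partial_t$ for the convex function $t\mapsto\varphi_\gamma(x,t)$ on $[0,\infty)$). *)

theory Defs
  imports "HOL-Analysis.Analysis"
begin

text \<open>Elements of the function spaces are represented by functions; only their values
  almost everywhere on the domain (for Lebesgue measure) matter.\<close>

section \<open>Bounded Lipschitz domains\<close>

text \<open>Near every boundary point the set is the strict epigraph, in some direction \<open>e\<close>, of a
  Lipschitz function \<open>h\<close> on the hyperplane orthogonal to \<open>e\<close>.\<close>

definition bounded_lipschitz_domain :: "'a::euclidean_space set \<Rightarrow> bool" where
  "bounded_lipschitz_domain \<Omega> \<longleftrightarrow>
     open \<Omega> \<and> connected \<Omega> \<and> \<Omega> \<noteq> {} \<and> bounded \<Omega> \<and>
     (\<forall>x0\<in>frontier \<Omega>. \<exists>r>0. \<exists>e. norm e = 1 \<and>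
        (\<exists>h L. L-lipschitz_on {y. y \<bullet> e = 0} h \<and>
           \<Omega> \<inter> ball x0 r = {x \<in> ball x0 r. h (x - (x \<bullet> e) *\<^sub>R e) < x \<bullet> e}))"

section \<open>Test functions and weak derivatives\<close>

fun C_k :: "nat \<Rightarrow> ('a::euclidean_space \<Rightarrow> real) \<Rightarrow> bool" where
  "C_k 0 f \<longleftrightarrow> continuous_on UNIV f"
| "C_k (Suc k) f \<longleftrightarrow>
     (\<forall>x. f differentiable (at x)) \<and> (\<forall>v. C_k k (\<lambda>x. frechet_derivative f (at x) v))"

definition test_function :: "'a::euclidean_space set \<Rightarrow> ('a \<Rightarrow> real) \<Rightarrow> bool" where
  "test_function \<Omega> \<psi> \<longleftrightarrow>
     (\<forall>k. C_k k \<psi>) \<and> compact (closure {x. \<psi> x \<noteq> 0}) \<and> closure {x. \<psi> x \<noteq> 0} \<subseteq> \<Omega>"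

definition classical_grad :: "('a::euclidean_space \<Rightarrow> real) \<Rightarrow> 'a \<Rightarrow> 'a" where
  "classical_grad \<psi> x = (THE D. GDERIV \<psi> x :> D)"

definition locally_integrable ::
    "'a::euclidean_space set \<Rightarrow> ('a \<Rightarrow> 'b::euclidean_space) \<Rightarrow> bool" where
  "locally_integrable \<Omega> g \<longleftrightarrow> (\<forall>K. compact K \<and> K \<subseteq> \<Omega> \<longrightarrow> g absolutely_integrable_on K)"

definition has_weak_grad ::
    "'a::euclidean_space set \<Rightarrow> ('a \<Rightarrow> real) \<Rightarrow> ('a \<Rightarrow> 'a) \<Rightarrow> bool" where
  "has_weak_grad \<Omega> u g \<longleftrightarrow>
     locally_integrable \<Omega> u \<and> locally_integrable \<Omega> g \<and>
     (\<forall>\<psi>. test_function \<Omega> \<psi> \<longrightarrow>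
        (\<integral>x. u x *\<^sub>R classical_grad \<psi> x \<partial>lebesgue_on \<Omega>)
          = - (\<integral>x. \<psi> x *\<^sub>R g x \<partial>lebesgue_on \<Omega>))"

definition has_weak_div ::
    "'a::euclidean_space set \<Rightarrow> ('a \<Rightarrow> 'a) \<Rightarrow> ('a \<Rightarrow> real) \<Rightarrow> bool" where
  "has_weak_div \<Omega> p d \<longleftrightarrow>
     locally_integrable \<Omega> p \<and> locally_integrable \<Omega> d \<and>
     (\<forall>\<psi>. test_function \<Omega> \<psi> \<longrightarrow>
        (\<integral>x. p x \<bullet> classical_grad \<psi> x \<partial>lebesgue_on \<Omega>)
          = - (\<integral>x. d x * \<psi> x \<partial>lebesgue_on \<Omega>))"

text \<open>The following choices matter only up to null sets, because locally integrable weak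
  gradients and divergences are unique almost everywhere.\<close>

definition weak_grad :: "'a::euclidean_space set \<Rightarrow> ('a \<Rightarrow> real) \<Rightarrow> 'a \<Rightarrow> 'a" where
  "weak_grad \<Omega> u = (SOME g. has_weak_grad \<Omega> u g)"

definition weak_div :: "'a::euclidean_space set \<Rightarrow> ('a \<Rightarrow> 'a) \<Rightarrow> 'a \<Rightarrow> real" where
  "weak_div \<Omega> p = (SOME d. has_weak_div \<Omega> p d)"

section \<open>Function spaces\<close>

definition L2 :: "'a::euclidean_space set \<Rightarrow> ('a \<Rightarrow> real) set" where
  "L2 \<Omega> = {u \<in> borel_measurable (lebesgue_on \<Omega>). integrable (lebesgue_on \<Omega>) (\<lambda>x. (u x)\<^sup>2)}"

definition L2_norm :: "'a::euclidean_space set \<Rightarrow> ('a \<Rightarrow> real) \<Rightarrow> real" where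
  "L2_norm \<Omega> u = sqrt (\<integral>x. (u x)\<^sup>2 \<partial>lebesgue_on \<Omega>)"

definition W11 :: "'a::euclidean_space set \<Rightarrow> ('a \<Rightarrow> real) set" where
  "W11 \<Omega> = {u. integrable (lebesgue_on \<Omega>) u \<and>
                (\<exists>g. has_weak_grad \<Omega> u g \<and> integrable (lebesgue_on \<Omega>) g)}"

section \<open>The integrand, its conjugate, and subdifferentials\<close>

definition log_plus :: "real \<Rightarrow> real" where
  "log_plus r = (if r > 0 then max 0 (ln r) else 0)"

definition phi :: "real \<Rightarrow> real \<Rightarrow> ('a \<Rightarrow> real) \<Rightarrow> 'a \<Rightarrow> real \<Rightarrow> real" where
  "phi \<alpha> \<gamma> \<kappa> x t = \<alpha> * t * (1 + \<gamma> * log_plus (t / \<kappa> x))"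

definition phi_conj :: "real \<Rightarrow> real \<Rightarrow> ('a \<Rightarrow> real) \<Rightarrow> 'a \<Rightarrow> real \<Rightarrow> ereal" where
  "phi_conj \<alpha> \<gamma> \<kappa> x s = (SUP t\<in>{0..}. ereal (s * t - phi \<alpha> \<gamma> \<kappa> x t))"

definition Phi ::
    "real \<Rightarrow> real \<Rightarrow> ('a \<Rightarrow> real) \<Rightarrow> 'a \<Rightarrow> 'b::real_normed_vector \<Rightarrow> real" where
  "Phi \<alpha> \<gamma> \<kappa> x z = phi \<alpha> \<gamma> \<kappa> x (norm z)"

text \<open>Convex subdifferential at \<open>z\<close> of a function with effective domain \<open>S\<close>.\<close>

definition subdifferential :: "'b::real_inner set \<Rightarrow> ('b \<Rightarrow> real) \<Rightarrow> 'b \<Rightarrow> 'b set" where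
  "subdifferential S F z = {q. \<forall>y\<in>S. F z + q \<bullet> (y - z) \<le> F y}"

section \<open>The primal and dual problems\<close>

definition X_space ::
    "'a::euclidean_space set \<Rightarrow> real \<Rightarrow> real \<Rightarrow> ('a \<Rightarrow> real) \<Rightarrow> ('a \<Rightarrow> real) set" where
  "X_space \<Omega> \<alpha> \<gamma> \<kappa> =
     {u \<in> L2 \<Omega> \<inter> W11 \<Omega>.
        integrable (lebesgue_on \<Omega>) (\<lambda>x. phi \<alpha> \<gamma> \<kappa> x (norm (weak_grad \<Omega> u x)))}"

definition primal_functional ::
    "'a::euclidean_space set \<Rightarrow> ('a \<Rightarrow> real) \<Rightarrow> real \<Rightarrow> real \<Rightarrow> ('a \<Rightarrow> real) \<Rightarrow> ('a \<Rightarrow> real) \<Rightarrow> real" where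
  "primal_functional \<Omega> f \<alpha> \<gamma> \<kappa> u =
     1/2 * (L2_norm \<Omega> (\<lambda>x. u x - f x))\<^sup>2
     + (\<integral>x. phi \<alpha> \<gamma> \<kappa> x (norm (weak_grad \<Omega> u x)) \<partial>lebesgue_on \<Omega>)"

definition L_phi_conj ::
    "'a::euclidean_space set \<Rightarrow> real \<Rightarrow> real \<Rightarrow> ('a \<Rightarrow> real) \<Rightarrow> ('a \<Rightarrow> 'a) set" where
  "L_phi_conj \<Omega> \<alpha> \<gamma> \<kappa> =
     {p \<in> borel_measurable (lebesgue_on \<Omega>).
        \<exists>c>0. (\<integral>\<^sup>+x. e2ennreal (phi_conj \<alpha> \<gamma> \<kappa> x (c * norm (p x))) \<partial>lebesgue_on \<Omega>) < \<infinity>}"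

definition K_set ::
    "'a::euclidean_space set \<Rightarrow> real \<Rightarrow> real \<Rightarrow> ('a \<Rightarrow> real) \<Rightarrow> ('a \<Rightarrow> 'a) set" where
  "K_set \<Omega> \<alpha> \<gamma> \<kappa> =
     {p \<in> L_phi_conj \<Omega> \<alpha> \<gamma> \<kappa>.
        (\<exists>d\<in>L2 \<Omega>. has_weak_div \<Omega> p d) \<and>
        (\<forall>u\<in>X_space \<Omega> \<alpha> \<gamma> \<kappa>.
           (\<integral>x. p x \<bullet> weak_grad \<Omega> u x \<partial>lebesgue_on \<Omega>)
             = - (\<integral>x. weak_div \<Omega> p x * u x \<partial>lebesgue_on \<Omega>))}"

text \<open>Extended-real-valued: for \<open>p\<close> in the Orlicz space the modular of \<open>p\<close> itself (without
  rescaling) may be infinite, and the dual functional is then \<open>-\<infinity>\<close>. The conjugate is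
  nonnegative (take \<open>t = 0\<close>), so \<open>e2ennreal\<close> does not truncate it.\<close>

definition dual_functional ::
    "'a::euclidean_space set \<Rightarrow> ('a \<Rightarrow> real) \<Rightarrow> real \<Rightarrow> real \<Rightarrow> ('a \<Rightarrow> real) \<Rightarrow> ('a \<Rightarrow> 'a) \<Rightarrow> ereal" where
  "dual_functional \<Omega> f \<alpha> \<gamma> \<kappa> p =
     ereal (- (1/2) * (L2_norm \<Omega> (weak_div \<Omega> p))\<^sup>2
            - (\<integral>x. f x * weak_div \<Omega> p x \<partial>lebesgue_on \<Omega>))
     - enn2ereal (\<integral>\<^sup>+x. e2ennreal (phi_conj \<alpha> \<gamma> \<kappa> x (norm (p x))) \<partial>lebesgue_on \<Omega>)"

end

theory Submission
  imports Defs
begin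

text \<open>The subdifferential of \<open>\<Phi>\<close> at \<open>\<nabla>u\<close> consists pointwise of vectors of norm at most a logarithm of
  \<open>|\<nabla>u|\<close>, so the measurable selections \<open>q\<close> of \<open>\<partial>\<Phi>(x, \<nabla>u(x))\<close> form a convex set that is bounded in \<open>L\<^sup>2\<close>.
  Minimality of \<open>u\<close> provides, for every direction \<open>v\<close>, a selection with
  \<open>\<integral> q \<bullet> \<nabla>v + \<integral> (u - f) v \<ge> 0\<close>. A minimax argument for finitely many directions and a compactness argument
  in \<open>L\<^sup>2\<close> turn this into one selection \<open>q\<close> for which the expression vanishes for all \<open>v\<close>. Hence \<open>q\<close> is
  dual admissible with \<open>div q = u - f\<close> and has dual value at least \<open>F(u)\<close>, so there is no duality gap.
  For a dual maximizer \<open>p\<close> the absence of a gap says that \<open>\<integral> (div p - (u - f))\<^sup>2 / 2\<close> plus the integral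
  of the nonnegative defect in the Fenchel--Young inequality is zero, so both integrands vanish a.e.\<close>

section \<open>Smooth bump functions\<close>

text \<open>Two features of the integrand shape the proof. Its kinks (\<open>t = \<kappa> x\<close>,
  and the origin for \<open>Phi\<close>) make the first variation at the minimizer merely sublinear
  in the direction: each direction brings its own selection, and no Euler-Lagrange field can be read
  off. Exchanging these quantifiers is the actual work. On the other hand, growth of type t log t is
  mild. Slopes grow like a logarithm, whose square is at most linear, so an L1 gradient already puts
  every selection into L2, and Hilbert space arguments replace weak-star compactness in an Orlicz
  dual. The same growth gives a doubling estimate, so the energy space is a vector space and
  residuals can be rescaled. The conjugate grows exponentially and has no doubling: the dual value
  can be -\<infinity>, and finiteness must be extracted from the comparison with the primal value
  before dual integrals are manipulated. Smooth bumps enter because \<open>weak_grad\<close> and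
  \<open>weak_div\<close> are arbitrary choices: statements about them have content only once any
  two candidates agree almost everywhere.\<close>

lemma C_k_SucI:
  assumes "\<And>x. (f has_derivative F x) (at x)" "\<And>v. C_k k (\<lambda>x. F x v)"
  shows "C_k (Suc k) f"
proof -
  have "frechet_derivative f (at x) = F x" for x
    using frechet_derivative_at[OF assms(1)] by simp
  then show ?thesis using assms by (auto simp: differentiable_def)
qed

lemma C_k_Suc_has_derivative:
  "C_k (Suc k) f \<Longrightarrow> (f has_derivative frechet_derivative f (at x)) (at x)"
  by (simp add: frechet_derivative_works)

lemma C_k_SucD: "C_k (Suc k) f \<Longrightarrow> C_k k f"
proof (induction k arbitrary: f)
  case 0
  then show ?case
    by (auto simp: continuous_on_eq_continuous_within intro: differentiable_imp_continuous_within)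
next
  case (Suc k)
  then show ?case by simp
qed

lemma C_k_const: "C_k k (\<lambda>x. c)"
proof (induction k arbitrary: c)
  case (Suc k)
  show ?case by (rule C_k_SucI[where F="\<lambda>x v. 0"]) (use Suc in auto)
qed simp

lemma C_k_add: "C_k k f \<Longrightarrow> C_k k g \<Longrightarrow> C_k k (\<lambda>x. f x + g x)"
proof (induction k arbitrary: f g)
  case (Suc k)
  show ?case
  proof (rule C_k_SucI)
    show "((\<lambda>x. f x + g x) has_derivative
            (\<lambda>v. frechet_derivative f (at x) v + frechet_derivative g (at x) v)) (at x)" for x
      by (intro has_derivative_add C_k_Suc_has_derivative[OF Suc.prems(1)] C_k_Suc_has_derivative[OF Suc.prems(2)])
  qed (use Suc in auto)
qed (auto intro: continuous_on_add)

lemma C_k_mult: "C_k k f \<Longrightarrow> C_k k g \<Longrightarrow> C_k k (\<lambda>x. f x * g x)"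
proof (induction k arbitrary: f g)
  case (Suc k)
  show ?case
  proof (rule C_k_SucI)
    show "((\<lambda>x. f x * g x) has_derivative
            (\<lambda>v. f x * frechet_derivative g (at x) v + frechet_derivative f (at x) v * g x)) (at x)" for x
      by (intro has_derivative_mult C_k_Suc_has_derivative[OF Suc.prems(1)] C_k_Suc_has_derivative[OF Suc.prems(2)])
    \<comment> \<open>The product rule leaves \<open>f\<close> and \<open>g\<close>
      undifferentiated, so \<open>C_k_SucD\<close> must lower their order before the induction
      hypothesis applies.\<close>
    show "C_k k (\<lambda>x. f x * frechet_derivative g (at x) v + frechet_derivative f (at x) v * g x)" for v
      using Suc.prems C_k_SucD[OF Suc.prems(1)] C_k_SucD[OF Suc.prems(2)] by (intro C_k_add Suc.IH) auto
  qed
qed (auto intro: continuous_on_mult)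

lemma C_k_prod: "finite A \<Longrightarrow> (\<And>i. i \<in> A \<Longrightarrow> C_k k (f i)) \<Longrightarrow> C_k k (\<lambda>x. \<Prod>i\<in>A. f i x)"
  by (induction A rule: finite_induct) (auto intro: C_k_const C_k_mult)

text \<open>The functions \<open>P(1/t) exp(-1/t)\<close>, extended by zero to \<open>t \<le> 0\<close>: a family closed under
  differentiation.\<close>

definition flat_exp :: "real poly \<Rightarrow> real \<Rightarrow> real" where
  "flat_exp P t = (if t > 0 then poly P (1 / t) * exp (- (1 / t)) else 0)"

lemma tendsto_poly_div_exp: "((\<lambda>x. poly P x / exp x) \<longlongrightarrow> (0::real)) at_top"
proof -
  have "((\<lambda>x. \<Sum>i\<le>degree P. coeff P i * (x ^ i / exp x)) \<longlongrightarrow> 0) at_top"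
    by (intro tendsto_null_sum tendsto_mult_right_zero tendsto_power_div_exp_0)
  then show ?thesis by (simp add: poly_altdef sum_divide_distrib)
qed

text \<open>With s = 1/t the chain rule gives s^2 (P(s) - P'(s)) exp(-s), again of the same form;
  this is the polynomial in the statement. At t = 0 the difference quotient from the right is s P(s)
  / exp s with s tending to infinity.\<close>

lemma flat_exp_has_derivative:
  "(flat_exp P has_field_derivative flat_exp ([:0, 0, 1:] * (P - pderiv P)) t) (at t)"
proof -
  consider "t > 0" | "t = 0" | "t < 0" by linarith
  then show ?thesis
  proof cases
    case 1
    have "((\<lambda>t. poly P (1 / t) * exp (- (1 / t))) has_field_derivative
            flat_exp ([:0, 0, 1:] * (P - pderiv P)) t) (at t)"
      using 1 by (auto intro!: derivative_eq_intros poly_DERIV[THEN DERIV_chain2]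
          simp: flat_exp_def power2_eq_square field_simps)
    then show ?thesis
      by (rule DERIV_cong_ev[OF refl _ refl, THEN iffD1, rotated])
         (use eventually_nhds_in_open[of "{0<..}" t] 1 in \<open>auto elim!: eventually_mono simp: flat_exp_def\<close>)
  next
    case 3
    have "((\<lambda>t. 0) has_field_derivative flat_exp ([:0, 0, 1:] * (P - pderiv P)) t) (at t)"
      using 3 by (simp add: flat_exp_def)
    then show ?thesis
      by (rule DERIV_cong_ev[OF refl _ refl, THEN iffD1, rotated])
         (use eventually_nhds_in_open[of "{..<0}" t] 3 in \<open>auto elim!: eventually_mono simp: flat_exp_def\<close>)
  next
    case 2
    have "((\<lambda>h. flat_exp P h / h) \<longlongrightarrow> 0) (at_left 0)"
      by (rule Lim_transform_eventually[OF tendsto_const])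
         (auto simp: eventually_at_filter flat_exp_def)
    moreover have "((\<lambda>h. flat_exp P h / h) \<longlongrightarrow> 0) (at_right 0)"
    proof (rule Lim_transform_eventually)
      show "((\<lambda>h. poly ([:0, 1:] * P) (inverse h) / exp (inverse h)) \<longlongrightarrow> 0) (at_right (0::real))"
        by (rule filterlim_compose[OF tendsto_poly_div_exp filterlim_inverse_at_top_right])
      show "eventually (\<lambda>h. poly ([:0, 1:] * P) (inverse h) / exp (inverse h) = flat_exp P h / h) (at_right 0)"
        by (auto simp: eventually_at_filter flat_exp_def field_simps exp_minus intro!: always_eventually)
    qed
    ultimately have "((\<lambda>h. flat_exp P h / h) \<longlongrightarrow> 0) (at 0)" by (rule filterlim_split_at_real)
    then show ?thesis using 2 by (simp add: DERIV_def flat_exp_def)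
  qed
qed

lemma C_k_flat_exp_affine: "C_k k (\<lambda>x. flat_exp P (c + w \<bullet> x))"
proof (induction k arbitrary: P)
  case 0
  have "continuous_on UNIV (flat_exp P)"
    using flat_exp_has_derivative DERIV_isCont continuous_at_imp_continuous_on by blast
  then have "continuous_on UNIV (\<lambda>x. flat_exp P (c + w \<bullet> x))"
    by (rule continuous_on_compose2) (auto intro!: continuous_intros)
  then show ?case by simp
next
  case (Suc k)
  let ?Q = "[:0, 0, 1:] * (P - pderiv P)"
  show ?case
  proof (rule C_k_SucI)
    fix x
    have "((\<lambda>x. c + w \<bullet> x) has_derivative (\<lambda>v. w \<bullet> v)) (at x)"
      by (auto intro!: derivative_eq_intros)
    moreover have "(flat_exp P has_derivative (*) (flat_exp ?Q (c + w \<bullet> x))) (at (c + w \<bullet> x))"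
      using flat_exp_has_derivative unfolding has_field_derivative_def .
    ultimately show "((\<lambda>x. flat_exp P (c + w \<bullet> x)) has_derivative (\<lambda>v. flat_exp ?Q (c + w \<bullet> x) * (w \<bullet> v))) (at x)"
      by (rule has_derivative_compose)
  next
    show "C_k k (\<lambda>x. flat_exp ?Q (c + w \<bullet> x) * (w \<bullet> v))" for v
      by (intro C_k_mult Suc C_k_const)
  qed
qed

lemma flat_exp_1: "0 \<le> flat_exp 1 t" "flat_exp 1 t \<le> 1" "t \<le> 0 \<Longrightarrow> flat_exp 1 t = 0"
  by (auto simp: flat_exp_def)

lemma flat_exp_1_tendsto: "(\<lambda>n. flat_exp 1 (real n * s)) \<longlonglongrightarrow> (if s > 0 then 1 else 0)"
proof (cases "s > 0")
  case True
  have "filterlim (\<lambda>n. real n * s) at_top sequentially"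
    using True by (intro filterlim_at_top_mult_tendsto_pos[OF tendsto_const _ filterlim_real_sequentially]) auto
  then have "(\<lambda>n. inverse (real n * s)) \<longlonglongrightarrow> 0"
    by (rule tendsto_inverse_0_at_top)
  then have "(\<lambda>n. exp (- inverse (real n * s))) \<longlonglongrightarrow> exp (- 0)"
    by (intro tendsto_intros)
  then have "(\<lambda>n. flat_exp 1 (real n * s)) \<longlonglongrightarrow> exp (- 0)"
  proof (rule Lim_transform_eventually)
    show "eventually (\<lambda>n. exp (- inverse (real n * s)) = flat_exp 1 (real n * s)) sequentially"
      using eventually_gt_at_top[of 0]
      by eventually_elim (use True in \<open>auto simp: flat_exp_def inverse_eq_divide\<close>)
  qed
  then show ?thesis using True by simp
next
  case False
  then show ?thesis by (simp add: flat_exp_1 mult_nonneg_nonpos)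
qed

text \<open>Each factor is exp(-1/(n s)), where s is the signed distance to a face; it tends to 1
  exactly when s > 0. So the bumps approximate the indicator of the open box from inside. Boxes
  generate the Borel sets, which replaces mollification later on.\<close>

definition box_bump :: "'a::euclidean_space \<Rightarrow> 'a \<Rightarrow> nat \<Rightarrow> 'a \<Rightarrow> real" where
  "box_bump a c n x =
     (\<Prod>b\<in>Basis. flat_exp 1 (real n * (x \<bullet> b - a \<bullet> b)) * flat_exp 1 (real n * (c \<bullet> b - x \<bullet> b)))"

lemma C_k_box_bump: "C_k k (box_bump a c n)"
proof -
  have 1: "C_k k (\<lambda>x. flat_exp 1 (real n * (x \<bullet> b - a \<bullet> b)))" for b
    using C_k_flat_exp_affine[of k 1 "- real n * (a \<bullet> b)" "real n *\<^sub>R b"]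
    by (simp add: algebra_simps inner_commute)
  have 2: "C_k k (\<lambda>x. flat_exp 1 (real n * (c \<bullet> b - x \<bullet> b)))" for b
    using C_k_flat_exp_affine[of k 1 "real n * (c \<bullet> b)" "- real n *\<^sub>R b"]
    by (simp add: algebra_simps inner_commute)
  show ?thesis unfolding box_bump_def[abs_def] by (intro C_k_prod C_k_mult 1 2) simp
qed

lemma box_bump_bounds: "0 \<le> box_bump a c n x" "box_bump a c n x \<le> 1"
  unfolding box_bump_def by (auto intro!: prod_nonneg prod_le_1 mult_nonneg_nonneg mult_le_one flat_exp_1)

lemma box_bump_eq_0: "x \<notin> box a c \<Longrightarrow> box_bump a c n x = 0"
proof -
  assume "x \<notin> box a c"
  then obtain b where b: "b \<in> Basis" "x \<bullet> b - a \<bullet> b \<le> 0 \<or> c \<bullet> b - x \<bullet> b \<le> 0"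
    by (auto simp: mem_box not_less)
  have "flat_exp 1 (real n * s) = 0" if "s \<le> 0" for s
    using that by (intro flat_exp_1(3)) (simp add: mult_nonneg_nonpos)
  then have "flat_exp 1 (real n * (x \<bullet> b - a \<bullet> b)) * flat_exp 1 (real n * (c \<bullet> b - x \<bullet> b)) = 0"
    using b(2) by auto
  then show ?thesis unfolding box_bump_def using b(1) by (intro prod_zero) auto
qed

lemma box_bump_tendsto: "(\<lambda>n. box_bump a c n x) \<longlonglongrightarrow> indicator (box a c) x"
proof -
  have "(\<lambda>n. box_bump a c n x) \<longlonglongrightarrow>
      (\<Prod>b\<in>Basis. (if x \<bullet> b - a \<bullet> b > 0 then 1 else 0) * (if c \<bullet> b - x \<bullet> b > 0 then 1 else 0))"
    unfolding box_bump_def by (intro tendsto_prod tendsto_mult flat_exp_1_tendsto)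
  also have "(\<Prod>b\<in>Basis. (if x \<bullet> b - a \<bullet> b > 0 then 1 else 0) * (if c \<bullet> b - x \<bullet> b > 0 then 1 else 0)) = (indicator (box a c) x :: real)"
  proof (cases "x \<in> box a c")
    case True
    then show ?thesis by (auto simp: mem_box intro!: prod.neutral)
  next
    case False
    then show ?thesis by (auto simp: mem_box intro!: prod_zero)
  qed
  finally show ?thesis .
qed

lemma test_function_box_bump:
  assumes "cbox a c \<subseteq> \<Omega>"
  shows "test_function \<Omega> (box_bump a c n)"
proof -
  have sub: "{x. box_bump a c n x \<noteq> 0} \<subseteq> cbox a c"
    using box_bump_eq_0 box_subset_cbox by blast
  then have "closure {x. box_bump a c n x \<noteq> 0} \<subseteq> cbox a c"
    by (rule closure_minimal[OF _ closed_cbox])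
  moreover have "bounded {x. box_bump a c n x \<noteq> 0}"
    using sub bounded_cbox bounded_subset by blast
  ultimately show ?thesis unfolding test_function_def
    using assms C_k_box_bump by auto
qed

section \<open>The fundamental lemma and weak derivatives\<close>

text \<open>Dynkin's argument: boxes are stable under intersection and generate the Borel sets. The
  hypothesis \<open>whole\<close> is what the complement step consumes.\<close>

lemma set_integral_zero_borel:
  fixes G :: "'a::euclidean_space \<Rightarrow> 'b::euclidean_space"
  assumes G: "integrable lebesgue G"
    and whole: "(\<integral>x. G x \<partial>lebesgue) = 0"
    and box: "\<And>a c. (\<integral>x. indicator (box a c) x *\<^sub>R G x \<partial>lebesgue) = 0"
    and A: "A \<in> sets borel"
  shows "(\<integral>x. indicator A x *\<^sub>R G x \<partial>lebesgue) = 0"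
proof -
  have "Int_stable (range (\<lambda>(a, b). box a b :: 'a set))"
    by (auto simp: Int_stable_def box_Int_box)
  moreover have "range (\<lambda>(a, b). box a b) \<subseteq> Pow (UNIV :: 'a set)" by auto
  moreover have "A \<in> sigma_sets UNIV (range (\<lambda>(a, b). box a b))"
    using A unfolding borel_eq_box by simp
  ultimately show ?thesis
  proof (induction rule: sigma_sets_induct_disjoint)
    case (basic A)
    then show ?case using box by auto
  next
    case empty
    then show ?case by simp
  next
    case (compl A)
    then have [measurable]: "A \<in> sets borel" by (simp add: borel_eq_box)
    have "(\<lambda>x. indicator (UNIV - A) x *\<^sub>R G x) = (\<lambda>x. G x - indicator A x *\<^sub>R G x)"
      by (auto simp: indicator_def)
    then show ?case
      using compl.IH whole G integrable_mult_indicator[of A lebesgue G] by simp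
  next
    case (union F)
    then have F: "\<And>i. F i \<in> sets lebesgue" by (simp add: borel_eq_box subset_eq)
    have "(LINT x:(\<Union>i. F i)|lebesgue. G x) = (\<Sum>i. (LINT x:(F i)|lebesgue. G x))"
    proof (rule lebesgue_integral_countable_add[OF F])
      show "F i \<inter> F j = {}" if "i \<noteq> j" for i j
        using union.hyps that by (auto simp: disjoint_family_on_def)
      show "set_integrable lebesgue (\<Union>i. F i) G"
        unfolding set_integrable_def using F by (intro integrable_mult_indicator G) auto
    qed
    then show ?case using union.IH by (simp add: set_lebesgue_integral_def)
  qed
qed

lemma sigma_finite_lebesgue: "sigma_finite_measure (lebesgue :: 'a::euclidean_space measure)"
proof
  obtain A :: "'a set set" where A: "countable A" "A \<subseteq> sets lborel" "\<Union>A = space lborel" "\<forall>a\<in>A. emeasure lborel a \<noteq> \<infinity>"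
    using lborel.sigma_finite_countable by auto
  then show "\<exists>A. countable A \<and> A \<subseteq> sets lebesgue \<and> \<Union>A = space (lebesgue :: 'a measure) \<and> (\<forall>a\<in>A. emeasure lebesgue a \<noteq> \<infinity>)"
    by (intro exI[of _ A]) (auto simp: subset_iff)
qed

text \<open>A Lebesgue set is an F-sigma set up to a null set, so vanishing integrals over Borel
  sets are enough.\<close>

lemma AE_zero_if_box_integrals_zero:
  fixes G :: "'a::euclidean_space \<Rightarrow> 'b::euclidean_space"
  assumes G: "integrable lebesgue G"
    and whole: "(\<integral>x. G x \<partial>lebesgue) = 0"
    and box: "\<And>a c. (\<integral>x. indicator (box a c) x *\<^sub>R G x \<partial>lebesgue) = 0"
  shows "AE x in lebesgue. G x = 0"
proof (rule sigma_finite_measure.density_zero[OF _ G])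
  show "sigma_finite_measure (lebesgue :: 'a measure)" by (rule sigma_finite_lebesgue)
  fix A :: "'a set" assume "A \<in> sets lebesgue"
  then obtain C T where CT: "fsigma C" "T \<in> null_sets lebesgue" "C \<union> T = A"
    by (metis lebesgue_set_almost_fsigma)
  have C: "C \<in> sets borel" using CT(1) by (auto elim!: fsigma.cases)
  have "(LINT x:A|lebesgue. G x) = (\<integral>x. indicator C x *\<^sub>R G x \<partial>lebesgue)"
    unfolding set_lebesgue_integral_def
  proof (rule integral_cong_AE)
    show "AE x in lebesgue. indicator A x *\<^sub>R G x = indicator C x *\<^sub>R G x"
      using AE_not_in[OF CT(2)] by eventually_elim (use CT(3) in \<open>auto simp: indicator_def\<close>)
  qed (use G C \<open>A \<in> sets lebesgue\<close> in \<open>auto intro!: borel_measurable_scaleR borel_measurable_indicator\<close>)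
  then show "(LINT x:A|lebesgue. G x) = 0"
    using set_integral_zero_borel[OF G whole box C] by simp
qed

text \<open>The fundamental lemma of the calculus of variations. Since \<open>g\<close> is only
  locally integrable, the argument is run on one closed box inside \<Omega> at a time, and countably
  many such boxes exhaust \<Omega>.\<close>

lemma AE_zero_if_test_integrals_zero:
  fixes g :: "'a::euclidean_space \<Rightarrow> 'b::euclidean_space"
  assumes \<Omega>: "open \<Omega>" and g: "locally_integrable \<Omega> g"
    and zero: "\<And>\<psi>. test_function \<Omega> \<psi> \<Longrightarrow> (\<integral>x. \<psi> x *\<^sub>R g x \<partial>lebesgue_on \<Omega>) = 0"
  shows "AE x in lebesgue_on \<Omega>. g x = 0"
proof -
  have \<Omega>m [measurable]: "\<Omega> \<in> sets lebesgue" using \<Omega> by auto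
  have int: "integrable lebesgue (\<lambda>x. indicator (cbox a c) x *\<^sub>R g x)" if "cbox a c \<subseteq> \<Omega>" for a c
    using g that unfolding locally_integrable_def set_integrable_def by auto
  \<comment> \<open>The bumps are test functions bounded by 1, so dominated convergence turns the
    vanishing test integrals into vanishing box integrals.\<close>
  have box0: "(\<integral>x. indicator (box a c) x *\<^sub>R g x \<partial>lebesgue) = 0" if sub: "cbox a c \<subseteq> \<Omega>" for a c
  proof -
    let ?G = "\<lambda>x. indicator (cbox a c) x *\<^sub>R g x"
    have "(\<lambda>n. \<integral>x. box_bump a c n x *\<^sub>R ?G x \<partial>lebesgue) \<longlonglongrightarrow> (\<integral>x. indicator (box a c) x *\<^sub>R ?G x \<partial>lebesgue)"
    proof (rule integral_dominated_convergence[where w="\<lambda>x. norm (?G x)"])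
      have "continuous_on UNIV (box_bump a c n)" for n using C_k_box_bump[of 0] by simp
      then have m: "box_bump a c n \<in> borel_measurable lebesgue" for n
        using continuous_imp_measurable_on_sets_lebesgue[of UNIV "box_bump a c n"] by simp
      show "(\<lambda>x. box_bump a c n x *\<^sub>R ?G x) \<in> borel_measurable lebesgue" for n
        by (rule borel_measurable_scaleR[OF m borel_measurable_integrable[OF int[OF sub]]])
      show "integrable lebesgue (\<lambda>x. norm (?G x))" using int[OF sub] by (rule integrable_norm)
      show "AE x in lebesgue. norm (box_bump a c n x *\<^sub>R ?G x) \<le> norm (?G x)" for n
        unfolding norm_scaleR using box_bump_bounds[of a c n] by (intro AE_I2 mult_left_le_one_le) auto
      show "AE x in lebesgue. (\<lambda>n. box_bump a c n x *\<^sub>R ?G x) \<longlonglongrightarrow> indicator (box a c) x *\<^sub>R ?G x"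
        by (intro AE_I2 tendsto_scaleR box_bump_tendsto tendsto_const)
      show "(\<lambda>x. indicator (box a c) x *\<^sub>R ?G x) \<in> borel_measurable lebesgue"
        by (rule borel_measurable_scaleR[OF borel_measurable_indicator borel_measurable_integrable[OF int[OF sub]]]) simp
    qed
    moreover have "(\<integral>x. box_bump a c n x *\<^sub>R ?G x \<partial>lebesgue) = 0" for n
    proof -
      have "(\<integral>x. box_bump a c n x *\<^sub>R ?G x \<partial>lebesgue) = (\<integral>x. indicator \<Omega> x *\<^sub>R (box_bump a c n x *\<^sub>R g x) \<partial>lebesgue)"
        using sub box_bump_eq_0[of _ a c n] box_subset_cbox[of a c]
        by (intro Bochner_Integration.integral_cong refl) (auto simp: indicator_def)
      also have "\<dots> = (\<integral>x. box_bump a c n x *\<^sub>R g x \<partial>lebesgue_on \<Omega>)"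
        by (simp add: integral_restrict_space)
      also have "\<dots> = 0" by (rule zero[OF test_function_box_bump[OF sub]])
      finally show ?thesis .
    qed
    ultimately have "(\<integral>x. indicator (box a c) x *\<^sub>R ?G x \<partial>lebesgue) = 0"
      by (simp add: LIMSEQ_const_iff)
    moreover have "(\<lambda>x. indicator (box a c) x *\<^sub>R ?G x) = (\<lambda>x. indicator (box a c) x *\<^sub>R g x)"
      using box_subset_cbox[of a c] by (auto simp: indicator_def fun_eq_iff)
    ultimately show ?thesis by (simp only:)
  qed
  \<comment> \<open>Cutting \<open>g\<close> off outside the open box makes it globally integrable;
    intersecting with another box only produces a smaller box, to which \<open>box0\<close> applies
    again.\<close>
  have AE_cbox: "AE x in lebesgue. x \<in> cbox a c \<longrightarrow> g x = 0" if sub: "cbox a c \<subseteq> \<Omega>" for a c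
  proof -
    let ?H = "\<lambda>x. indicator (box a c) x *\<^sub>R g x"
    have H: "?H x = indicator (box a c) x *\<^sub>R (indicator (cbox a c) x *\<^sub>R g x)" for x
      using box_subset_cbox[of a c] by (auto simp: indicator_def)
    have "integrable lebesgue ?H"
      unfolding H by (rule integrable_mult_indicator[OF _ int[OF sub]]) auto
    then have "AE x in lebesgue. ?H x = 0"
    proof (rule AE_zero_if_box_integrals_zero[OF _ box0[OF sub]])
      fix a' c'
      obtain a'' c'' where eq: "box a' c' \<inter> box a c = box a'' c''"
        by (auto simp: box_Int_box)
      have "(\<lambda>x. indicator (box a' c') x *\<^sub>R ?H x) = (\<lambda>x. indicator (box a'' c'') x *\<^sub>R g x)"
        unfolding eq[symmetric] by (auto simp: indicator_def)
      moreover have "(\<integral>x. indicator (box a'' c'') x *\<^sub>R g x \<partial>lebesgue) = 0"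
      proof (cases "box a'' c'' = {}")
        case False
        have "cbox a'' c'' = closure (box a'' c'')" using False by simp
        also have "\<dots> \<subseteq> cbox a c"
          unfolding eq[symmetric] by (rule closure_minimal) (use box_subset_cbox[of a c] in auto)
        finally show ?thesis using box0 sub by auto
      qed simp
      ultimately show "(\<integral>x. indicator (box a' c') x *\<^sub>R ?H x \<partial>lebesgue) = 0" by simp
    qed
    \<comment> \<open>The bumps see the open box only; its boundary is a null set.\<close>
    moreover have "AE x in lebesgue. x \<notin> cbox a c - box a c"
      using negligible_frontier_interval[of a c] by (intro AE_not_in) (simp add: negligible_iff_null_sets)
    ultimately show ?thesis by eventually_elim (auto simp: indicator_def)
  qed
  obtain \<D> where \<D>: "countable \<D>" "\<D> \<subseteq> Pow \<Omega>" "\<And>X. X \<in> \<D> \<Longrightarrow> \<exists>a b. X = cbox a b" "\<Union>\<D> = \<Omega>"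
    using open_countable_Union_open_cbox[OF \<Omega>] by metis
  have "AE x in lebesgue. \<forall>X\<in>\<D>. x \<in> X \<longrightarrow> g x = 0"
  proof (subst AE_ball_countable[OF \<D>(1)], intro ballI)
    fix X assume "X \<in> \<D>"
    then obtain a b where "X = cbox a b" "cbox a b \<subseteq> \<Omega>" using \<D>(2,3) by blast
    then show "AE x in lebesgue. x \<in> X \<longrightarrow> g x = 0" using AE_cbox by auto
  qed
  then have "AE x in lebesgue. x \<in> \<Omega> \<longrightarrow> g x = 0"
    by eventually_elim (use \<D>(4) in blast)
  then show ?thesis by (simp add: AE_restrict_space_iff)
qed

section \<open>Gradients and supports of test functions\<close>

lemma has_derivative_classical_grad:
  assumes "f differentiable (at x)"
  shows "(f has_derivative (\<lambda>v. v \<bullet> classical_grad f x)) (at x)"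
proof -
  let ?F = "frechet_derivative f (at x)"
  have F: "(f has_derivative ?F) (at x)" using assms by (simp add: frechet_derivative_works)
  then interpret bounded_linear ?F by (rule has_derivative_bounded_linear)
  let ?D = "\<Sum>b\<in>Basis. ?F b *\<^sub>R b"
  have "?F v = v \<bullet> ?D" for v
  proof -
    have "?F v = ?F (\<Sum>b\<in>Basis. (v \<bullet> b) *\<^sub>R b)" by (simp only: euclidean_representation)
    also have "\<dots> = (\<Sum>b\<in>Basis. (v \<bullet> b) *\<^sub>R ?F b)" by (simp only: sum scaleR)
    also have "\<dots> = v \<bullet> ?D" by (simp add: inner_sum_right mult.commute)
    finally show ?thesis .
  qed
  then have "?F = (\<lambda>v. v \<bullet> ?D)" by (rule ext)
  then have D: "GDERIV f x :> ?D" unfolding gderiv_def by (rule has_derivative_eq_rhs[OF F])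
  have "GDERIV f x :> classical_grad f x"
    unfolding classical_grad_def
  proof (rule theI[of "\<lambda>D. GDERIV f x :> D", OF D])
    fix E assume "GDERIV f x :> E"
    then have "(\<lambda>v. v \<bullet> E) = (\<lambda>v. v \<bullet> ?D)"
      using D unfolding gderiv_def by (rule has_derivative_unique)
    then have "\<forall>v. v \<bullet> E = v \<bullet> ?D" by (rule fun_cong[THEN allI])
    then show "E = ?D" by (rule vector_eq_ldot[THEN iffD1])
  qed
  then show ?thesis by (simp add: gderiv_def)
qed

lemma frechet_derivative_eq_classical_grad:
  "f differentiable (at x) \<Longrightarrow> frechet_derivative f (at x) v = v \<bullet> classical_grad f x"
  by (simp only: frechet_derivative_at[OF has_derivative_classical_grad, symmetric])

lemma test_functionD:
  assumes "test_function \<Omega> \<psi>"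
  shows "\<psi> differentiable (at x)" and "continuous_on UNIV \<psi>" and "continuous_on UNIV (classical_grad \<psi>)"
proof -
  have C: "C_k k \<psi>" for k using assms by (simp add: test_function_def)
  show diff: "\<psi> differentiable (at x)" for x using C[of "Suc 0"] by simp
  show "continuous_on UNIV \<psi>" using C[of 0] by simp
  have "continuous_on UNIV (\<lambda>x. classical_grad \<psi> x \<bullet> b)" for b
    using C[of "Suc 0"] by (simp add: frechet_derivative_eq_classical_grad[OF diff] inner_commute)
  then show "continuous_on UNIV (classical_grad \<psi>)" by (subst continuous_on_componentwise) blast
qed

lemma test_function_support:
  assumes \<psi>: "test_function \<Omega> \<psi>"
  obtains K where "compact K" "K \<subseteq> \<Omega>" "\<And>x. x \<notin> K \<Longrightarrow> \<psi> x = 0" "\<And>x. x \<notin> K \<Longrightarrow> classical_grad \<psi> x = 0"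
proof -
  obtain K where K: "K = closure {x. \<psi> x \<noteq> 0}" by simp
  have 0: "\<psi> x = 0" if "x \<notin> K" for x
    using that closure_subset[of "{x. \<psi> x \<noteq> 0}"] unfolding K by blast
  have cK: "compact K" "K \<subseteq> \<Omega>" using \<psi> by (auto simp: test_function_def K)
  have "classical_grad \<psi> x = 0" if x: "x \<notin> K" for x
  proof -
    \<comment> \<open>Near a point outside the closed set \<open>K\<close> the function coincides
      with zero, so uniqueness of the derivative applies.\<close>
    have "((\<lambda>x. 0) has_derivative (\<lambda>v. v \<bullet> classical_grad \<psi> x)) (at x)"
      by (rule has_derivative_transform_within_open[OF has_derivative_classical_grad[OF test_functionD(1)[OF \<psi>]], of "- K"])
         (use x 0 cK(1) in \<open>auto simp: compact_imp_closed\<close>)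
    then have "(\<lambda>v. v \<bullet> classical_grad \<psi> x) = (\<lambda>v. 0)"
      by (rule has_derivative_unique) auto
    from fun_cong[OF this, of "classical_grad \<psi> x"] show ?thesis by simp
  qed
  then show ?thesis using that 0 cK by blast
qed

lemma locally_integrable_lincomb:
  assumes "locally_integrable \<Omega> f" "locally_integrable \<Omega> g"
  shows "locally_integrable \<Omega> (\<lambda>x. a *\<^sub>R f x + b *\<^sub>R g x)"
  using assms unfolding locally_integrable_def
  by (intro allI impI set_integral_add(1)) (auto intro: absolutely_integrable_scaleR_left)

lemma integrable_imp_locally_integrable:
  assumes "integrable (lebesgue_on \<Omega>) f" "open \<Omega>"
  shows "locally_integrable \<Omega> f"
  unfolding locally_integrable_def
proof (intro allI impI)
  fix K assume K: "compact K \<and> K \<subseteq> \<Omega>"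
  have "f absolutely_integrable_on \<Omega>"
    using assms by (simp add: set_integrable_def integrable_restrict_space)
  then show "f absolutely_integrable_on K"
    by (rule set_integrable_subset) (use K in \<open>auto simp: compact_imp_closed\<close>)
qed

text \<open>The continuous factor is bounded on its compact support and the other factor is
  integrable there. The bilinear \<open>B\<close> lets one proof serve scalar times vector, vector
  times scalar and the inner product.\<close>

lemma integrable_compact_support_product:
  fixes B :: "'b::euclidean_space \<Rightarrow> 'c::euclidean_space \<Rightarrow> 'd::euclidean_space" and h :: "'a::euclidean_space \<Rightarrow> 'b"
  assumes bil: "bilinear B" and \<Omega>: "open \<Omega>" and u: "locally_integrable \<Omega> u"
    and h: "continuous_on UNIV h" and K: "compact K" "K \<subseteq> \<Omega>" "\<And>x. x \<notin> K \<Longrightarrow> h x = 0"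
  shows "integrable (lebesgue_on \<Omega>) (\<lambda>x. B (h x) (u x))"
proof -
  have Km: "K \<in> sets lebesgue" using K(1) by (simp add: compact_imp_closed)
  have "(\<lambda>x. B (h x) (u x)) absolutely_integrable_on K"
  proof (rule absolutely_integrable_bounded_measurable_product[OF bil])
    show "h \<in> borel_measurable (lebesgue_on K)"
      using h Km by (intro continuous_imp_measurable_on_sets_lebesgue) (auto intro: continuous_on_subset)
    show "bounded (h ` K)"
      using h K(1) by (intro compact_imp_bounded compact_continuous_image) (auto intro: continuous_on_subset)
    show "u absolutely_integrable_on K" using u K by (auto simp: locally_integrable_def)
  qed (rule Km)
  moreover have "(\<lambda>x. indicator K x *\<^sub>R B (h x) (u x)) = (\<lambda>x. indicator \<Omega> x *\<^sub>R B (h x) (u x))"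
  proof
    fix x
    show "indicator K x *\<^sub>R B (h x) (u x) = indicator \<Omega> x *\<^sub>R B (h x) (u x)"
      using K(2,3) bilinear_lzero[OF bil] by (cases "x \<in> K") (auto simp: indicator_def)
  qed
  ultimately have "integrable lebesgue (\<lambda>x. indicator \<Omega> x *\<^sub>R B (h x) (u x))"
    unfolding set_integrable_def by (simp only:)
  then show ?thesis using \<Omega> by (subst integrable_restrict_space) auto
qed

lemma test_function_integrable:
  assumes \<psi>: "test_function \<Omega> \<psi>" and \<Omega>: "open \<Omega>"
  shows "locally_integrable \<Omega> u \<Longrightarrow> integrable (lebesgue_on \<Omega>) (\<lambda>x. \<psi> x *\<^sub>R u x)"
    and "locally_integrable \<Omega> w \<Longrightarrow> integrable (lebesgue_on \<Omega>) (\<lambda>x. w x *\<^sub>R classical_grad \<psi> x)"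
    and "locally_integrable \<Omega> p \<Longrightarrow> integrable (lebesgue_on \<Omega>) (\<lambda>x. p x \<bullet> classical_grad \<psi> x)"
proof -
  note T = test_functionD[OF \<psi>]
  obtain K where K: "compact K" "K \<subseteq> \<Omega>" "\<And>x. x \<notin> K \<Longrightarrow> \<psi> x = 0" "\<And>x. x \<notin> K \<Longrightarrow> classical_grad \<psi> x = 0"
    using test_function_support[OF \<psi>] by metis
  show "locally_integrable \<Omega> u \<Longrightarrow> integrable (lebesgue_on \<Omega>) (\<lambda>x. \<psi> x *\<^sub>R u x)"
    by (rule integrable_compact_support_product[OF _ \<Omega> _ T(2) K(1,2,3), of scaleR])
       (simp_all add: bilinear_conv_bounded_bilinear bounded_bilinear_scaleR)
  show "locally_integrable \<Omega> w \<Longrightarrow> integrable (lebesgue_on \<Omega>) (\<lambda>x. w x *\<^sub>R classical_grad \<psi> x)"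
    by (rule integrable_compact_support_product[OF _ \<Omega> _ T(3) K(1,2,4), of "\<lambda>a b. b *\<^sub>R a"])
       (simp_all add: bilinear_conv_bounded_bilinear bounded_bilinear.flip[OF bounded_bilinear_scaleR])
  show "locally_integrable \<Omega> p \<Longrightarrow> integrable (lebesgue_on \<Omega>) (\<lambda>x. p x \<bullet> classical_grad \<psi> x)"
    by (rule integrable_compact_support_product[OF _ \<Omega> _ T(3) K(1,2,4), of "\<lambda>a b. b \<bullet> a"])
       (simp_all add: bilinear_conv_bounded_bilinear bounded_bilinear.flip[OF bounded_bilinear_inner])
qed

section \<open>Linearity and uniqueness of weak derivatives\<close>

lemma has_weak_grad_lincomb:
  assumes \<Omega>: "open \<Omega>" and u: "has_weak_grad \<Omega> u g" and v: "has_weak_grad \<Omega> v h"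
  shows "has_weak_grad \<Omega> (\<lambda>x. a * u x + b * v x) (\<lambda>x. a *\<^sub>R g x + b *\<^sub>R h x)"
proof -
  have L: "locally_integrable \<Omega> u" "locally_integrable \<Omega> g" "locally_integrable \<Omega> v" "locally_integrable \<Omega> h"
    using u v by (auto simp: has_weak_grad_def)
  have "(\<integral>x. (a * u x + b * v x) *\<^sub>R classical_grad \<psi> x \<partial>lebesgue_on \<Omega>)
      = - (\<integral>x. \<psi> x *\<^sub>R (a *\<^sub>R g x + b *\<^sub>R h x) \<partial>lebesgue_on \<Omega>)" if \<psi>: "test_function \<Omega> \<psi>" for \<psi>
  proof -
    note I = test_function_integrable[OF \<psi> \<Omega>]
    have "(\<integral>x. (a * u x + b * v x) *\<^sub>R classical_grad \<psi> x \<partial>lebesgue_on \<Omega>)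
        = (\<integral>x. a *\<^sub>R (u x *\<^sub>R classical_grad \<psi> x) + b *\<^sub>R (v x *\<^sub>R classical_grad \<psi> x) \<partial>lebesgue_on \<Omega>)"
      by (simp add: algebra_simps)
    also have "\<dots> = a *\<^sub>R (\<integral>x. u x *\<^sub>R classical_grad \<psi> x \<partial>lebesgue_on \<Omega>)
        + b *\<^sub>R (\<integral>x. v x *\<^sub>R classical_grad \<psi> x \<partial>lebesgue_on \<Omega>)"
      using I(2)[OF L(1)] I(2)[OF L(3)] by (simp del: scaleR_scaleR)
    also have "\<dots> = - (a *\<^sub>R (\<integral>x. \<psi> x *\<^sub>R g x \<partial>lebesgue_on \<Omega>) + b *\<^sub>R (\<integral>x. \<psi> x *\<^sub>R h x \<partial>lebesgue_on \<Omega>))"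
      using u v \<psi> by (simp add: has_weak_grad_def)
    also have "a *\<^sub>R (\<integral>x. \<psi> x *\<^sub>R g x \<partial>lebesgue_on \<Omega>) + b *\<^sub>R (\<integral>x. \<psi> x *\<^sub>R h x \<partial>lebesgue_on \<Omega>)
        = (\<integral>x. a *\<^sub>R (\<psi> x *\<^sub>R g x) + b *\<^sub>R (\<psi> x *\<^sub>R h x) \<partial>lebesgue_on \<Omega>)"
      using I(1)[OF L(2)] I(1)[OF L(4)] by (simp del: scaleR_scaleR)
    also have "\<dots> = (\<integral>x. \<psi> x *\<^sub>R (a *\<^sub>R g x + b *\<^sub>R h x) \<partial>lebesgue_on \<Omega>)"
      by (simp add: algebra_simps)
    finally show ?thesis .
  qed
  then show ?thesis
    using locally_integrable_lincomb[OF L(1,3), of a b] locally_integrable_lincomb[OF L(2,4), of a b]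
    by (simp add: has_weak_grad_def)
qed

text \<open>The difference of two weak gradients of \<open>u\<close> is a weak gradient of zero,
  which the fundamental lemma annihilates.\<close>

lemma has_weak_grad_unique:
  assumes \<Omega>: "open \<Omega>" and "has_weak_grad \<Omega> u g" "has_weak_grad \<Omega> u h"
  shows "AE x in lebesgue_on \<Omega>. g x = h x"
proof -
  have L: "has_weak_grad \<Omega> (\<lambda>x. 0) (\<lambda>x. g x - h x)"
    using has_weak_grad_lincomb[OF assms, of 1 "-1"] by simp
  have "AE x in lebesgue_on \<Omega>. g x - h x = 0"
    by (rule AE_zero_if_test_integrals_zero[OF \<Omega>]) (use L in \<open>auto simp: has_weak_grad_def\<close>)
  then show ?thesis by simp
qed

lemma has_weak_div_unique:
  assumes \<Omega>: "open \<Omega>" and p: "has_weak_div \<Omega> p d" "has_weak_div \<Omega> p e"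
  shows "AE x in lebesgue_on \<Omega>. d x = e x"
proof -
  have L: "locally_integrable \<Omega> d" "locally_integrable \<Omega> e" using p by (auto simp: has_weak_div_def)
  have "AE x in lebesgue_on \<Omega>. d x - e x = 0"
  proof (rule AE_zero_if_test_integrals_zero[OF \<Omega>])
    show "locally_integrable \<Omega> (\<lambda>x. d x - e x)"
      using locally_integrable_lincomb[OF L, of 1 "-1"] by simp
    fix \<psi> assume \<psi>: "test_function \<Omega> \<psi>"
    note I = test_function_integrable(1)[OF \<psi> \<Omega>]
    have "(\<integral>x. d x * \<psi> x \<partial>lebesgue_on \<Omega>) = (\<integral>x. e x * \<psi> x \<partial>lebesgue_on \<Omega>)"
      using p \<psi> by (simp add: has_weak_div_def)
    then show "(\<integral>x. \<psi> x *\<^sub>R (d x - e x) \<partial>lebesgue_on \<Omega>) = 0"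
      using I[OF L(1)] I[OF L(2)] by (simp add: right_diff_distrib mult.commute)
  qed
  then show ?thesis by simp
qed

lemma has_weak_grad_weak_grad: "has_weak_grad \<Omega> u g \<Longrightarrow> has_weak_grad \<Omega> u (weak_grad \<Omega> u)"
  unfolding weak_grad_def by (rule someI[where P="has_weak_grad \<Omega> u"])

lemma has_weak_div_weak_div: "has_weak_div \<Omega> p d \<Longrightarrow> has_weak_div \<Omega> p (weak_div \<Omega> p)"
  unfolding weak_div_def by (rule someI[where P="has_weak_div \<Omega> p"])

lemma weak_grad_AE_eq:
  "open \<Omega> \<Longrightarrow> has_weak_grad \<Omega> u g \<Longrightarrow> AE x in lebesgue_on \<Omega>. weak_grad \<Omega> u x = g x"
  by (rule has_weak_grad_unique[OF _ has_weak_grad_weak_grad])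

lemma weak_div_AE_eq:
  "open \<Omega> \<Longrightarrow> has_weak_div \<Omega> p d \<Longrightarrow> AE x in lebesgue_on \<Omega>. weak_div \<Omega> p x = d x"
  by (rule has_weak_div_unique[OF _ has_weak_div_weak_div])

text \<open>By translation invariance the difference quotients of \<open>w\<close> have integral zero.\<close>

lemma integral_directional_derivative_eq_0:
  fixes w :: "'a::euclidean_space \<Rightarrow> real"
  assumes w: "\<And>x. (w has_derivative (\<lambda>v. v \<bullet> D x)) (at x)"
    and cont: "continuous_on UNIV D"
    and K: "compact K" "\<And>x. x \<notin> K \<Longrightarrow> w x = 0" "\<And>x. x \<notin> K \<Longrightarrow> D x = 0"
  shows "(\<integral>x. v \<bullet> D x \<partial>lborel) = 0"
proof -
  have wc: "continuous_on UNIV w"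
    using w has_derivative_continuous continuous_at_imp_continuous_on by blast
  have intw: "integrable lborel w"
  proof -
    have "integrable lborel (\<lambda>x. indicator K x *\<^sub>R w x)"
      using K(1) wc by (intro borel_integrable_compact) (auto intro: continuous_on_subset)
    moreover have "(\<lambda>x. indicator K x *\<^sub>R w x) = w" using K(2) by (force simp: indicator_def fun_eq_iff)
    ultimately show ?thesis by simp
  qed
  define T where "T n = 1 / real (Suc n)" for n
  have T: "T n > 0" "T n \<le> 1" "T \<longlonglongrightarrow> 0" for n
    unfolding T_def using LIMSEQ_inverse_real_of_nat by (auto simp: inverse_eq_divide)
  let ?q = "\<lambda>n x. (w (T n *\<^sub>R v + x) - w x) / T n"
  have wm: "w \<in> borel_measurable borel" and Dm: "D \<in> borel_measurable borel"
    using wc cont by (auto intro: borel_measurable_continuous_onI)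
  have shift: "integrable lborel (\<lambda>x. w (c + x))" "(\<integral>x. w (c + x) \<partial>lborel) = (\<integral>x. w x \<partial>lborel)" for c
  proof -
    have "integrable (distr lborel borel ((+) c)) w" using intw by (simp add: lborel_distr_plus)
    then show "integrable lborel (\<lambda>x. w (c + x))" by (subst (asm) integrable_distr_eq) (use wm in auto)
    have "(\<integral>x. w x \<partial>lborel) = (\<integral>x. w x \<partial>distr lborel borel ((+) c))" by (simp add: lborel_distr_plus)
    also have "\<dots> = (\<integral>x. w (c + x) \<partial>lborel)" by (rule integral_distr) (use wm in auto)
    finally show "(\<integral>x. w (c + x) \<partial>lborel) = (\<integral>x. w x \<partial>lborel)" by simp
  qed
  have q0: "(\<integral>x. ?q n x \<partial>lborel) = 0" for n
    using intw shift by simp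
  obtain M where M: "\<And>x. \<bar>v \<bullet> D x\<bar> \<le> M"
  proof -
    have "compact ((\<lambda>x. v \<bullet> D x) ` K)"
      using K(1) cont by (intro compact_continuous_image continuous_intros) (auto intro: continuous_on_subset)
    then obtain M where M: "\<And>x. x \<in> K \<Longrightarrow> \<bar>v \<bullet> D x\<bar> \<le> M"
      using compact_imp_bounded bounded_real by (metis imageI)
    have "\<bar>v \<bullet> D x\<bar> \<le> max M 0" for x using M[of x] K(3)[of x] by (cases "x \<in> K") auto
    then show ?thesis using that by blast
  qed
  \<comment> \<open>The mean value theorem on the segment bounds all quotients by one constant,
    independent of \<open>n\<close>.\<close>
  have qM: "\<bar>?q n x\<bar> \<le> M" for n x
  proof -
    have "((\<lambda>t. w (t *\<^sub>R v + x)) has_real_derivative (v \<bullet> D (t *\<^sub>R v + x))) (at t)" for t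
    proof -
      have 1: "(w has_derivative (\<lambda>h. h \<bullet> D (t *\<^sub>R v + x))) (at (t *\<^sub>R v + x))" by (rule w)
      have 2: "((\<lambda>t. t *\<^sub>R v + x) has_derivative (\<lambda>s. s *\<^sub>R v)) (at t)"
        by (auto intro!: derivative_eq_intros)
      show ?thesis unfolding has_field_derivative_def
        by (rule has_derivative_eq_rhs[OF has_derivative_compose[OF 2 1]]) (simp add: fun_eq_iff)
    qed
    then obtain z where z: "w (T n *\<^sub>R v + x) - w (0 *\<^sub>R v + x) = (T n - 0) * (v \<bullet> D (z *\<^sub>R v + x))"
      using MVT2[of 0 "T n" "\<lambda>t. w (t *\<^sub>R v + x)" "\<lambda>t. v \<bullet> D (t *\<^sub>R v + x)"] T(1)[of n] by auto
    then have "?q n x = v \<bullet> D (z *\<^sub>R v + x)" using T(1)[of n] by simp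
    then show ?thesis using M by simp
  qed
  obtain R where R: "\<And>x. x \<in> K \<Longrightarrow> norm x \<le> R" using compact_imp_bounded[OF K(1)] bounded_iff by blast
  \<comment> \<open>Step sizes are at most 1, so enlarging \<open>K\<close> by \<open>norm v\<close>
    catches the support of every difference quotient; the constant bound is integrable on this
    ball.\<close>
  let ?B = "cball 0 (R + norm v) :: 'a set"
  have qB: "?q n x = 0" if "x \<notin> ?B" for n x
  proof -
    have x: "norm x > R + norm v" using that by simp
    have "norm x \<le> norm (T n *\<^sub>R v + x) + norm (T n *\<^sub>R v)"
      using norm_triangle_ineq4[of "T n *\<^sub>R v + x" "T n *\<^sub>R v"] by simp
    moreover have "norm (T n *\<^sub>R v) \<le> norm v" using T(1,2)[of n] by (simp add: mult_left_le_one_le)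
    ultimately have "norm (T n *\<^sub>R v + x) > R" "norm x > R" using x norm_ge_zero[of v] by linarith+
    then have "T n *\<^sub>R v + x \<notin> K" "x \<notin> K" using R by force+
    then show ?thesis using K(2) by simp
  qed
  have "(\<lambda>n. \<integral>x. ?q n x \<partial>lborel) \<longlonglongrightarrow> (\<integral>x. v \<bullet> D x \<partial>lborel)"
  proof (rule integral_dominated_convergence[where w="\<lambda>x. indicator ?B x *\<^sub>R M"])
    show "(\<lambda>x. v \<bullet> D x) \<in> borel_measurable lborel" using Dm by simp
    show "?q n \<in> borel_measurable lborel" for n
      using shift(1)[of "T n *\<^sub>R v"] intw by (intro borel_measurable_divide borel_measurable_diff) auto
    show "integrable lborel (\<lambda>x. indicator ?B x *\<^sub>R M)"
      by (intro borel_integrable_compact) auto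
    show "AE x in lborel. norm (?q n x) \<le> indicator ?B x *\<^sub>R M" for n
      using qM[of n] qB[of _ n] by (intro AE_I2) (auto simp: indicator_def simp del: mem_cball)
    show "AE x in lborel. (\<lambda>n. ?q n x) \<longlonglongrightarrow> v \<bullet> D x"
    proof (rule AE_I2)
      fix x
      have 1: "(w has_derivative (\<lambda>h. h \<bullet> D x)) (at (0 *\<^sub>R v + x))" using w by simp
      have 2: "((\<lambda>t. t *\<^sub>R v + x) has_derivative (\<lambda>s. s *\<^sub>R v)) (at 0)"
        by (auto intro!: derivative_eq_intros)
      have "((\<lambda>t. w (t *\<^sub>R v + x)) has_field_derivative (v \<bullet> D x)) (at 0)"
        unfolding has_field_derivative_def
        by (rule has_derivative_eq_rhs[OF has_derivative_compose[OF 2 1]]) (simp add: fun_eq_iff)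
      then have "((\<lambda>t. (w (t *\<^sub>R v + x) - w x) / t) \<longlongrightarrow> v \<bullet> D x) (at 0)"
        by (simp add: DERIV_def)
      moreover have "filterlim T (at 0) sequentially"
        using T unfolding filterlim_at by (auto simp: less_imp_neq[symmetric] intro!: always_eventually)
      ultimately show "(\<lambda>n. ?q n x) \<longlonglongrightarrow> v \<bullet> D x" by (rule filterlim_compose)
    qed
  qed
  then show ?thesis by (simp only: q0 LIMSEQ_const_iff)
qed

lemma continuous_locally_integrable:
  fixes f :: "'a::euclidean_space \<Rightarrow> 'b::euclidean_space"
  assumes "continuous_on UNIV f"
  shows "locally_integrable \<Omega> f"
  unfolding locally_integrable_def
proof (intro allI impI)
  fix K assume K: "compact K \<and> K \<subseteq> \<Omega>"
  have "integrable lborel (\<lambda>x. indicator K x *\<^sub>R f x)"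
    using K assms by (intro borel_integrable_compact) (auto intro: continuous_on_subset)
  then show "f absolutely_integrable_on K"
    unfolding set_integrable_def by (simp add: integrable_completion)
qed

text \<open>The field \<open>D\<close> is the gradient of the product of the two test functions, so
  its integral vanishes. The product is supported inside \<Omega>, hence the integral over \<Omega>
  is one over the whole space and no boundary term appears.\<close>

lemma has_weak_grad_test_function:
  assumes \<psi>: "test_function \<Omega> \<psi>" and \<Omega>: "open \<Omega>"
  shows "has_weak_grad \<Omega> \<psi> (classical_grad \<psi>)"
proof -
  note P = test_functionD[OF \<psi>]
  obtain K where K: "compact K" "K \<subseteq> \<Omega>" "\<And>x. x \<notin> K \<Longrightarrow> \<psi> x = 0" "\<And>x. x \<notin> K \<Longrightarrow> classical_grad \<psi> x = 0"
    using test_function_support[OF \<psi>] by metis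
  have L: "locally_integrable \<Omega> \<psi>" "locally_integrable \<Omega> (classical_grad \<psi>)"
    using P(2,3) by (auto intro: continuous_locally_integrable)
  have "(\<integral>x. \<psi> x *\<^sub>R classical_grad \<eta> x \<partial>lebesgue_on \<Omega>)
      = - (\<integral>x. \<eta> x *\<^sub>R classical_grad \<psi> x \<partial>lebesgue_on \<Omega>)" if \<eta>: "test_function \<Omega> \<eta>" for \<eta>
  proof -
    note E = test_functionD[OF \<eta>]
    define D where "D x = \<psi> x *\<^sub>R classical_grad \<eta> x + \<eta> x *\<^sub>R classical_grad \<psi> x" for x
    have I: "integrable (lebesgue_on \<Omega>) (\<lambda>x. \<psi> x *\<^sub>R classical_grad \<eta> x)"
      "integrable (lebesgue_on \<Omega>) (\<lambda>x. \<eta> x *\<^sub>R classical_grad \<psi> x)"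
      using test_function_integrable(2)[OF \<eta> \<Omega> L(1)] test_function_integrable(1)[OF \<eta> \<Omega> L(2)] by auto
    have cont: "continuous_on UNIV D" unfolding D_def
      using P(2,3) E(2,3) by (intro continuous_intros)
    have "(\<integral>x. D x \<partial>lebesgue_on \<Omega>) = (\<integral>x. D x \<partial>lebesgue)"
    proof -
      have "(\<integral>x. D x \<partial>lebesgue_on \<Omega>) = (\<integral>x. indicator \<Omega> x *\<^sub>R D x \<partial>lebesgue)"
        using \<Omega> by (simp add: integral_restrict_space)
      also have "(\<lambda>x. indicator \<Omega> x *\<^sub>R D x) = D"
        using K(2,3,4) unfolding D_def by (force simp: indicator_def fun_eq_iff)
      finally show ?thesis .
    qed
    also have "\<dots> = (\<integral>x. D x \<partial>lborel)"
      using cont by (intro integral_completion) (auto intro: borel_measurable_continuous_onI)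
    also have "\<dots> = 0"
    proof -
      have int: "integrable lborel D"
      proof -
        have "integrable lborel (\<lambda>x. indicator K x *\<^sub>R D x)"
          using K(1) cont by (intro borel_integrable_compact) (auto intro: continuous_on_subset)
        moreover have "(\<lambda>x. indicator K x *\<^sub>R D x) = D"
          using K(3,4) unfolding D_def by (force simp: indicator_def fun_eq_iff)
        ultimately show ?thesis by simp
      qed
      have "b \<bullet> (\<integral>x. D x \<partial>lborel) = 0" for b
      proof -
        have "(\<integral>x. b \<bullet> D x \<partial>lborel) = 0"
        proof (rule integral_directional_derivative_eq_0[OF _ cont K(1)])
          show "((\<lambda>x. \<psi> x * \<eta> x) has_derivative (\<lambda>v. v \<bullet> D x)) (at x)" for x
            by (rule has_derivative_eq_rhs[OF has_derivative_mult[OF has_derivative_classical_grad[OF P(1)] has_derivative_classical_grad[OF E(1)]]])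
               (simp add: D_def inner_add_right algebra_simps)
        qed (use K(3,4) in \<open>auto simp: D_def\<close>)
        then show ?thesis using int by simp
      qed
      \<comment> \<open>Pairing the vector-valued integral with itself shows that it is
        zero.\<close>
      from this[of "\<integral>x. D x \<partial>lborel"] show ?thesis by simp
    qed
    finally show ?thesis unfolding D_def using I by (simp add: eq_neg_iff_add_eq_0)
  qed
  then show ?thesis using L by (auto simp: has_weak_grad_def)
qed

section \<open>The integrand and its subdifferential\<close>

text \<open>A formula without case distinction, from which monotonicity, continuity and
  measurability are immediate.\<close>

lemma log_plus_eq: "log_plus r = ln (max 1 r)"
  by (auto simp: log_plus_def max_def)

lemma log_plus_nonneg [simp]: "0 \<le> log_plus r"
  by (simp add: log_plus_eq)

lemma log_plus_mono: "r \<le> s \<Longrightarrow> log_plus r \<le> log_plus s"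
  by (simp add: log_plus_eq)

lemma log_plus_mult_le:
  assumes "0 \<le> c" "0 \<le> r"
  shows "log_plus (c * r) \<le> log_plus c + log_plus r"
proof -
  have "max 1 (c * r) \<le> max 1 c * max 1 r"
    using assms mult_mono[of 1 "max 1 c" 1 "max 1 r"] mult_mono[of c "max 1 c" r "max 1 r"] by simp
  then have "ln (max 1 (c * r)) \<le> ln (max 1 c * max 1 r)" by (intro ln_mono) auto
  also have "\<dots> = ln (max 1 c) + ln (max 1 r)" by (rule ln_mult_pos) auto
  finally show ?thesis by (simp add: log_plus_eq)
qed

lemma log_plus_measurable [measurable]: "log_plus \<in> borel_measurable borel"
  unfolding log_plus_eq[abs_def] by measurable

lemma log_plus_ge_ln: "0 < r \<Longrightarrow> ln r \<le> log_plus r"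
  by (simp add: log_plus_def)

text \<open>For m \<ge> 1, ln m = 2 ln (sqrt m) \<le> 2 sqrt m, which squares to 4 m. This is the
  estimate that places subgradient selections in L2 when the gradient is only integrable.\<close>

lemma log_plus_sq_le: "0 \<le> r \<Longrightarrow> (log_plus r)\<^sup>2 \<le> 4 * (1 + r)"
proof -
  assume r: "0 \<le> r"
  let ?m = "max 1 r"
  have "ln ?m = 2 * ln (sqrt ?m)" by (simp add: ln_sqrt)
  also have "\<dots> \<le> 2 * sqrt ?m" using ln_le_minus_one[of "sqrt ?m"]
    by (smt (verit) max.cobounded1 real_sqrt_gt_zero)
  finally have "(log_plus r)\<^sup>2 \<le> (2 * sqrt ?m)\<^sup>2"
    unfolding log_plus_eq by (intro power_mono) auto
  also have "\<dots> = 4 * ?m" by (simp add: power_mult_distrib)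
  also have "\<dots> \<le> 4 * (1 + r)" using r by simp
  finally show ?thesis .
qed

text \<open>A bound for the norm of every subgradient at \<open>t\<close>. It comes from comparing
  \<open>phi\<close> at \<open>2 * t\<close> and at \<open>t\<close> with
  \<open>log_plus 2 \<le> 1\<close>; this explains \<open>2 * \<gamma>\<close> where the right
  derivative has \<open>\<gamma>\<close>. Its product with \<open>t\<close> is \<open>phi\<close>
  plus a linear term, so it inherits integrability.\<close>

definition slope_bound :: "real \<Rightarrow> real \<Rightarrow> ('a \<Rightarrow> real) \<Rightarrow> 'a \<Rightarrow> real \<Rightarrow> real" where
  "slope_bound \<alpha> \<gamma> \<kappa> x t = \<alpha> * (1 + 2 * \<gamma> + \<gamma> * log_plus (t / \<kappa> x))"

text \<open>The right derivative of \<open>phi\<close> in \<open>t\<close>; it jumps from \<alpha>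
  to \<alpha> (1 + \<gamma>) at \<open>t = \<kappa> x\<close>.\<close>

definition right_slope :: "real \<Rightarrow> real \<Rightarrow> ('a \<Rightarrow> real) \<Rightarrow> 'a \<Rightarrow> real \<Rightarrow> real" where
  "right_slope \<alpha> \<gamma> \<kappa> x t = (if t < \<kappa> x then \<alpha> else \<alpha> * (1 + \<gamma> + \<gamma> * log_plus (t / \<kappa> x)))"

text \<open>The element of the subdifferential of \<open>\<Phi>\<close> at \<open>z\<close> realizing the directional derivative
  in direction \<open>w\<close>; it depends on \<open>w\<close> only at the two kinks \<open>z = 0\<close> and \<open>norm z = \<kappa>\<close>.\<close>

definition dir_subgrad ::
    "real \<Rightarrow> real \<Rightarrow> ('a \<Rightarrow> real) \<Rightarrow> 'a \<Rightarrow> 'b::real_inner \<Rightarrow> 'b \<Rightarrow> 'b" where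
  "dir_subgrad \<alpha> \<gamma> \<kappa> x z w =
     (if z = 0 then \<alpha> *\<^sub>R sgn w
      else if norm z = \<kappa> x \<and> z \<bullet> w \<le> 0 then \<alpha> *\<^sub>R sgn z
      else right_slope \<alpha> \<gamma> \<kappa> x (norm z) *\<^sub>R sgn z)"

lemma inner_sgn_self: "sgn z \<bullet> z = norm (z::'b::real_inner)"
  by (cases "z = 0") (simp_all add: sgn_div_norm power2_norm_eq_inner[symmetric] power2_eq_square)

lemma norm_difference_quotient:
  fixes z w :: "'b::real_inner"
  assumes z: "z \<noteq> 0" and T: "\<And>n. T n > 0" "T \<longlonglongrightarrow> 0"
  shows "(\<lambda>n. (norm (z + T n *\<^sub>R w) - norm z) / T n) \<longlonglongrightarrow> sgn z \<bullet> w"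
proof -
  have 1: "(norm has_derivative (\<lambda>h. h \<bullet> sgn z)) (at (z + 0 *\<^sub>R w))"
    using has_derivative_norm[OF z] by simp
  have "((\<lambda>t. norm (z + t *\<^sub>R w)) has_derivative (\<lambda>t. (t *\<^sub>R w) \<bullet> sgn z)) (at 0)"
    using 1 by (intro has_derivative_compose[where f="\<lambda>t. z + t *\<^sub>R w" and g=norm]) (auto intro!: derivative_eq_intros)
  then have "((\<lambda>t. norm (z + t *\<^sub>R w)) has_field_derivative (w \<bullet> sgn z)) (at 0)"
    unfolding has_field_derivative_def by (rule has_derivative_eq_rhs) (simp add: fun_eq_iff)
  then have "((\<lambda>t. (norm (z + t *\<^sub>R w) - norm z) / t) \<longlongrightarrow> w \<bullet> sgn z) (at 0)"
    by (simp add: DERIV_def)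
  moreover have "filterlim T (at 0) sequentially"
    using T unfolding filterlim_at by (auto simp: less_imp_neq[symmetric] intro!: always_eventually)
  ultimately show ?thesis unfolding inner_commute[of "sgn z"] by (rule filterlim_compose)
qed

lemma phi_zero [simp]: "phi \<alpha> \<gamma> \<kappa> x 0 = 0"
  by (simp add: phi_def)

lemma Phi_zero [simp]: "Phi \<alpha> \<gamma> \<kappa> x 0 = 0"
  by (simp add: Phi_def)

section \<open>Growth and subgradients of the integrand at a fixed point\<close>

context
  fixes \<alpha> \<gamma> :: real and \<kappa> :: "'a \<Rightarrow> real" and x :: 'a
  assumes \<alpha>: "0 < \<alpha>" and \<gamma>: "0 < \<gamma>" and \<kappa>: "0 < \<kappa> x"
begin

lemma phi_ge: "0 \<le> t \<Longrightarrow> \<alpha> * t \<le> phi \<alpha> \<gamma> \<kappa> x t"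
  using \<alpha> \<gamma> unfolding phi_def by (intro mult_right_le_one_le[THEN order_trans] mult_left_mono[of 1 _ "\<alpha> * t", simplified]) auto

lemma phi_nonneg: "0 \<le> t \<Longrightarrow> 0 \<le> phi \<alpha> \<gamma> \<kappa> x t"
  using phi_ge[of t] \<alpha> mult_nonneg_nonneg[of \<alpha> t] by linarith

lemma phi_eq_linear: "t \<le> \<kappa> x \<Longrightarrow> phi \<alpha> \<gamma> \<kappa> x t = \<alpha> * t"
  using \<kappa> by (auto simp: phi_def log_plus_eq max_def)

lemma phi_mono: "0 \<le> s \<Longrightarrow> s \<le> t \<Longrightarrow> phi \<alpha> \<gamma> \<kappa> x s \<le> phi \<alpha> \<gamma> \<kappa> x t"
  unfolding phi_def using \<alpha> \<gamma> \<kappa>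
  by (intro mult_mono add_mono mult_left_mono log_plus_mono divide_right_mono) auto

lemma slope_bound_mono: "s \<le> t \<Longrightarrow> slope_bound \<alpha> \<gamma> \<kappa> x s \<le> slope_bound \<alpha> \<gamma> \<kappa> x t"
  unfolding slope_bound_def using \<alpha> \<gamma> \<kappa>
  by (intro mult_left_mono add_mono log_plus_mono divide_right_mono) auto

lemma slope_bound_ge: "\<alpha> \<le> slope_bound \<alpha> \<gamma> \<kappa> x t"
  unfolding slope_bound_def using \<alpha> \<gamma> by simp

lemma slope_bound_mult: "slope_bound \<alpha> \<gamma> \<kappa> x t * t = phi \<alpha> \<gamma> \<kappa> x t + 2 * \<alpha> * \<gamma> * t"
  by (simp add: slope_bound_def phi_def algebra_simps)

lemma right_slope_le: "right_slope \<alpha> \<gamma> \<kappa> x t \<le> slope_bound \<alpha> \<gamma> \<kappa> x t"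
  unfolding right_slope_def slope_bound_def using \<alpha> \<gamma> by (auto simp: algebra_simps)

lemma right_slope_pos: "0 < right_slope \<alpha> \<gamma> \<kappa> x t"
  unfolding right_slope_def using \<alpha> \<gamma> by (auto intro!: mult_pos_pos add_pos_nonneg)

text \<open>A quantitative doubling condition: \<open>log_plus\<close> is subadditive on products,
  so dilating the argument costs only a linear term. Linearity of the energy space rests on
  it.\<close>

lemma phi_scale_le:
  assumes "0 \<le> c" "0 \<le> t"
  shows "phi \<alpha> \<gamma> \<kappa> x (c * t) \<le> c * phi \<alpha> \<gamma> \<kappa> x t + \<alpha> * \<gamma> * c * log_plus c * t"
proof -
  have "log_plus (c * t / \<kappa> x) \<le> log_plus c + log_plus (t / \<kappa> x)"
    using log_plus_mult_le[of c "t / \<kappa> x"] assms \<kappa> by simp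
  then have "\<alpha> * (c * t) * (1 + \<gamma> * log_plus (c * t / \<kappa> x))
      \<le> \<alpha> * (c * t) * (1 + \<gamma> * (log_plus c + log_plus (t / \<kappa> x)))"
    using assms \<alpha> \<gamma> by (intro mult_left_mono add_left_mono) auto
  then show ?thesis by (simp add: phi_def algebra_simps)
qed

lemma phi_add_le:
  assumes "0 \<le> s" "0 \<le> t"
  shows "phi \<alpha> \<gamma> \<kappa> x (s + t) \<le> 2 * phi \<alpha> \<gamma> \<kappa> x s + 2 * phi \<alpha> \<gamma> \<kappa> x t + 2 * \<alpha> * \<gamma> * (s + t)"
proof -
  have ln2: "log_plus 2 \<le> 1" using ln_le_minus_one[of "2::real"] by (simp add: log_plus_eq)
  \<comment> \<open>Used with \<open>r\<close> the larger of the two arguments, so that the sum is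
    at most \<open>2 * r\<close>.\<close>
  have *: "phi \<alpha> \<gamma> \<kappa> x (s + t) \<le> 2 * phi \<alpha> \<gamma> \<kappa> x r + 2 * \<alpha> * \<gamma> * r"
    if "s + t \<le> 2 * r" "0 \<le> r" for r
  proof -
    have "phi \<alpha> \<gamma> \<kappa> x (s + t) \<le> phi \<alpha> \<gamma> \<kappa> x (2 * r)" using that assms by (intro phi_mono) auto
    also have "\<dots> \<le> 2 * phi \<alpha> \<gamma> \<kappa> x r + \<alpha> * \<gamma> * 2 * log_plus 2 * r" using that by (intro phi_scale_le) auto
    also have "\<alpha> * \<gamma> * 2 * log_plus 2 * r \<le> \<alpha> * \<gamma> * 2 * 1 * r"
      using ln2 that \<alpha> \<gamma> by (intro mult_right_mono mult_left_mono) auto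
    finally show ?thesis by simp
  qed
  have nn: "0 \<le> \<alpha> * \<gamma> * s" "0 \<le> \<alpha> * \<gamma> * t" using assms \<alpha> \<gamma> by auto
  show ?thesis
  proof (cases "s \<le> t")
    case True
    then show ?thesis using *[of t] assms phi_nonneg[of s] nn by (simp add: algebra_simps)
  next
    case False
    then show ?thesis using *[of s] assms phi_nonneg[of t] nn by (simp add: algebra_simps)
  qed
qed

text \<open>At \<open>t = \<kappa> x\<close> both alternatives hold and give two different slopes at
  the kink. Beyond it the inequality reduces to s (ln t - ln s) \<le> t - s, the tangent inequality
  for the logarithm.\<close>

lemma phi_subgradient:
  assumes "0 \<le> t" "0 \<le> s"
    and a: "t \<le> \<kappa> x \<and> a = \<alpha> \<or> \<kappa> x \<le> t \<and> a = \<alpha> * (1 + \<gamma> + \<gamma> * log_plus (t / \<kappa> x))"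
  shows "phi \<alpha> \<gamma> \<kappa> x t + a * (s - t) \<le> phi \<alpha> \<gamma> \<kappa> x s"
  using a
proof
  assume "t \<le> \<kappa> x \<and> a = \<alpha>"
  then show ?thesis using phi_ge[OF assms(2)] by (simp add: phi_eq_linear algebra_simps)
next
  assume t: "\<kappa> x \<le> t \<and> a = \<alpha> * (1 + \<gamma> + \<gamma> * log_plus (t / \<kappa> x))"
  then have tp: "0 < t" using \<kappa> by linarith
  have L: "log_plus (t / \<kappa> x) = ln t - ln (\<kappa> x)"
    using t tp \<kappa> by (simp add: log_plus_eq ln_div)
  have "s * (1 + ln t - ln (\<kappa> x)) - t \<le> s * log_plus (s / \<kappa> x)"
  proof (cases "s = 0")
    case False
    then have s: "0 < s" using assms by auto
    have "s * (ln t - ln s) \<le> s * (t / s - 1)"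
      using ln_le_minus_one[of "t / s"] s tp by (intro mult_left_mono) (auto simp: ln_div)
    also have "\<dots> = t - s" using s by (simp add: field_simps)
    finally have "s * (1 + ln t - ln (\<kappa> x)) - t \<le> s * (ln s - ln (\<kappa> x))" by (simp add: algebra_simps)
    also have "\<dots> \<le> s * log_plus (s / \<kappa> x)"
      using log_plus_ge_ln[of "s / \<kappa> x"] s \<kappa> by (intro mult_left_mono) (auto simp: ln_div)
    finally show ?thesis .
  qed (use tp in simp)
  then have "\<alpha> * \<gamma> * (s * (1 + ln t - ln (\<kappa> x)) - t) \<le> \<alpha> * \<gamma> * (s * log_plus (s / \<kappa> x))"
    using \<alpha> \<gamma> by (intro mult_left_mono) auto
  moreover have a: "a = \<alpha> * (1 + \<gamma> + \<gamma> * (ln t - ln (\<kappa> x)))" using t L by simp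
  ultimately show ?thesis unfolding phi_def L a by (simp add: algebra_simps)
qed

lemma right_slope_subgradient:
  "0 \<le> t \<Longrightarrow> 0 \<le> s \<Longrightarrow> phi \<alpha> \<gamma> \<kappa> x t + right_slope \<alpha> \<gamma> \<kappa> x t * (s - t) \<le> phi \<alpha> \<gamma> \<kappa> x s"
  by (rule phi_subgradient) (auto simp: right_slope_def)

section \<open>The subdifferential of the radial integrand\<close>

lemma subdifferential_Phi_radial:
  fixes z :: "'b::real_inner"
  assumes "a \<in> subdifferential {0..} (phi \<alpha> \<gamma> \<kappa> x) (norm z)" "z \<noteq> 0"
  shows "a *\<^sub>R sgn z \<in> subdifferential UNIV (Phi \<alpha> \<gamma> \<kappa> x) z"
proof -
  have a: "phi \<alpha> \<gamma> \<kappa> x (norm z) + a * (s - norm z) \<le> phi \<alpha> \<gamma> \<kappa> x s" if "0 \<le> s" for s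
    using assms(1) that by (auto simp: subdifferential_def)
  \<comment> \<open>Comparison with \<open>s = 0\<close> forces a nonnegative slope; otherwise
    multiplying the Cauchy-Schwarz estimate by \<open>a\<close> would reverse it.\<close>
  have "0 \<le> a * norm z" using a[of 0] phi_nonneg[of "norm z"] by simp
  then have a0: "0 \<le> a" using assms(2) by (simp add: zero_le_mult_iff)
  show ?thesis unfolding subdifferential_def Phi_def
  proof (intro CollectI ballI)
    fix y :: 'b
    have "sgn z \<bullet> y \<le> norm (sgn z) * norm y" by (rule norm_cauchy_schwarz)
    also have "\<dots> = norm y" using assms(2) by (simp add: norm_sgn)
    finally have "a * (sgn z \<bullet> (y - z)) \<le> a * (norm y - norm z)"
      using a0 by (intro mult_left_mono) (auto simp: inner_diff_right inner_sgn_self)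
    then show "phi \<alpha> \<gamma> \<kappa> x (norm z) + a *\<^sub>R sgn z \<bullet> (y - z) \<le> phi \<alpha> \<gamma> \<kappa> x (norm y)"
      using a[of "norm y"] by simp
  qed
qed

lemma subdifferential_Phi_zero_iff:
  fixes q :: "'b::real_inner"
  shows "q \<in> subdifferential UNIV (Phi \<alpha> \<gamma> \<kappa> x) 0 \<longleftrightarrow> norm q \<le> \<alpha>"
proof
  assume q: "q \<in> subdifferential UNIV (Phi \<alpha> \<gamma> \<kappa> x) 0"
  show "norm q \<le> \<alpha>"
  proof (cases "q = 0")
    case False
    \<comment> \<open>The point in direction \<open>q\<close> of length \<open>\<kappa> x\<close>,
      up to which \<open>phi\<close> is still linear with slope \<alpha>; testing there gives the
      sharp bound.\<close>
    let ?y = "(\<kappa> x / norm q) *\<^sub>R q"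
    have "q \<bullet> ?y \<le> phi \<alpha> \<gamma> \<kappa> x (norm ?y)" using q unfolding subdifferential_def by (auto simp: Phi_def simp del: inner_scaleR_right norm_scaleR)
    also have "norm ?y = \<kappa> x" using False \<kappa> by simp
    also have "phi \<alpha> \<gamma> \<kappa> x (\<kappa> x) = \<alpha> * \<kappa> x" by (simp add: phi_eq_linear)
    finally have "\<kappa> x * norm q \<le> \<kappa> x * \<alpha>"
      using False by (simp add: power2_norm_eq_inner[symmetric] power2_eq_square mult.commute)
    then show ?thesis using \<kappa> by simp
  qed (use \<alpha> in simp)
next
  assume q: "norm q \<le> \<alpha>"
  have "q \<bullet> y \<le> phi \<alpha> \<gamma> \<kappa> x (norm y)" for y
    using norm_cauchy_schwarz[of q y] mult_right_mono[OF q, of "norm y"] phi_ge[of "norm y"] by simp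
  then show "q \<in> subdifferential UNIV (Phi \<alpha> \<gamma> \<kappa> x) 0" by (simp add: subdifferential_def Phi_def)
qed

text \<open>Rotating \<open>z\<close> into the direction of \<open>q\<close> leaves
  \<open>Phi\<close> unchanged, so the subgradient inequality forces equality in Cauchy-Schwarz:
  \<open>q\<close> is a nonnegative multiple of \<open>z\<close>. Testing along the ray through
  \<open>z\<close> then yields the scalar subgradient.\<close>

lemma subdifferential_Phi_nonzero:
  fixes q z :: "'b::real_inner"
  assumes q: "q \<in> subdifferential UNIV (Phi \<alpha> \<gamma> \<kappa> x) z" and z: "z \<noteq> 0"
  shows "norm q \<in> subdifferential {0..} (phi \<alpha> \<gamma> \<kappa> x) (norm z)" "q = norm q *\<^sub>R sgn z"
proof -
  have sub: "phi \<alpha> \<gamma> \<kappa> x (norm z) + q \<bullet> (y - z) \<le> phi \<alpha> \<gamma> \<kappa> x (norm y)" for y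
    using q by (simp add: subdifferential_def Phi_def)
  have eq: "q \<bullet> z = norm q * norm z"
  proof (cases "q = 0")
    case False
    have "norm ((norm z / norm q) *\<^sub>R q) = norm z" using False by simp
    then have "q \<bullet> ((norm z / norm q) *\<^sub>R q) \<le> q \<bullet> z"
      using sub[of "(norm z / norm q) *\<^sub>R q"] by (simp add: inner_diff_right)
    then have "norm q * norm z \<le> q \<bullet> z"
      using False by (simp add: power2_norm_eq_inner[symmetric] power2_eq_square mult.commute)
    then show ?thesis using norm_cauchy_schwarz[of q z] by linarith
  qed simp
  then have "norm q *\<^sub>R z = norm z *\<^sub>R q" by (simp add: norm_cauchy_schwarz_eq)
  then show qq: "q = norm q *\<^sub>R sgn z" using z
    by (simp add: sgn_div_norm) (metis (no_types) inverse_eq_divide norm_eq_zero scaleR_one scaleR_scaleR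
        left_inverse mult.commute)
  show "norm q \<in> subdifferential {0..} (phi \<alpha> \<gamma> \<kappa> x) (norm z)"
    unfolding subdifferential_def
  proof (intro CollectI ballI)
    fix s :: real assume "s \<in> {0..}"
    then have n: "norm (s *\<^sub>R sgn z) = s" using z by (simp add: norm_sgn)
    have "q \<bullet> sgn z = norm q"
      using eq z by (simp add: sgn_div_norm)
    then have "q \<bullet> (s *\<^sub>R sgn z - z) = norm q * (s - norm z)"
      by (simp add: inner_diff_right eq algebra_simps)
    then show "phi \<alpha> \<gamma> \<kappa> x (norm z) + norm q \<bullet> (s - norm z) \<le> phi \<alpha> \<gamma> \<kappa> x s"
      using sub[of "s *\<^sub>R sgn z"] n by simp
  qed
qed

lemma subdifferential_Phi_iff:
  fixes q z :: "'b::real_inner"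
  shows "q \<in> subdifferential UNIV (Phi \<alpha> \<gamma> \<kappa> x) z \<longleftrightarrow>
    (z \<noteq> 0 \<longrightarrow> (\<exists>a\<in>subdifferential {0..} (phi \<alpha> \<gamma> \<kappa> x) (norm z). q = a *\<^sub>R (z /\<^sub>R norm z)))
    \<and> (z = 0 \<longrightarrow> norm q \<le> \<alpha>)"
  using subdifferential_Phi_nonzero[of q z] subdifferential_Phi_radial[of _ z]
    subdifferential_Phi_zero_iff[of q]
  unfolding sgn_div_norm by (cases "z = 0") auto

lemma subdifferential_Phi_bound:
  fixes q z :: "'b::real_inner"
  assumes q: "q \<in> subdifferential UNIV (Phi \<alpha> \<gamma> \<kappa> x) z"
  shows "norm q \<le> slope_bound \<alpha> \<gamma> \<kappa> x (norm z)"
proof (cases "z = 0")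
  case True
  then show ?thesis using q subdifferential_Phi_zero_iff[of q] slope_bound_ge order_trans by blast
next
  case False
  let ?t = "norm z"
  have t: "0 < ?t" using False by simp
  have ln2: "log_plus 2 \<le> 1" using ln_le_minus_one[of "2::real"] by (simp add: log_plus_eq)
  have "phi \<alpha> \<gamma> \<kappa> x ?t + norm q * (2 * ?t - ?t) \<le> phi \<alpha> \<gamma> \<kappa> x (2 * ?t)"
    using subdifferential_Phi_nonzero(1)[OF q False] t
    unfolding subdifferential_def by (auto dest!: bspec[of _ _ "2 * ?t"])
  also have "\<dots> \<le> 2 * phi \<alpha> \<gamma> \<kappa> x ?t + \<alpha> * \<gamma> * 2 * log_plus 2 * ?t"
    by (intro phi_scale_le) auto
  also have "\<alpha> * \<gamma> * 2 * log_plus 2 * ?t \<le> \<alpha> * \<gamma> * 2 * 1 * ?t"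
    using ln2 \<alpha> \<gamma> by (intro mult_right_mono mult_left_mono) auto
  finally have "norm q * ?t \<le> slope_bound \<alpha> \<gamma> \<kappa> x ?t * ?t"
    unfolding slope_bound_mult by simp
  then show ?thesis using t by simp
qed

section \<open>Fenchel-Young inequality and directional subgradients\<close>

lemma phi_conj_ge: "ereal (q \<bullet> y - Phi \<alpha> \<gamma> \<kappa> x y) \<le> phi_conj \<alpha> \<gamma> \<kappa> x (norm (q::'b::real_inner))"
  unfolding phi_conj_def
proof (rule SUP_upper2)
  show "norm y \<in> {0..}" by simp
  show "ereal (q \<bullet> y - Phi \<alpha> \<gamma> \<kappa> x y) \<le> ereal (norm q * norm y - phi \<alpha> \<gamma> \<kappa> x (norm y))"
    using norm_cauchy_schwarz[of q y] by (simp add: Phi_def)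
qed

text \<open>The equality case of Fenchel-Young. Among vectors of norm \<open>t\<close> the pairing
  with \<open>q\<close> is largest at \<open>t *\<^sub>R sgn q\<close>, so the scalar conjugate at
  \<open>norm q\<close> is the conjugate of \<open>Phi\<close> at \<open>q\<close>.\<close>

lemma phi_conj_le_iff_subgradient:
  fixes q z :: "'b::real_inner"
  shows "phi_conj \<alpha> \<gamma> \<kappa> x (norm q) \<le> ereal (q \<bullet> z - Phi \<alpha> \<gamma> \<kappa> x z) \<longleftrightarrow>
    q \<in> subdifferential UNIV (Phi \<alpha> \<gamma> \<kappa> x) z"
proof
  assume "phi_conj \<alpha> \<gamma> \<kappa> x (norm q) \<le> ereal (q \<bullet> z - Phi \<alpha> \<gamma> \<kappa> x z)"
  then have "ereal (q \<bullet> y - Phi \<alpha> \<gamma> \<kappa> x y) \<le> ereal (q \<bullet> z - Phi \<alpha> \<gamma> \<kappa> x z)" for y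
    using phi_conj_ge order_trans by blast
  then show "q \<in> subdifferential UNIV (Phi \<alpha> \<gamma> \<kappa> x) z"
    by (auto simp: subdifferential_def inner_diff_right algebra_simps)
next
  assume "q \<in> subdifferential UNIV (Phi \<alpha> \<gamma> \<kappa> x) z"
  then have sub: "Phi \<alpha> \<gamma> \<kappa> x z + q \<bullet> (y - z) \<le> Phi \<alpha> \<gamma> \<kappa> x y" for y
    by (simp add: subdifferential_def)
  show "phi_conj \<alpha> \<gamma> \<kappa> x (norm q) \<le> ereal (q \<bullet> z - Phi \<alpha> \<gamma> \<kappa> x z)"
    unfolding phi_conj_def
  proof (rule SUP_least)
    fix t :: real assume "t \<in> {0..}"
    then have t: "0 \<le> t" by simp
    have "norm q * t - phi \<alpha> \<gamma> \<kappa> x t \<le> q \<bullet> z - Phi \<alpha> \<gamma> \<kappa> x z"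
    proof (cases "q = 0")
      case True
      then show ?thesis using sub[of 0] phi_nonneg[OF t] by simp
    next
      case False
      have "norm (t *\<^sub>R sgn q) = t" using False t by (simp add: norm_sgn)
      then show ?thesis using sub[of "t *\<^sub>R sgn q"] inner_sgn_self[of q]
        by (simp add: inner_diff_right Phi_def inner_commute algebra_simps)
    qed
    then show "ereal (norm q * t - phi \<alpha> \<gamma> \<kappa> x t) \<le> ereal (q \<bullet> z - Phi \<alpha> \<gamma> \<kappa> x z)" by simp
  qed
qed

lemma dir_subgrad_in:
  fixes z w :: "'b::real_inner"
  shows "dir_subgrad \<alpha> \<gamma> \<kappa> x z w \<in> subdifferential UNIV (Phi \<alpha> \<gamma> \<kappa> x) z"
proof (cases "z = 0")
  case True
  then show ?thesis using \<alpha> by (simp add: dir_subgrad_def subdifferential_Phi_zero_iff norm_sgn)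
next
  case False
  let ?a = "if norm z = \<kappa> x \<and> z \<bullet> w \<le> 0 then \<alpha> else right_slope \<alpha> \<gamma> \<kappa> x (norm z)"
  have "phi \<alpha> \<gamma> \<kappa> x (norm z) + ?a * (s - norm z) \<le> phi \<alpha> \<gamma> \<kappa> x s" if "0 \<le> s" for s
    using that right_slope_subgradient[of "norm z" s]
    by (cases "norm z = \<kappa> x \<and> z \<bullet> w \<le> 0") (use \<kappa> in \<open>auto intro!: phi_subgradient\<close>)
  then have "?a \<in> subdifferential {0..} (phi \<alpha> \<gamma> \<kappa> x) (norm z)"
    by (simp add: subdifferential_def)
  from subdifferential_Phi_radial[OF this False] show ?thesis
    using False by (auto simp: dir_subgrad_def)
qed

text \<open>The slope is taken at the perturbed point because, by convexity, it bounds the increment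
  of \<open>phi\<close> from above. Its limit depends on the side from which the norm approaches
  \<open>\<kappa> x\<close>, hence the cases.\<close>

lemma dir_subgrad_limit:
  fixes z w :: "'b::real_inner"
  assumes T: "\<And>n. T n > 0" "\<And>n. T n \<le> 1" "T \<longlonglongrightarrow> 0"
  shows "(\<lambda>n. right_slope \<alpha> \<gamma> \<kappa> x (norm (z + T n *\<^sub>R w)) * ((norm (z + T n *\<^sub>R w) - norm z) / T n))
           \<longlonglongrightarrow> dir_subgrad \<alpha> \<gamma> \<kappa> x z w \<bullet> w"
proof -
  let ?N = "\<lambda>n. norm (z + T n *\<^sub>R w)"
  let ?s = "right_slope \<alpha> \<gamma> \<kappa> x"
  let ?Q = "\<lambda>n. (?N n - norm z) / T n"
  have N: "?N \<longlonglongrightarrow> norm z"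
    using T(3) by (auto intro!: tendsto_eq_intros)
  have above: "(\<lambda>n. ?s (?N n)) \<longlonglongrightarrow> \<alpha> * (1 + \<gamma> + \<gamma> * log_plus (norm z / \<kappa> x))"
    if ev: "eventually (\<lambda>n. \<kappa> x \<le> ?N n) sequentially"
  proof -
    have "(\<lambda>n. \<alpha> * (1 + \<gamma> + \<gamma> * log_plus (?N n / \<kappa> x))) \<longlonglongrightarrow> \<alpha> * (1 + \<gamma> + \<gamma> * log_plus (norm z / \<kappa> x))"
      unfolding log_plus_eq using \<kappa> N by (auto intro!: tendsto_intros)
    then show ?thesis
      by (rule Lim_transform_eventually) (use ev in eventually_elim, auto simp: right_slope_def)
  qed
  have below: "(\<lambda>n. ?s (?N n)) \<longlonglongrightarrow> \<alpha>" if ev: "eventually (\<lambda>n. ?N n < \<kappa> x) sequentially"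
    by (rule Lim_transform_eventually[OF tendsto_const])
       (use ev in eventually_elim, auto simp: right_slope_def)
  show ?thesis
  proof (cases "z = 0")
    case True
    have "eventually (\<lambda>n. ?N n < \<kappa> x) sequentially"
      using order_tendstoD(2)[OF N, of "\<kappa> x"] \<kappa> True by auto
    from tendsto_mult[OF below[OF this] tendsto_const[of "norm w"]] show ?thesis
      using True T(1) by (simp add: dir_subgrad_def inner_sgn_self less_imp_le less_imp_neq[symmetric] order_less_imp_not_eq2)
  next
    case False
    have Q: "?Q \<longlonglongrightarrow> sgn z \<bullet> w" by (rule norm_difference_quotient[OF False T(1,3)])
    have sgn: "sgn z \<bullet> w = (z \<bullet> w) / norm z" by (simp add: sgn_div_norm divide_inverse_commute)
    consider "norm z < \<kappa> x" | "norm z > \<kappa> x" | "norm z = \<kappa> x" "z \<bullet> w > 0"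
      | "norm z = \<kappa> x" "z \<bullet> w < 0" | "norm z = \<kappa> x" "z \<bullet> w = 0" by linarith
    then show ?thesis
    proof cases
      case 1
      from tendsto_mult[OF below[OF order_tendstoD(2)[OF N 1]] Q] show ?thesis
        using False 1 by (simp add: dir_subgrad_def right_slope_def)
    next
      case 2
      have "eventually (\<lambda>n. \<kappa> x \<le> ?N n) sequentially"
        using order_tendstoD(1)[OF N 2] by eventually_elim simp
      from tendsto_mult[OF above[OF this] Q] show ?thesis
        using False 2 by (simp add: dir_subgrad_def right_slope_def)
    next
      case 3
      have "eventually (\<lambda>n. 0 < ?Q n) sequentially"
        by (rule order_tendstoD(1)[OF Q]) (use 3 \<kappa> in \<open>simp add: sgn\<close>)
      then have "eventually (\<lambda>n. \<kappa> x \<le> ?N n) sequentially"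
        by eventually_elim (use T(1) 3 in \<open>auto simp: zero_less_divide_iff dest: less_asym\<close>)
      from tendsto_mult[OF above[OF this] Q] show ?thesis
        using False 3 by (simp add: dir_subgrad_def right_slope_def)
    next
      case 4
      have "eventually (\<lambda>n. ?Q n < 0) sequentially"
        by (rule order_tendstoD(2)[OF Q]) (use 4 \<kappa> in \<open>simp add: sgn divide_neg_pos\<close>)
      then have "eventually (\<lambda>n. ?N n < \<kappa> x) sequentially"
        by eventually_elim (use T(1) 4 in \<open>auto simp: divide_less_0_iff dest: less_asym\<close>)
      from tendsto_mult[OF below[OF this] Q] show ?thesis
        using False 4 by (simp add: dir_subgrad_def)
    next
      case 5
      \<comment> \<open>In a tangential direction the norm quotient tends to 0, so boundedness of
        the slopes is enough.\<close>
      have Q0: "?Q \<longlonglongrightarrow> 0" using Q 5 by (simp add: sgn)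
      have bd: "norm (?s (?N n)) \<le> slope_bound \<alpha> \<gamma> \<kappa> x (norm z + norm w)" for n
      proof -
        have "?N n \<le> norm z + norm (T n *\<^sub>R w)" by (rule norm_triangle_ineq)
        also have "norm (T n *\<^sub>R w) \<le> norm w" using T(1)[of n] T(2)[of n] by (simp add: mult_left_le_one_le)
        finally have "?N n \<le> norm z + norm w" by simp
        then show ?thesis
          using right_slope_le[of "?N n"] slope_bound_mono[of "?N n" "norm z + norm w"] right_slope_pos[of "?N n"] by simp
      qed
      have "(\<lambda>n. ?s (?N n) * ?Q n) \<longlonglongrightarrow> 0"
      proof (rule Lim_null_comparison)
        show "(\<lambda>n. slope_bound \<alpha> \<gamma> \<kappa> x (norm z + norm w) * norm (?Q n)) \<longlonglongrightarrow> 0"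
          by (intro tendsto_mult_right_zero tendsto_norm_zero Q0)
        show "eventually (\<lambda>n. norm (?s (?N n) * ?Q n) \<le> slope_bound \<alpha> \<gamma> \<kappa> x (norm z + norm w) * norm (?Q n)) sequentially"
          unfolding norm_mult by (intro always_eventually allI mult_right_mono bd norm_ge_zero)
      qed
      then show ?thesis using False 5 by (simp add: dir_subgrad_def sgn)
    qed
  qed
qed

end

section \<open>Minimax and compactness\<close>

text \<open>If the infimum of \<open>\<Sum>v. (L v q)\<^sup>2\<close> were positive, the coefficients \<open>- L v q\<close> at a near-minimizer \<open>q\<close>
  would select a descent direction.\<close>

lemma finite_minimax_approx:
  fixes L :: "'v \<Rightarrow> 'c \<Rightarrow> real"
  assumes fin: "finite F" and e: "e > 0"
    and mix: "\<And>q r t. q \<in> C \<Longrightarrow> r \<in> C \<Longrightarrow> 0 \<le> t \<Longrightarrow> t \<le> 1 \<Longrightarrow>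
                \<exists>s\<in>C. \<forall>v\<in>F. L v s = (1 - t) * L v q + t * L v r"
    and bnd: "\<And>v. v \<in> F \<Longrightarrow> \<exists>M. \<forall>q\<in>C. \<bar>L v q\<bar> \<le> M"
    and ex: "\<And>c. \<exists>q\<in>C. (\<Sum>v\<in>F. c v * L v q) \<ge> 0"
  shows "\<exists>q\<in>C. \<forall>v\<in>F. \<bar>L v q\<bar> \<le> e"
proof (rule ccontr)
  assume contra: "\<not> ?thesis"
  define g where "g q = (\<Sum>v\<in>F. (L v q)\<^sup>2)" for q
  define m where "m = (INF q\<in>C. g q)"
  obtain M where M: "\<And>v q. v \<in> F \<Longrightarrow> q \<in> C \<Longrightarrow> \<bar>L v q\<bar> \<le> M v"
    using bnd by metis
  \<comment> \<open>\<open>B\<close> bounds the quadratic term for every pair in \<open>C\<close>;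
    the summand 1 keeps it positive, so that dividing by it below is legitimate.\<close>
  define B where "B = 1 + (\<Sum>v\<in>F. (2 * M v)\<^sup>2)"
  have B: "B > 0" unfolding B_def by (simp add: add_pos_nonneg sum_nonneg)
  have ne: "C \<noteq> {}" using ex[of "\<lambda>_. 0"] by auto
  have g_ge: "g q \<ge> e\<^sup>2" if "q \<in> C" for q
  proof -
    have "\<exists>v\<in>F. \<not> \<bar>L v q\<bar> \<le> e" using contra that by blast
    then obtain v where v: "v \<in> F" "\<bar>L v q\<bar> > e" by (auto simp: not_le)
    have "e\<^sup>2 \<le> (L v q)\<^sup>2" using v(2) e by (metis abs_le_square_iff abs_of_pos less_imp_le)
    also have "\<dots> \<le> g q" unfolding g_def using fin v(1) by (intro member_le_sum) auto
    finally show ?thesis .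
  qed
  have bdd: "bdd_below (g ` C)" using g_ge by (intro bdd_belowI[of _ "e\<^sup>2"]) auto
  \<comment> \<open>Moving from \<open>q\<close> towards \<open>s\<close> by \<open>t\<close> gains
    at least 2 t e^2 and costs at most t^2 B. This choice makes the cost at most t e^2, so the net
    decrease is t e^2, exactly the tolerance with which \<open>q\<close> is chosen below.\<close>
  define t where "t = min 1 (e\<^sup>2 / B)"
  have t: "0 < t" "t \<le> 1" "t * B \<le> e\<^sup>2"
    using B e by (auto simp: t_def min_def field_simps)
  have "\<exists>q\<in>C. g q < m + t * e\<^sup>2"
    unfolding m_def using t e bdd ne cINF_less_iff[of C g "Inf (g ` C) + t * e\<^sup>2"] by auto
  then obtain q where q: "q \<in> C" "g q < m + t * e\<^sup>2" by auto
  obtain s where s: "s \<in> C" "(\<Sum>v\<in>F. - L v q * L v s) \<ge> 0" using ex[of "\<lambda>v. - L v q"] by auto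
  obtain r where r: "r \<in> C" "\<And>v. v \<in> F \<Longrightarrow> L v r = (1 - t) * L v q + t * L v s"
    using mix[OF q(1) s(1), of t] t by auto
  have *: "(\<Sum>v\<in>F. (L v s - L v q)\<^sup>2) \<le> B"
  proof -
    have "(\<Sum>v\<in>F. (L v s - L v q)\<^sup>2) \<le> (\<Sum>v\<in>F. (2 * M v)\<^sup>2)"
    proof (rule sum_mono)
      fix v assume v: "v \<in> F"
      have "\<bar>L v s - L v q\<bar> \<le> 2 * M v" using M[OF v s(1)] M[OF v q(1)] by linarith
      then show "(L v s - L v q)\<^sup>2 \<le> (2 * M v)\<^sup>2"
        by (metis abs_le_square_iff abs_ge_self order_trans)
    qed
    then show ?thesis unfolding B_def by simp
  qed
  have "m \<le> g r" unfolding m_def using bdd r(1) by (rule cINF_lower)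
  also have "g r = (\<Sum>v\<in>F. (L v q)\<^sup>2 - 2 * t * (L v q)\<^sup>2 - 2 * t * (- L v q * L v s) + t\<^sup>2 * (L v s - L v q)\<^sup>2)"
    unfolding g_def by (intro sum.cong refl) (simp add: r power2_eq_square algebra_simps)
  also have "\<dots> = g q - 2 * t * g q - 2 * t * (\<Sum>v\<in>F. - L v q * L v s) + t\<^sup>2 * (\<Sum>v\<in>F. (L v s - L v q)\<^sup>2)"
    unfolding g_def by (simp add: sum.distrib sum_subtractf sum_distrib_left sum_negf mult.assoc)
  also have "\<dots> \<le> g q - 2 * t * e\<^sup>2 - 0 + t\<^sup>2 * B"
    using t g_ge[OF q(1)] s(2) * by (intro add_mono diff_mono mult_left_mono order_refl) auto
  also have "\<dots> \<le> g q - t * e\<^sup>2"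
    using mult_left_mono[OF t(3), of t] t by (simp add: power2_eq_square algebra_simps)
  finally show False using q(2) by simp
qed

lemma parallelogram_norm:
  fixes a b :: "'b::real_inner"
  shows "(norm (a - b))\<^sup>2 = 2 * (norm a)\<^sup>2 + 2 * (norm b)\<^sup>2 - 4 * (norm ((1/2) *\<^sub>R (a + b)))\<^sup>2"
  unfolding power2_norm_eq_inner by (simp add: inner_simps inner_commute field_simps)

text \<open>A substitute for weak compactness: elements of almost minimal norm in growing finite
  intersections form a Cauchy sequence by the parallelogram identity.\<close>

lemma L2_dominated_fip:
  fixes C :: "('a \<Rightarrow> 'b::euclidean_space) set" and P :: "'i \<Rightarrow> ('a \<Rightarrow> 'b) \<Rightarrow> bool" and B :: "'a \<Rightarrow> real"
  assumes M: "finite_measure M"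
    and meas: "\<And>q. q \<in> C \<Longrightarrow> q \<in> borel_measurable M"
    and dom: "\<And>q. q \<in> C \<Longrightarrow> AE x in M. norm (q x) \<le> B x"
    and B: "integrable M (\<lambda>x. (B x)\<^sup>2)"
    and midC: "\<And>q r. q \<in> C \<Longrightarrow> r \<in> C \<Longrightarrow> (\<lambda>x. (1/2) *\<^sub>R (q x + r x)) \<in> C"
    and midP: "\<And>i q r. i \<in> I \<Longrightarrow> q \<in> C \<Longrightarrow> r \<in> C \<Longrightarrow> P i q \<Longrightarrow> P i r \<Longrightarrow> P i (\<lambda>x. (1/2) *\<^sub>R (q x + r x))"
    and closedC: "\<And>q r. (\<And>n::nat. q n \<in> C) \<Longrightarrow> r \<in> borel_measurable M \<Longrightarrow>
                    (AE x in M. (\<lambda>n. q n x) \<longlonglongrightarrow> r x) \<Longrightarrow> r \<in> C"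
    and closedP: "\<And>i q r. i \<in> I \<Longrightarrow> (\<And>n::nat. q n \<in> C) \<Longrightarrow> (\<And>n. P i (q n)) \<Longrightarrow> r \<in> C \<Longrightarrow>
                    (AE x in M. (\<lambda>n. q n x) \<longlonglongrightarrow> r x) \<Longrightarrow> P i r"
    and fip: "\<And>F. finite F \<Longrightarrow> F \<subseteq> I \<Longrightarrow> \<exists>q\<in>C. \<forall>i\<in>F. P i q"
  shows "\<exists>r\<in>C. \<forall>i\<in>I. P i r"
proof -
  interpret finite_measure M by (rule M)
  define N where "N q = (\<integral>x. (norm (q x))\<^sup>2 \<partial>M)" for q :: "'a \<Rightarrow> 'b"
  define S where "S F = {q \<in> C. \<forall>i\<in>F. P i q}" for F
  define d where "d F = (INF q\<in>S F. N q)" for F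
  define \<F> where "\<F> = {F. finite F \<and> F \<subseteq> I}"
  have int2: "integrable M (\<lambda>x. (norm (q x))\<^sup>2)" if "q \<in> C" for q
  proof (rule Bochner_Integration.integrable_bound[OF B])
    show "(\<lambda>x. (norm (q x))\<^sup>2) \<in> borel_measurable M" using meas[OF that] by measurable
    show "AE x in M. norm ((norm (q x))\<^sup>2) \<le> norm ((B x)\<^sup>2)"
      using dom[OF that] by eventually_elim (auto intro!: power_mono)
  qed
  have N0: "N q \<ge> 0" for q unfolding N_def by (intro integral_nonneg_AE) auto
  have NB: "N q \<le> (\<integral>x. (B x)\<^sup>2 \<partial>M)" if "q \<in> C" for q
    unfolding N_def
  proof (rule integral_mono_AE[OF int2[OF that] B])
    show "AE x in M. (norm (q x))\<^sup>2 \<le> (B x)\<^sup>2"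
      using dom[OF that] by eventually_elim (auto intro!: power_mono)
  qed
  have bdd: "bdd_below (N ` S F)" for F using N0 by (intro bdd_belowI[of _ 0]) auto
  have neS: "S F \<noteq> {}" if "F \<in> \<F>" for F using fip[of F] that unfolding S_def \<F>_def by auto
  have near: "\<exists>q\<in>S F. N q < d F + e" if "F \<in> \<F>" "e > 0" for F e
    using cINF_less_iff[OF neS[OF that(1)] bdd[of F], of "d F + e"] that(2) unfolding d_def by auto
  have dB: "d F \<le> (\<integral>x. (B x)\<^sup>2 \<partial>M)" if F: "F \<in> \<F>" for F
  proof -
    obtain q where q: "q \<in> S F" using neS[OF F] by auto
    have "d F \<le> N q" unfolding d_def using bdd q by (rule cINF_lower)
    also have "\<dots> \<le> (\<integral>x. (B x)\<^sup>2 \<partial>M)" using NB q unfolding S_def by auto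
    finally show ?thesis .
  qed
  define D where "D = (SUP F\<in>\<F>. d F)"
  have bddD: "bdd_above (d ` \<F>)" using dB by (intro bdd_aboveI2) auto
  have dD: "d F \<le> D" if "F \<in> \<F>" for F unfolding D_def using bddD that by (rule cSUP_upper2) simp
  have neF: "\<F> \<noteq> {}" unfolding \<F>_def by auto
  have "\<exists>F\<in>\<F>. D - e < d F" if "e > 0" for e
    using less_cSUP_iff[OF neF bddD, of "D - e"] that unfolding D_def by auto
  then have "\<forall>n. \<exists>F\<in>\<F>. D - 1 / Suc n < d F" by (auto simp del: of_nat_Suc)
  then obtain H where H: "\<And>n. H n \<in> \<F>" "\<And>n. D - 1 / Suc n < d (H n)" by metis
  \<comment> \<open>Accumulating the sets makes the constraints nested, and the minimal norms stay
    within \<open>1 / Suc n\<close> of their supremum \<open>D\<close>.\<close>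
  define G where "G n = (\<Union>k\<le>n. H k)" for n
  have G: "G n \<in> \<F>" for n using H(1) unfolding G_def \<F>_def by auto
  have Gmono: "G n \<subseteq> G m" if "n \<le> m" for n m using that unfolding G_def by force
  have Smono: "S E \<subseteq> S F" if "F \<subseteq> E" for E F using that unfolding S_def by auto
  have dmono: "d F \<le> d E" if "F \<subseteq> E" "E \<in> \<F>" for E F
    unfolding d_def using neS[OF that(2)] bdd Smono[OF that(1)] by (intro cINF_superset_mono) auto
  have dG: "D - 1 / Suc n < d (G n)" for n
    using H(2)[of n] dmono[OF _ G, of "H n" n] unfolding G_def by force
  \<comment> \<open>With e = 1 / (n + 1) the parallelogram identity gives 2 (D + e) + 2 (D + e) - 4
    (D - e) = 8 e, because the midpoint still satisfies the constraints.\<close>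
  have N_diff: "N (\<lambda>x. q x - r x) \<le> 8 / Suc n"
    if "q \<in> S (G n)" "r \<in> S (G n)" "N q < D + 1 / Suc n" "N r < D + 1 / Suc n" for q r n
  proof -
    let ?m = "\<lambda>x. (1/2) *\<^sub>R (q x + r x)"
    have C: "q \<in> C" "r \<in> C" using that unfolding S_def by auto
    have "\<forall>i\<in>G n. i \<in> I" using G unfolding \<F>_def by auto
    then have m: "?m \<in> S (G n)" using that midC midP unfolding S_def by auto
    have "?m \<in> C" using C midC by auto
    have "d (G n) \<le> N ?m" unfolding d_def using bdd m by (rule cINF_lower)
    then have "D - 1 / Suc n < N ?m" using dG[of n] by simp
    moreover have "N (\<lambda>x. q x - r x) = 2 * N q + 2 * N r - 4 * N ?m"
      unfolding N_def parallelogram_norm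
      using int2[OF C(1)] int2[OF C(2)] int2[OF \<open>?m \<in> C\<close>] by simp
    moreover have "8 / real (Suc n) = 8 * (1 / real (Suc n))" by simp
    ultimately show ?thesis using that by linarith
  qed
  \<comment> \<open>Smallness is passed to the L1 norm, where almost everywhere convergent
    subsequences are extracted: a \<le> \<delta> + a^2 / \<delta>, and finiteness of the measure
    controls the constant.\<close>
  have L1: "(\<integral>x. norm (q x - r x) \<partial>M) \<le> \<delta> * measure M (space M) + N (\<lambda>x. q x - r x) / \<delta>"
    if "q \<in> C" "r \<in> C" "\<delta> > 0" for q r \<delta>
  proof -
    have i: "integrable M (\<lambda>x. (norm (q x - r x))\<^sup>2)"
      unfolding parallelogram_norm using int2[OF that(1)] int2[OF that(2)] int2[OF midC[OF that(1,2)]] by simp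
    have bd: "norm (q x - r x) \<le> \<delta> + (norm (q x - r x))\<^sup>2 / \<delta>" for x
    proof -
      have "0 \<le> (norm (q x - r x) - \<delta>)\<^sup>2 + \<delta> * norm (q x - r x)" using that(3) by simp
      then have "\<delta> * norm (q x - r x) \<le> \<delta>\<^sup>2 + (norm (q x - r x))\<^sup>2" by (simp add: power2_eq_square algebra_simps)
      then show ?thesis using that(3) by (simp add: field_simps power2_eq_square)
    qed
    have "(\<integral>x. norm (q x - r x) \<partial>M) \<le> (\<integral>x. \<delta> + (norm (q x - r x))\<^sup>2 / \<delta> \<partial>M)"
      using i bd that(3) by (intro Bochner_Integration.integral_mono') auto
    also have "\<dots> = \<delta> * measure M (space M) + N (\<lambda>x. q x - r x) / \<delta>"
      using i unfolding N_def by simp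
    finally show ?thesis .
  qed
  have L1_small: "\<exists>n0. \<forall>n\<ge>n0. \<forall>q r. q \<in> S (G n) \<longrightarrow> r \<in> S (G n) \<longrightarrow> N q < D + 1 / Suc n \<longrightarrow> N r < D + 1 / Suc n \<longrightarrow>
      (\<integral>x. norm (q x - r x) \<partial>M) < e" if e: "e > 0" for e
  proof -
    define \<delta> where "\<delta> = e / (2 * (measure M (space M) + 1))"
    have pos: "measure M (space M) + 1 > 0" by (simp add: add_nonneg_pos)
    have \<delta>: "\<delta> > 0" unfolding \<delta>_def using e pos by simp
    have \<delta>2: "\<delta> * measure M (space M) < e / 2"
      unfolding \<delta>_def using e pos by (simp add: field_simps)
    obtain n0 where n0: "8 / (\<delta> * (e/2)) < real n0" using reals_Archimedean2 by blast
    show ?thesis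
    proof (intro exI[of _ n0] allI impI)
      fix n q r
      assume n: "n \<ge> n0" and qr: "q \<in> S (G n)" "r \<in> S (G n)" "N q < D + 1 / Suc n" "N r < D + 1 / Suc n"
      have "8 / (\<delta> * (e/2)) < real (Suc n)" using n0 n by linarith
      then have "8 < real (Suc n) * (\<delta> * (e / 2))" using \<delta> e by (simp add: pos_divide_less_eq del: of_nat_Suc)
      then have "8 / Suc n / \<delta> < e / 2" using \<delta> e
        by (simp add: pos_divide_less_eq mult_ac del: of_nat_Suc)
      moreover have "N (\<lambda>x. q x - r x) / \<delta> \<le> 8 / Suc n / \<delta>"
        using N_diff[OF qr] \<delta> by (intro divide_right_mono) auto
      moreover have "q \<in> C" "r \<in> C" using qr unfolding S_def by auto
      ultimately show "(\<integral>x. norm (q x - r x) \<partial>M) < e"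
        using L1[of q r, OF _ _ \<delta>] \<delta>2 by linarith
    qed
  qed
  have "\<forall>n. \<exists>q\<in>S (G n). N q < D + 1 / Suc n"
  proof
    fix n
    show "\<exists>q\<in>S (G n). N q < D + 1 / Suc n"
      using near[OF G, of "1 / Suc n" n] dD[OF G, of n] by force
  qed
  then obtain s where s: "\<And>n. s n \<in> S (G n)" "\<And>n. N (s n) < D + 1 / Suc n" by metis
  have sC: "s n \<in> C" for n using s(1) unfolding S_def by auto
  have int1: "integrable M q" if "q \<in> C" for q
  proof (rule Bochner_Integration.integrable_bound[of _ "\<lambda>x. 1 + (norm (q x))\<^sup>2"])
    have "norm (q x) \<le> 1 + (norm (q x))\<^sup>2" for x
    proof -
      have "0 \<le> (norm (q x) - 1)\<^sup>2 + norm (q x)" by simp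
      then show ?thesis by (simp add: power2_eq_square algebra_simps)
    qed
    then show "AE x in M. norm (q x) \<le> norm (1 + (norm (q x))\<^sup>2)" by (intro AE_I2) (simp add: order_trans[OF _ abs_ge_self])
  qed (use int2[OF that] meas[OF that] in auto)
  have "\<exists>N0. \<forall>i\<ge>N0. \<forall>j\<ge>N0. (\<integral>x. norm (s i x - s j x) \<partial>M) < e" if "e > 0" for e
  proof -
    obtain n0 where n0: "\<And>n q r. n \<ge> n0 \<Longrightarrow> q \<in> S (G n) \<Longrightarrow> r \<in> S (G n) \<Longrightarrow> N q < D + 1 / Suc n \<Longrightarrow> N r < D + 1 / Suc n
       \<Longrightarrow> (\<integral>x. norm (q x - r x) \<partial>M) < e" using L1_small[OF \<open>e > 0\<close>] by metis
    have "s i \<in> S (G n0)" "N (s i) < D + 1 / Suc n0" if "i \<ge> n0" for i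
    proof -
      show "s i \<in> S (G n0)" using s(1)[of i] Smono[OF Gmono[OF that]] by auto
      have "1 / Suc i \<le> 1 / Suc n0" using that by (simp add: frac_le)
      then show "N (s i) < D + 1 / Suc n0" using s(2)[of i] by linarith
    qed
    then show ?thesis using n0[of n0] by blast
  qed
  then obtain \<rho> where \<rho>: "strict_mono \<rho>" "AE x in M. Cauchy (\<lambda>i. s (\<rho> i) x)"
    using cauchy_L1_AE_cauchy_subseq[of M s] int1 sC by metis
  define r where "r x = lim (\<lambda>i. s (\<rho> i) x)" for x
  have rm: "r \<in> borel_measurable M" unfolding r_def
    by (intro borel_measurable_lim_metric meas sC)
  have conv: "AE x in M. (\<lambda>i. s (\<rho> i) x) \<longlonglongrightarrow> r x"
    using \<rho>(2) unfolding r_def by eventually_elim (simp add: Cauchy_convergent_iff convergent_LIMSEQ_iff)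
  have rC: "r \<in> C" by (rule closedC[OF _ rm conv]) (rule sC)
  have "P i r" if i: "i \<in> I" for i
  proof -
    \<comment> \<open>The index \<open>i\<close> may occur in no \<open>G n\<close>. Adding it
      yields near-minimizers \<open>w n\<close> that satisfy \<open>P i\<close>; they also lie in
      \<open>S (G n)\<close>, so they are L1-close to \<open>s n\<close> and share its limit
      \<open>r\<close> along a subsequence.\<close>
    have ins: "insert i (G n) \<in> \<F>" for n using G[of n] i unfolding \<F>_def by auto
    have "\<forall>n. \<exists>q\<in>S (insert i (G n)). N q < D + 1 / Suc n"
    proof
      fix n
      show "\<exists>q\<in>S (insert i (G n)). N q < D + 1 / Suc n"
        using near[OF ins, of "1 / Suc n" n] dD[OF ins, of n] by force
    qed
    then obtain w where w: "\<And>n. w n \<in> S (insert i (G n))" "\<And>n. N (w n) < D + 1 / Suc n" by metis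
    have wG: "w n \<in> S (G n)" for n using w(1)[of n] Smono[of "G n" "insert i (G n)"] by auto
    have wC: "w n \<in> C" and wP: "P i (w n)" for n using w(1) unfolding S_def by auto
    have "(\<lambda>n. \<integral>x. norm (w n x - s n x) \<partial>M) \<longlonglongrightarrow> 0"
    proof (rule LIMSEQ_I)
      fix e :: real assume "e > 0"
      from L1_small[OF this] show "\<exists>no. \<forall>n\<ge>no. norm ((\<integral>x. norm (w n x - s n x) \<partial>M) - 0) < e"
        using wG s w(2) by (simp add: integral_nonneg_AE) blast
    qed
    then have lim0: "(\<lambda>n. \<integral>x. norm (w (\<rho> n) x - s (\<rho> n) x) \<partial>M) \<longlonglongrightarrow> 0"
      using LIMSEQ_subseq_LIMSEQ[OF _ \<rho>(1)] by (auto simp: o_def)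
    then obtain \<sigma> where \<sigma>: "strict_mono \<sigma>" "AE x in M. (\<lambda>n. w (\<rho> (\<sigma> n)) x - s (\<rho> (\<sigma> n)) x) \<longlonglongrightarrow> 0"
      using tendsto_L1_AE_subseq[of M "\<lambda>n x. w (\<rho> n) x - s (\<rho> n) x"] int1 wC sC by auto
    have "AE x in M. (\<lambda>n. w (\<rho> (\<sigma> n)) x) \<longlonglongrightarrow> r x"
      using \<sigma>(2) conv
    proof eventually_elim
      case (elim x)
      have "(\<lambda>n. s (\<rho> (\<sigma> n)) x) \<longlonglongrightarrow> r x"
        using LIMSEQ_subseq_LIMSEQ[OF elim(2) \<sigma>(1)] by (simp add: o_def)
      from tendsto_add[OF elim(1) this] show ?case by simp
    qed
    then show ?thesis using closedP[OF i, of "\<lambda>n. w (\<rho> (\<sigma> n))" r] wC wP rC by auto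
  qed
  then show ?thesis using rC by auto
qed

section \<open>The energy space\<close>

lemma L2_integrable_mult:
  assumes "f \<in> L2 \<Omega>" "g \<in> L2 \<Omega>"
  shows "integrable (lebesgue_on \<Omega>) (\<lambda>x. f x * g x)"
proof (rule Bochner_Integration.integrable_bound[of _ "\<lambda>x. (f x)\<^sup>2 + (g x)\<^sup>2"])
  have "\<bar>a * b\<bar> \<le> a\<^sup>2 + b\<^sup>2" for a b :: real
    using sum_squares_bound[of "\<bar>a\<bar>" "\<bar>b\<bar>"] mult_nonneg_nonneg[OF abs_ge_zero abs_ge_zero, of a b]
    unfolding abs_mult power2_abs mult.assoc by linarith
  then show "AE x in lebesgue_on \<Omega>. norm (f x * g x) \<le> norm ((f x)\<^sup>2 + (g x)\<^sup>2)" by (intro AE_I2) simp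
qed (use assms in \<open>auto simp: L2_def\<close>)

lemma L2_lincomb:
  assumes "f \<in> L2 \<Omega>" "g \<in> L2 \<Omega>"
  shows "(\<lambda>x. a * f x + b * g x) \<in> L2 \<Omega>"
proof -
  have "(\<lambda>x. (a * f x + b * g x)\<^sup>2) = (\<lambda>x. a\<^sup>2 * (f x)\<^sup>2 + 2 * a * b * (f x * g x) + b\<^sup>2 * (g x)\<^sup>2)"
    by (intro ext) (simp add: power2_eq_square algebra_simps)
  moreover have "integrable (lebesgue_on \<Omega>) (\<lambda>x. a\<^sup>2 * (f x)\<^sup>2 + 2 * a * b * (f x * g x) + b\<^sup>2 * (g x)\<^sup>2)"
    using assms L2_integrable_mult[OF assms] by (simp add: L2_def)
  moreover have "(\<lambda>x. a * f x + b * g x) \<in> borel_measurable (lebesgue_on \<Omega>)"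
    using assms by (auto simp: L2_def)
  ultimately show ?thesis unfolding L2_def by (simp only: mem_Collect_eq simp_thms)
qed

lemma L2_diff: "f \<in> L2 \<Omega> \<Longrightarrow> g \<in> L2 \<Omega> \<Longrightarrow> (\<lambda>x. f x - g x) \<in> L2 \<Omega>"
  using L2_lincomb[of f \<Omega> g 1 "-1"] by simp

lemma L2_norm_sq: "(L2_norm \<Omega> f)\<^sup>2 = (\<integral>x. (f x)\<^sup>2 \<partial>lebesgue_on \<Omega>)"
  unfolding L2_norm_def by (simp add: integral_nonneg_AE)

lemma L2_const:
  assumes "finite_measure (lebesgue_on \<Omega>)"
  shows "(\<lambda>x. c) \<in> L2 \<Omega>"
proof -
  interpret finite_measure "lebesgue_on \<Omega>" by (rule assms)
  show ?thesis by (simp add: L2_def)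
qed

lemma L2_integrable:
  assumes "finite_measure (lebesgue_on \<Omega>)" "f \<in> L2 \<Omega>"
  shows "integrable (lebesgue_on \<Omega>) f"
  using L2_integrable_mult[OF assms(2) L2_const[OF assms(1), of 1]] by simp

text \<open>Rests on the completeness of Lebesgue measure; it carries measurability over to the
  chosen representatives \<open>weak_grad\<close> and \<open>weak_div\<close>.\<close>

lemma borel_measurable_AE_lebesgue_on:
  fixes f g :: "'a::euclidean_space \<Rightarrow> 'b::euclidean_space"
  assumes "f \<in> borel_measurable (lebesgue_on S)" "S \<in> sets lebesgue" "AE x in lebesgue_on S. g x = f x"
  shows "g \<in> borel_measurable (lebesgue_on S)"
proof -
  have "AE x in lebesgue. x \<in> S \<longrightarrow> g x = f x"
    using assms(2,3) by (simp add: AE_restrict_space_iff)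
  then have "AE x in lebesgue. (if x \<in> S then f x else 0) = (if x \<in> S then g x else 0)"
    by eventually_elim auto
  then have "(\<lambda>x. if x \<in> S then g x else 0) \<in> borel_measurable lebesgue"
    by (rule borel_measurable_AE[rotated]) (use assms borel_measurable_if in blast)
  then show ?thesis using assms(2) borel_measurable_if by blast
qed

section \<open>Vector fields of finite energy\<close>

locale log_growth_problem =
  fixes \<Omega> :: "'a::euclidean_space set" and \<kappa> :: "'a \<Rightarrow> real" and \<alpha> \<gamma> \<kappa>_lo :: real
  assumes open_domain: "open \<Omega>" and bounded_domain: "bounded \<Omega>"
    and \<alpha>: "0 < \<alpha>" and \<gamma>: "0 < \<gamma>" and \<kappa>_lo: "0 < \<kappa>_lo"
    and \<kappa>_measurable [measurable]: "\<kappa> \<in> borel_measurable (lebesgue_on \<Omega>)"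
    and \<kappa>_ge: "AE x in lebesgue_on \<Omega>. \<kappa>_lo \<le> \<kappa> x"
begin

abbreviation M where "M \<equiv> lebesgue_on \<Omega>"
abbreviation \<phi> where "\<phi> \<equiv> phi \<alpha> \<gamma> \<kappa>"
abbreviation \<Phi> where "\<Phi> x \<equiv> Phi \<alpha> \<gamma> \<kappa> x"
abbreviation \<beta> where "\<beta> \<equiv> slope_bound \<alpha> \<gamma> \<kappa>"
abbreviation X where "X \<equiv> X_space \<Omega> \<alpha> \<gamma> \<kappa>"
abbreviation G where "G \<equiv> weak_grad \<Omega>"

lemma finite_M: "finite_measure M"
  using open_domain bounded_domain
  by (intro finite_measure_lebesgue_on) (simp add: bounded_set_imp_lmeasurable)

sublocale finite_measure M by (rule finite_M)

lemma \<kappa>_pos: "AE x in M. 0 < \<kappa> x"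
  using \<kappa>_ge by eventually_elim (use \<kappa>_lo in linarith)

lemma log_plus_quotient_measurable:
  "h \<in> borel_measurable M \<Longrightarrow> (\<lambda>x. log_plus (h x / \<kappa> x)) \<in> borel_measurable M"
  by (rule measurable_compose[OF borel_measurable_divide[OF _ \<kappa>_measurable] log_plus_measurable])

lemma phi_measurable [measurable (raw)]:
  "h \<in> borel_measurable M \<Longrightarrow> (\<lambda>x. \<phi> x (h x)) \<in> borel_measurable M"
  unfolding phi_def
  by (intro borel_measurable_times borel_measurable_add borel_measurable_const log_plus_quotient_measurable)

lemma slope_bound_measurable [measurable (raw)]:
  "h \<in> borel_measurable M \<Longrightarrow> (\<lambda>x. \<beta> x (h x)) \<in> borel_measurable M"
  unfolding slope_bound_def
  by (intro borel_measurable_times borel_measurable_add borel_measurable_const log_plus_quotient_measurable)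

text \<open>A property of fields rather than of functions, so that it applies alike to chosen weak
  gradients, to their linear combinations and to classical gradients.\<close>

definition finite_energy :: "('a \<Rightarrow> 'a) \<Rightarrow> bool" where
  "finite_energy g \<longleftrightarrow> integrable M g \<and> integrable M (\<lambda>x. \<phi> x (norm (g x)))"

lemma finite_energyD:
  assumes "finite_energy g"
  shows "g \<in> borel_measurable M" "integrable M g" "integrable M (\<lambda>x. norm (g x))"
    "integrable M (\<lambda>x. \<phi> x (norm (g x)))"
  using assms by (auto simp: finite_energy_def)

lemma integrable_phi_sum:
  assumes g: "finite_energy g" and h: "finite_energy h"
  shows "integrable M (\<lambda>x. \<phi> x (norm (g x) + norm (h x)))"
proof (rule Bochner_Integration.integrable_bound)
  show "integrable M (\<lambda>x. 2 * \<phi> x (norm (g x)) + 2 * \<phi> x (norm (h x)) + 2 * \<alpha> * \<gamma> * (norm (g x) + norm (h x)))"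
    using finite_energyD[OF g] finite_energyD[OF h] by simp
  show "(\<lambda>x. \<phi> x (norm (g x) + norm (h x))) \<in> borel_measurable M"
    using finite_energyD(1)[OF g] finite_energyD(1)[OF h] by measurable
  show "AE x in M. norm (\<phi> x (norm (g x) + norm (h x)))
      \<le> norm (2 * \<phi> x (norm (g x)) + 2 * \<phi> x (norm (h x)) + 2 * \<alpha> * \<gamma> * (norm (g x) + norm (h x)))"
    using \<kappa>_pos
  proof eventually_elim
    case (elim x)
    then show ?case
      using phi_add_le[where \<kappa>=\<kappa>, OF \<alpha> \<gamma> elim, of "norm (g x)" "norm (h x)"]
        phi_nonneg[where \<kappa>=\<kappa>, OF \<alpha> \<gamma> elim, of "norm (g x) + norm (h x)"] by simp
  qed
qed

lemma integrable_slope_bound_mult: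
  assumes g: "finite_energy g" and h: "finite_energy h"
  shows "integrable M (\<lambda>x. \<beta> x (norm (g x) + norm (h x)) * (norm (g x) + norm (h x)))"
proof -
  have "\<beta> x t * t = \<phi> x t + 2 * \<alpha> * \<gamma> * t" for x t
    by (simp add: slope_bound_def phi_def algebra_simps)
  then show ?thesis
    using integrable_phi_sum[OF assms] finite_energyD[OF g] finite_energyD[OF h] by simp
qed

lemma finite_energy_lincomb:
  assumes g: "finite_energy g" and h: "finite_energy h"
  shows "finite_energy (\<lambda>x. a *\<^sub>R g x + b *\<^sub>R h x)"
  unfolding finite_energy_def
proof
  show int: "integrable M (\<lambda>x. a *\<^sub>R g x + b *\<^sub>R h x)"
    using finite_energyD[OF g] finite_energyD[OF h] by simp
  define c where "c = max \<bar>a\<bar> \<bar>b\<bar>"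
  have c: "0 \<le> c" "\<bar>a\<bar> \<le> c" "\<bar>b\<bar> \<le> c" by (auto simp: c_def)
  show "integrable M (\<lambda>x. \<phi> x (norm (a *\<^sub>R g x + b *\<^sub>R h x)))"
  proof (rule Bochner_Integration.integrable_bound)
    show "integrable M (\<lambda>x. c * \<phi> x (norm (g x) + norm (h x)) + \<alpha> * \<gamma> * c * log_plus c * (norm (g x) + norm (h x)))"
      using integrable_phi_sum[OF assms] finite_energyD[OF g] finite_energyD[OF h] by simp
    show "(\<lambda>x. \<phi> x (norm (a *\<^sub>R g x + b *\<^sub>R h x))) \<in> borel_measurable M"
      using borel_measurable_integrable[OF int] by measurable
    show "AE x in M. norm (\<phi> x (norm (a *\<^sub>R g x + b *\<^sub>R h x)))
       \<le> norm (c * \<phi> x (norm (g x) + norm (h x)) + \<alpha> * \<gamma> * c * log_plus c * (norm (g x) + norm (h x)))"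
      using \<kappa>_pos
    proof eventually_elim
      case (elim x)
      have "norm (a *\<^sub>R g x + b *\<^sub>R h x) \<le> \<bar>a\<bar> * norm (g x) + \<bar>b\<bar> * norm (h x)"
        using norm_triangle_ineq[of "a *\<^sub>R g x" "b *\<^sub>R h x"] by simp
      also have "\<dots> \<le> c * (norm (g x) + norm (h x))"
        using c by (simp add: distrib_left add_mono mult_right_mono)
      finally have "\<phi> x (norm (a *\<^sub>R g x + b *\<^sub>R h x)) \<le> \<phi> x (c * (norm (g x) + norm (h x)))"
        by (intro phi_mono[where \<kappa>=\<kappa>, OF \<alpha> \<gamma> elim]) auto
      then show ?case
        using phi_scale_le[where \<kappa>=\<kappa>, OF \<alpha> \<gamma> elim c(1), of "norm (g x) + norm (h x)"]
          phi_nonneg[where \<kappa>=\<kappa>, OF \<alpha> \<gamma> elim, of "norm (a *\<^sub>R g x + b *\<^sub>R h x)"] by simp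
    qed
  qed
qed

lemma finite_energy_cong_AE:
  assumes "finite_energy g" "h \<in> borel_measurable M" "AE x in M. h x = g x"
  shows "finite_energy h"
  unfolding finite_energy_def
proof
  show "integrable M h"
    using finite_energyD[OF assms(1)] assms(2,3) by (subst integrable_cong_AE[of _ _ g]) auto
  show "integrable M (\<lambda>x. \<phi> x (norm (h x)))"
    using finite_energyD(4)[OF assms(1)]
  proof (subst integrable_cong_AE[of _ _ "\<lambda>x. \<phi> x (norm (g x))"])
    show "(\<lambda>x. \<phi> x (norm (h x))) \<in> borel_measurable M" using assms(2) by measurable
    show "AE x in M. \<phi> x (norm (h x)) = \<phi> x (norm (g x))" using assms(3) by eventually_elim simp
  qed auto
qed

section \<open>The energy space as a vector space containing the test functions\<close>

lemma X_D:
  assumes "u \<in> X"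
  shows "u \<in> L2 \<Omega>" "has_weak_grad \<Omega> u (G u)" "finite_energy (G u)"
proof -
  show "u \<in> L2 \<Omega>" using assms by (simp add: X_space_def)
  obtain g where g: "has_weak_grad \<Omega> u g" "integrable M g"
    using assms by (auto simp: X_space_def W11_def)
  show wg: "has_weak_grad \<Omega> u (G u)" by (rule has_weak_grad_weak_grad[OF g(1)])
  have ae: "AE x in M. G u x = g x" by (rule weak_grad_AE_eq[OF open_domain g(1)])
  have "G u \<in> borel_measurable M"
    by (rule borel_measurable_AE_lebesgue_on[of g]) (use g(2) ae open_domain in auto)
  then have "integrable M (G u)"
    using g(2) ae by (subst integrable_cong_AE[of _ _ g]) auto
  then show "finite_energy (G u)" using assms by (simp add: finite_energy_def X_space_def)
qed

lemma X_I:
  assumes "u \<in> L2 \<Omega>" "has_weak_grad \<Omega> u g" "finite_energy g"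
  shows "u \<in> X" "AE x in M. G u x = g x"
proof -
  show ae: "AE x in M. G u x = g x" by (rule weak_grad_AE_eq[OF open_domain assms(2)])
  have "G u \<in> borel_measurable M"
    by (rule borel_measurable_AE_lebesgue_on[of g]) (use finite_energyD[OF assms(3)] ae open_domain in auto)
  from finite_energy_cong_AE[OF assms(3) this ae] have "finite_energy (G u)" .
  then show "u \<in> X"
    using assms L2_integrable[OF finite_M assms(1)] finite_energyD(2)[OF assms(3)]
    unfolding X_space_def W11_def finite_energy_def by auto
qed

lemma X_lincomb:
  assumes u: "u \<in> X" and v: "v \<in> X"
  shows "(\<lambda>x. a * u x + b * v x) \<in> X"
    and "AE x in M. G (\<lambda>x. a * u x + b * v x) x = a *\<^sub>R G u x + b *\<^sub>R G v x"
  by (rule X_I[OF L2_lincomb[OF X_D(1)[OF u] X_D(1)[OF v]]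
      has_weak_grad_lincomb[OF open_domain X_D(2)[OF u] X_D(2)[OF v]]
      finite_energy_lincomb[OF X_D(3)[OF u] X_D(3)[OF v]]])+

lemma X_zero: "(\<lambda>x. 0) \<in> X" "AE x in M. G (\<lambda>x. 0) x = 0"
proof -
  have "has_weak_grad \<Omega> (\<lambda>x. 0) (\<lambda>x. 0)"
    by (simp add: has_weak_grad_def locally_integrable_def absolutely_integrable_zero)
  from X_I[OF L2_const[OF finite_M] this] show "(\<lambda>x. 0) \<in> X" "AE x in M. G (\<lambda>x. 0) x = 0"
    by (auto simp: finite_energy_def)
qed

lemma X_sum:
  assumes "finite F" "F \<subseteq> X"
  shows "(\<lambda>x. \<Sum>v\<in>F. c v * v x) \<in> X \<and> (AE x in M. G (\<lambda>x. \<Sum>v\<in>F. c v * v x) x = (\<Sum>v\<in>F. c v *\<^sub>R G v x))"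
  using assms
proof (induction F rule: finite_induct)
  case empty
  then show ?case using X_zero by simp
next
  case (insert w F)
  then have IH: "(\<lambda>x. \<Sum>v\<in>F. c v * v x) \<in> X" "w \<in> X"
      "AE x in M. G (\<lambda>x. \<Sum>v\<in>F. c v * v x) x = (\<Sum>v\<in>F. c v *\<^sub>R G v x)" by auto
  have eq: "(\<lambda>x. \<Sum>v\<in>insert w F. c v * v x) = (\<lambda>x. c w * w x + 1 * (\<Sum>v\<in>F. c v * v x))"
    using insert.hyps by simp
  have "AE x in M. G (\<lambda>x. \<Sum>v\<in>insert w F. c v * v x) x = (\<Sum>v\<in>insert w F. c v *\<^sub>R G v x)"
    unfolding eq using X_lincomb(2)[OF IH(2,1), of "c w" 1] IH(3)
    by eventually_elim (use insert.hyps in simp)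
  then show ?case unfolding eq using X_lincomb(1)[OF IH(2,1), of "c w" 1] by blast
qed

text \<open>Because of this, an identity tested against all of \<open>X\<close> contains the
  definition of the distributional divergence. The lower bound on \<kappa> keeps the energy density
  of a bounded gradient bounded.\<close>

lemma test_function_in_X:
  assumes \<psi>: "test_function \<Omega> \<psi>"
  shows "\<psi> \<in> X" "AE x in M. G \<psi> x = classical_grad \<psi> x"
proof -
  obtain K where K: "compact K" "\<And>x. x \<notin> K \<Longrightarrow> classical_grad \<psi> x = 0"
    using test_function_support[OF \<psi>] by metis
  have "bounded (classical_grad \<psi> ` K)"
    using K(1) test_functionD(3)[OF \<psi>] by (intro compact_imp_bounded compact_continuous_image) (auto intro: continuous_on_subset)
  then obtain m0 where m0: "\<And>x. x \<in> K \<Longrightarrow> norm (classical_grad \<psi> x) \<le> m0"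
    unfolding bounded_iff by auto
  define m where "m = max m0 0"
  have m: "norm (classical_grad \<psi> x) \<le> m" for x
    using m0[of x] K(2)[of x] by (cases "x \<in> K") (auto simp: m_def)
  have m_nonneg: "0 \<le> m" by (simp add: m_def)
  have one: "locally_integrable \<Omega> (\<lambda>x. 1 :: real)"
    by (rule continuous_locally_integrable) simp
  have grad: "integrable M (classical_grad \<psi>)"
    using test_function_integrable(2)[OF \<psi> open_domain one] by simp
  have "integrable M (\<lambda>x. \<psi> x *\<^sub>R \<psi> x)"
    by (rule test_function_integrable(1)[OF \<psi> open_domain continuous_locally_integrable[OF test_functionD(2)[OF \<psi>]]])
  moreover have "integrable M \<psi>" using test_function_integrable(1)[OF \<psi> open_domain one] by simp
  ultimately have L2: "\<psi> \<in> L2 \<Omega>" by (auto simp: L2_def power2_eq_square)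
  have "integrable M (\<lambda>x. \<phi> x (norm (classical_grad \<psi> x)))"
  proof (rule integrable_const_bound[where B="\<alpha> * m * (1 + \<gamma> * log_plus (m / \<kappa>_lo))"])
    show "(\<lambda>x. \<phi> x (norm (classical_grad \<psi> x))) \<in> borel_measurable M"
      using borel_measurable_integrable[OF grad] by measurable
    show "AE x in M. norm (\<phi> x (norm (classical_grad \<psi> x))) \<le> \<alpha> * m * (1 + \<gamma> * log_plus (m / \<kappa>_lo))"
      using \<kappa>_pos \<kappa>_ge
    proof eventually_elim
      case (elim x)
      have "norm (classical_grad \<psi> x) / \<kappa> x \<le> m / \<kappa>_lo"
        using m[of x] elim \<kappa>_lo by (intro frac_le) (auto simp: m_nonneg)
      then have "\<phi> x (norm (classical_grad \<psi> x)) \<le> \<alpha> * m * (1 + \<gamma> * log_plus (m / \<kappa>_lo))"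
        unfolding phi_def using m[of x] m_nonneg \<alpha> \<gamma>
        by (intro mult_mono add_mono mult_left_mono log_plus_mono) auto
      then show ?case using phi_nonneg[where \<kappa>=\<kappa>, OF \<alpha> \<gamma> elim(1), of "norm (classical_grad \<psi> x)"] by simp
    qed
  qed
  then have "finite_energy (classical_grad \<psi>)" using grad by (simp add: finite_energy_def)
  from X_I[OF L2 has_weak_grad_test_function[OF \<psi> open_domain] this]
  show "\<psi> \<in> X" "AE x in M. G \<psi> x = classical_grad \<psi> x" by auto
qed

end

section \<open>Subgradient fields and the first variation\<close>

lemma norm_measurable: "g \<in> borel_measurable M \<Longrightarrow> (\<lambda>x. norm (g x :: 'b::euclidean_space)) \<in> borel_measurable M"
  by measurable

context log_growth_problem
begin

definition subgrad_fields :: "('a \<Rightarrow> 'a) \<Rightarrow> ('a \<Rightarrow> 'a) set" where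
  "subgrad_fields g = {q \<in> borel_measurable M. AE x in M. q x \<in> subdifferential UNIV (\<Phi> x) (g x)}"

text \<open>The defect, tested with \<open>v\<close>, in the weak form of div q = w. If it vanishes
  for all \<open>v\<close> in \<open>X\<close>, both the distributional equation and the integration
  by parts required in \<open>K_set\<close> hold.\<close>

definition residual :: "('a \<Rightarrow> real) \<Rightarrow> ('a \<Rightarrow> 'a) \<Rightarrow> ('a \<Rightarrow> real) \<Rightarrow> real" where
  "residual w q v = (\<integral>x. q x \<bullet> G v x \<partial>M) + (\<integral>x. w x * v x \<partial>M)"

lemma subgrad_fieldsD:
  assumes "q \<in> subgrad_fields g"
  shows "q \<in> borel_measurable M" "AE x in M. q x \<in> subdifferential UNIV (\<Phi> x) (g x)"
    "AE x in M. norm (q x) \<le> \<beta> x (norm (g x))"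
proof -
  show "q \<in> borel_measurable M" and s: "AE x in M. q x \<in> subdifferential UNIV (\<Phi> x) (g x)"
    using assms by (auto simp: subgrad_fields_def)
  show "AE x in M. norm (q x) \<le> \<beta> x (norm (g x))"
    using s \<kappa>_pos by eventually_elim (rule subdifferential_Phi_bound[where \<kappa>=\<kappa>, OF \<alpha> \<gamma>])
qed

text \<open>Takes the place of the Orlicz-Hoelder inequality: enlarging both arguments to the sum of
  the norms turns the product into \<open>phi\<close> of that sum plus a linear term.\<close>

lemma integrable_slope_bound_mult2:
  assumes g: "finite_energy g" and h: "finite_energy h"
  shows "integrable M (\<lambda>x. \<beta> x (norm (g x)) * norm (h x))"
proof (rule Bochner_Integration.integrable_bound[OF integrable_slope_bound_mult[OF assms]])
  show "(\<lambda>x. \<beta> x (norm (g x)) * norm (h x)) \<in> borel_measurable M"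
    using finite_energyD(1)[OF g] finite_energyD(1)[OF h]
    by (intro borel_measurable_times slope_bound_measurable norm_measurable)
  show "AE x in M. norm (\<beta> x (norm (g x)) * norm (h x))
      \<le> norm (\<beta> x (norm (g x) + norm (h x)) * (norm (g x) + norm (h x)))"
    using \<kappa>_pos
  proof eventually_elim
    case (elim x)
    have "0 \<le> \<beta> x (norm (g x))" for g :: "'a \<Rightarrow> 'a"
      using slope_bound_ge[where \<kappa>=\<kappa>, OF \<alpha> \<gamma> elim, of "norm (g x)"] \<alpha> by simp
    moreover have "\<beta> x (norm (g x)) \<le> \<beta> x (norm (g x) + norm (h x))"
      by (rule slope_bound_mono[where \<kappa>=\<kappa>, OF \<alpha> \<gamma> elim]) simp
    ultimately have "0 \<le> \<beta> x (norm (g x)) * norm (h x)"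
      "\<beta> x (norm (g x)) * norm (h x) \<le> \<beta> x (norm (g x) + norm (h x)) * (norm (g x) + norm (h x))"
      by (auto intro!: mult_mono intro: order_trans)
    then show ?case by simp
  qed
qed

lemma integrable_slope_bound_sq:
  assumes g: "finite_energy g"
  shows "integrable M (\<lambda>x. (\<beta> x (norm (g x)))\<^sup>2)"
proof (rule Bochner_Integration.integrable_bound)
  \<comment> \<open>From (a + b)^2 \<le> 2 a^2 + 2 b^2 and the factor 4 in
    \<open>log_plus_sq_le\<close>; hence 8 = 2 * 4 in \<open>?d\<close>.\<close>
  let ?c = "\<alpha>\<^sup>2 * (2 * (1 + 2 * \<gamma>)\<^sup>2)" and ?d = "\<alpha>\<^sup>2 * (8 * \<gamma>\<^sup>2)"
  show "integrable M (\<lambda>x. ?c + ?d * (1 + norm (g x) / \<kappa>_lo))"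
    using finite_energyD[OF g] by simp
  show "(\<lambda>x. (\<beta> x (norm (g x)))\<^sup>2) \<in> borel_measurable M"
    using finite_energyD(1)[OF g] by (intro borel_measurable_power slope_bound_measurable norm_measurable)
  show "AE x in M. norm ((\<beta> x (norm (g x)))\<^sup>2) \<le> norm (?c + ?d * (1 + norm (g x) / \<kappa>_lo))"
    using \<kappa>_pos \<kappa>_ge
  proof eventually_elim
    case (elim x)
    let ?L = "log_plus (norm (g x) / \<kappa> x)"
    have "norm (g x) / \<kappa> x \<le> norm (g x) / \<kappa>_lo"
      using elim \<kappa>_lo by (intro divide_left_mono) auto
    then have L: "?L\<^sup>2 \<le> 4 * (1 + norm (g x) / \<kappa>_lo)"
      using log_plus_sq_le[of "norm (g x) / \<kappa> x"] elim by simp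
    have "(\<beta> x (norm (g x)))\<^sup>2 = \<alpha>\<^sup>2 * ((1 + 2 * \<gamma>) + \<gamma> * ?L)\<^sup>2"
      by (simp add: slope_bound_def power_mult_distrib add.assoc)
    also have "\<dots> \<le> \<alpha>\<^sup>2 * (2 * (1 + 2 * \<gamma>)\<^sup>2 + 2 * (\<gamma> * ?L)\<^sup>2)"
      using sum_squares_bound[of "1 + 2 * \<gamma>" "\<gamma> * ?L"] by (intro mult_left_mono) (simp_all add: power2_sum)
    also have "\<dots> = ?c + \<alpha>\<^sup>2 * 2 * \<gamma>\<^sup>2 * ?L\<^sup>2" by (simp add: power_mult_distrib algebra_simps)
    also have "\<dots> \<le> ?c + \<alpha>\<^sup>2 * 2 * \<gamma>\<^sup>2 * (4 * (1 + norm (g x) / \<kappa>_lo))"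
      using L by (intro add_left_mono mult_left_mono) auto
    also have "\<dots> = ?c + ?d * (1 + norm (g x) / \<kappa>_lo)" by simp
    finally show ?case by simp
  qed
qed

lemma integrable_slope_bound:
  assumes g: "finite_energy g"
  shows "integrable M (\<lambda>x. \<beta> x (norm (g x)))"
proof -
  have "(\<lambda>x. \<beta> x (norm (g x))) \<in> L2 \<Omega>"
    using integrable_slope_bound_sq[OF g] finite_energyD(1)[OF g]
    by (auto simp: L2_def intro!: slope_bound_measurable)
  then show ?thesis by (rule L2_integrable[OF finite_M])
qed

lemma integrable_inner_dominated:
  assumes g: "finite_energy g" and h: "finite_energy h"
    and q: "q \<in> borel_measurable M" "AE x in M. norm (q x) \<le> \<beta> x (norm (g x))"
  shows "integrable M (\<lambda>x. q x \<bullet> h x)"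
    and "AE x in M. norm (q x \<bullet> h x) \<le> \<beta> x (norm (g x)) * norm (h x)"
proof -
  show ae: "AE x in M. norm (q x \<bullet> h x) \<le> \<beta> x (norm (g x)) * norm (h x)"
    using q(2)
  proof eventually_elim
    case (elim x)
    show ?case using Cauchy_Schwarz_ineq2[of "q x" "h x"] mult_right_mono[OF elim, of "norm (h x)"] by simp
  qed
  show "integrable M (\<lambda>x. q x \<bullet> h x)"
  proof (rule Bochner_Integration.integrable_bound[OF integrable_slope_bound_mult2[OF g h]])
    show "(\<lambda>x. q x \<bullet> h x) \<in> borel_measurable M"
      using q(1) finite_energyD(1)[OF h] by (rule borel_measurable_inner)
    show "AE x in M. norm (q x \<bullet> h x) \<le> norm (\<beta> x (norm (g x)) * norm (h x))"
      using ae by eventually_elim simp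
  qed
qed

lemma subgrad_field_integrable_inner:
  assumes "q \<in> subgrad_fields g" "finite_energy g" "finite_energy h"
  shows "integrable M (\<lambda>x. q x \<bullet> h x)"
  by (rule integrable_inner_dominated(1)[OF assms(2,3) subgrad_fieldsD(1,3)[OF assms(1)]])

section \<open>Algebra and continuity of the residual\<close>

lemma residual_lincomb_right:
  assumes g: "finite_energy g" and q: "q \<in> subgrad_fields g" and w: "w \<in> L2 \<Omega>" and uv: "u \<in> X" "v \<in> X"
  shows "residual w q (\<lambda>x. a * u x + b * v x) = a * residual w q u + b * residual w q v"
proof -
  note I = subgrad_field_integrable_inner[OF q g X_D(3)]
  have "(\<integral>x. q x \<bullet> G (\<lambda>x. a * u x + b * v x) x \<partial>M) = (\<integral>x. a * (q x \<bullet> G u x) + b * (q x \<bullet> G v x) \<partial>M)"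
  proof (rule integral_cong_AE)
    show "AE x in M. q x \<bullet> G (\<lambda>x. a * u x + b * v x) x = a * (q x \<bullet> G u x) + b * (q x \<bullet> G v x)"
      using X_lincomb(2)[OF uv, of a b] by eventually_elim (simp add: inner_add_right)
  qed (use borel_measurable_integrable[OF I[OF uv(1)]] borel_measurable_integrable[OF I[OF uv(2)]]
        borel_measurable_integrable[OF I[OF X_lincomb(1)[OF uv, of a b]]] in auto)
  also have "\<dots> = a * (\<integral>x. q x \<bullet> G u x \<partial>M) + b * (\<integral>x. q x \<bullet> G v x \<partial>M)"
    using I[OF uv(1)] I[OF uv(2)] by simp
  finally have 1: "(\<integral>x. q x \<bullet> G (\<lambda>x. a * u x + b * v x) x \<partial>M) = \<dots>" .
  have "(\<integral>x. w x * (a * u x + b * v x) \<partial>M) = (\<integral>x. a * (w x * u x) + b * (w x * v x) \<partial>M)"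
    by (simp add: algebra_simps)
  also have "\<dots> = a * (\<integral>x. w x * u x \<partial>M) + b * (\<integral>x. w x * v x \<partial>M)"
    using L2_integrable_mult[OF w X_D(1)[OF uv(1)]] L2_integrable_mult[OF w X_D(1)[OF uv(2)]] by simp
  finally show ?thesis unfolding residual_def 1 by (simp add: algebra_simps)
qed

lemma residual_sum_right:
  assumes g: "finite_energy g" and q: "q \<in> subgrad_fields g" and w: "w \<in> L2 \<Omega>"
    and F: "finite F" "F \<subseteq> X"
  shows "residual w q (\<lambda>x. \<Sum>v\<in>F. c v * v x) = (\<Sum>v\<in>F. c v * residual w q v)"
  using F
proof (induction F rule: finite_induct)
  case empty
  show ?case using residual_lincomb_right[OF g q w X_zero(1) X_zero(1), of 0 0] by simp
next
  case (insert v F)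
  have "(\<lambda>x. \<Sum>v\<in>insert v F. c v * v x) = (\<lambda>x. c v * v x + 1 * (\<Sum>v\<in>F. c v * v x))"
    using insert.hyps by simp
  moreover have "v \<in> X" "(\<lambda>x. \<Sum>v\<in>F. c v * v x) \<in> X" using insert X_sum[of F c] by auto
  ultimately show ?case
    using residual_lincomb_right[OF g q w, of v "\<lambda>x. \<Sum>v\<in>F. c v * v x" "c v" 1] insert by simp
qed

lemma residual_mix_left:
  assumes g: "finite_energy g" and q: "q \<in> subgrad_fields g" and r: "r \<in> subgrad_fields g" and v: "v \<in> X"
  shows "residual w (\<lambda>x. (1 - t) *\<^sub>R q x + t *\<^sub>R r x) v = (1 - t) * residual w q v + t * residual w r v"
proof -
  have "(\<integral>x. ((1 - t) *\<^sub>R q x + t *\<^sub>R r x) \<bullet> G v x \<partial>M)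
      = (1 - t) * (\<integral>x. q x \<bullet> G v x \<partial>M) + t * (\<integral>x. r x \<bullet> G v x \<partial>M)"
    using subgrad_field_integrable_inner[OF q g X_D(3)[OF v]] subgrad_field_integrable_inner[OF r g X_D(3)[OF v]]
    by (simp add: inner_add_left)
  then show ?thesis unfolding residual_def by (simp add: algebra_simps)
qed

lemma subgrad_fields_mix:
  assumes q: "q \<in> subgrad_fields g" and r: "r \<in> subgrad_fields g" and t: "0 \<le> t" "t \<le> 1"
  shows "(\<lambda>x. (1 - t) *\<^sub>R q x + t *\<^sub>R r x) \<in> subgrad_fields g"
  unfolding subgrad_fields_def
proof (intro CollectI conjI)
  show "(\<lambda>x. (1 - t) *\<^sub>R q x + t *\<^sub>R r x) \<in> borel_measurable M"
    using subgrad_fieldsD(1)[OF q] subgrad_fieldsD(1)[OF r] by measurable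
  show "AE x in M. (1 - t) *\<^sub>R q x + t *\<^sub>R r x \<in> subdifferential UNIV (\<Phi> x) (g x)"
    using subgrad_fieldsD(2)[OF q] subgrad_fieldsD(2)[OF r]
  proof eventually_elim
    case (elim x)
    show ?case unfolding subdifferential_def
    proof (intro CollectI ballI)
      fix y
      have a: "\<Phi> x (g x) + q x \<bullet> (y - g x) \<le> \<Phi> x y" "\<Phi> x (g x) + r x \<bullet> (y - g x) \<le> \<Phi> x y"
        using elim by (auto simp: subdifferential_def)
      have "(1 - t) * (\<Phi> x (g x) + q x \<bullet> (y - g x)) + t * (\<Phi> x (g x) + r x \<bullet> (y - g x))
          \<le> (1 - t) * \<Phi> x y + t * \<Phi> x y"
        using t a by (intro add_mono mult_left_mono) auto
      then show "\<Phi> x (g x) + ((1 - t) *\<^sub>R q x + t *\<^sub>R r x) \<bullet> (y - g x) \<le> \<Phi> x y"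
        by (simp add: inner_add_left algebra_simps)
    qed
  qed
qed

lemma subgrad_fields_closed:
  assumes q: "\<And>n::nat. q n \<in> subgrad_fields g" and r: "r \<in> borel_measurable M"
    and lim: "AE x in M. (\<lambda>n. q n x) \<longlonglongrightarrow> r x"
  shows "r \<in> subgrad_fields g"
  unfolding subgrad_fields_def
proof (intro CollectI conjI r)
  have "AE x in M. \<forall>n. q n x \<in> subdifferential UNIV (\<Phi> x) (g x)"
    using subgrad_fieldsD(2)[OF q] by (simp add: AE_all_countable)
  then show "AE x in M. r x \<in> subdifferential UNIV (\<Phi> x) (g x)"
    using lim
  proof eventually_elim
    case (elim x)
    show ?case unfolding subdifferential_def
    proof (intro CollectI ballI)
      fix y
      have "(\<lambda>n. \<Phi> x (g x) + q n x \<bullet> (y - g x)) \<longlonglongrightarrow> \<Phi> x (g x) + r x \<bullet> (y - g x)"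
        using elim(2) by (intro tendsto_intros)
      then show "\<Phi> x (g x) + r x \<bullet> (y - g x) \<le> \<Phi> x y"
        by (rule LIMSEQ_le_const2) (use elim(1) in \<open>auto simp: subdifferential_def\<close>)
    qed
  qed
qed

lemma residual_tendsto:
  assumes g: "finite_energy g" and q: "\<And>n::nat. q n \<in> subgrad_fields g" and r: "r \<in> subgrad_fields g"
    and lim: "AE x in M. (\<lambda>n. q n x) \<longlonglongrightarrow> r x" and v: "v \<in> X"
  shows "(\<lambda>n. residual w (q n) v) \<longlonglongrightarrow> residual w r v"
  unfolding residual_def
proof (intro tendsto_add tendsto_const)
  note h = X_D(3)[OF v]
  show "(\<lambda>n. \<integral>x. q n x \<bullet> G v x \<partial>M) \<longlonglongrightarrow> (\<integral>x. r x \<bullet> G v x \<partial>M)"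
  proof (rule integral_dominated_convergence[OF _ _ integrable_slope_bound_mult2[OF g h]])
    show "(\<lambda>x. r x \<bullet> G v x) \<in> borel_measurable M"
      using subgrad_field_integrable_inner[OF r g h] by (rule borel_measurable_integrable)
    show "(\<lambda>x. q n x \<bullet> G v x) \<in> borel_measurable M" for n
      using subgrad_field_integrable_inner[OF q g h] by (rule borel_measurable_integrable)
    show "AE x in M. (\<lambda>n. q n x \<bullet> G v x) \<longlonglongrightarrow> r x \<bullet> G v x"
      using lim by eventually_elim (intro tendsto_intros)
    show "AE x in M. norm (q n x \<bullet> G v x) \<le> \<beta> x (norm (g x)) * norm (G v x)" for n
      by (rule integrable_inner_dominated(2)[OF g h subgrad_fieldsD(1,3)[OF q]])
  qed
qed

lemma residual_bounded:
  assumes g: "finite_energy g" and v: "v \<in> X"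
  shows "\<exists>B. \<forall>q\<in>subgrad_fields g. \<bar>residual w q v\<bar> \<le> B"
proof (intro exI ballI)
  fix q assume q: "q \<in> subgrad_fields g"
  note h = X_D(3)[OF v]
  have "\<bar>\<integral>x. q x \<bullet> G v x \<partial>M\<bar> \<le> (\<integral>x. \<beta> x (norm (g x)) * norm (G v x) \<partial>M)"
  proof -
    have "\<bar>\<integral>x. q x \<bullet> G v x \<partial>M\<bar> \<le> (\<integral>x. norm (q x \<bullet> G v x) \<partial>M)"
      using integral_norm_bound[of M "\<lambda>x. q x \<bullet> G v x"] by simp
    also have "\<dots> \<le> (\<integral>x. \<beta> x (norm (g x)) * norm (G v x) \<partial>M)"
      by (rule integral_mono_AE[OF integrable_norm[OF subgrad_field_integrable_inner[OF q g h]]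
          integrable_slope_bound_mult2[OF g h] integrable_inner_dominated(2)[OF g h subgrad_fieldsD(1,3)[OF q]]])
    finally show ?thesis .
  qed
  then show "\<bar>residual w q v\<bar> \<le> (\<integral>x. \<beta> x (norm (g x)) * norm (G v x) \<partial>M) + \<bar>\<integral>x. w x * v x \<partial>M\<bar>"
    unfolding residual_def by linarith
qed

text \<open>For finitely many directions the minimax argument gives only approximate zeros, so the
  compactness argument is run with the closed convex conditions that residuals have modulus at most
  1. One field satisfying this for the whole vector space \<open>X\<close> has zero residuals: a
  nonzero one could be rescaled to 2.\<close>

lemma exists_balanced_subgrad_field:
  assumes g: "finite_energy g" and w: "w \<in> L2 \<Omega>"
    and dir: "\<And>v. v \<in> X \<Longrightarrow> \<exists>s\<in>subgrad_fields g. 0 \<le> residual w s v"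
  shows "\<exists>q\<in>subgrad_fields g. \<forall>v\<in>X. residual w q v = 0"
proof -
  have mid: "(\<lambda>x. (1/2) *\<^sub>R (q x + r x)) = (\<lambda>x. (1 - 1/2) *\<^sub>R q x + (1/2) *\<^sub>R r x)" for q r :: "'a \<Rightarrow> 'a"
    by (simp add: scaleR_add_right)
  have "\<exists>q\<in>subgrad_fields g. \<forall>v\<in>X. \<bar>residual w q v\<bar> \<le> 1"
  proof (rule L2_dominated_fip[where B="\<lambda>x. \<beta> x (norm (g x))"])
    show "finite_measure M" by (rule finite_M)
    show "q \<in> borel_measurable M" "AE x in M. norm (q x) \<le> \<beta> x (norm (g x))" if "q \<in> subgrad_fields g" for q
      using subgrad_fieldsD(1,3)[OF that] .
    show "integrable M (\<lambda>x. (\<beta> x (norm (g x)))\<^sup>2)" by (rule integrable_slope_bound_sq[OF g])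
    show "(\<lambda>x. (1/2) *\<^sub>R (q x + r x)) \<in> subgrad_fields g" if "q \<in> subgrad_fields g" "r \<in> subgrad_fields g" for q r
      unfolding mid by (rule subgrad_fields_mix[OF that]) auto
    show "\<bar>residual w (\<lambda>x. (1/2) *\<^sub>R (q x + r x)) v\<bar> \<le> 1"
      if "v \<in> X" "q \<in> subgrad_fields g" "r \<in> subgrad_fields g" "\<bar>residual w q v\<bar> \<le> 1" "\<bar>residual w r v\<bar> \<le> 1" for v q r
      using that(4,5) unfolding mid residual_mix_left[OF g that(2,3,1)] by (auto simp: abs_le_iff)
    show "r \<in> subgrad_fields g"
      if "\<And>n::nat. q n \<in> subgrad_fields g" "r \<in> borel_measurable M" "AE x in M. (\<lambda>n. q n x) \<longlonglongrightarrow> r x" for q r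
      by (rule subgrad_fields_closed[OF that])
    show "\<bar>residual w r v\<bar> \<le> 1"
      if "v \<in> X" "\<And>n::nat. q n \<in> subgrad_fields g" "\<And>n. \<bar>residual w (q n) v\<bar> \<le> 1" "r \<in> subgrad_fields g"
        "AE x in M. (\<lambda>n. q n x) \<longlonglongrightarrow> r x" for v q r
      using tendsto_rabs[OF residual_tendsto[OF g that(2,4,5,1)]]
      by (rule LIMSEQ_le_const2) (use that(3) in auto)
    show "\<exists>q\<in>subgrad_fields g. \<forall>v\<in>F. \<bar>residual w q v\<bar> \<le> 1" if F: "finite F" "F \<subseteq> X" for F
    proof (rule finite_minimax_approx[where L="\<lambda>v q. residual w q v", OF F(1)])
      show "\<exists>s\<in>subgrad_fields g. \<forall>v\<in>F. residual w s v = (1 - t) * residual w q v + t * residual w r v"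
        if "q \<in> subgrad_fields g" "r \<in> subgrad_fields g" "0 \<le> t" "t \<le> 1" for q r t
        using subgrad_fields_mix[OF that] residual_mix_left[OF g that(1,2)] F(2) by blast
      show "\<exists>B. \<forall>q\<in>subgrad_fields g. \<bar>residual w q v\<bar> \<le> B" if "v \<in> F" for v
        using residual_bounded[OF g] that F(2) by blast
      show "\<exists>q\<in>subgrad_fields g. 0 \<le> (\<Sum>v\<in>F. c v * residual w q v)" for c
      proof -
        obtain s where s: "s \<in> subgrad_fields g" "0 \<le> residual w s (\<lambda>x. \<Sum>v\<in>F. c v * v x)"
          using dir X_sum[OF F, of c] by blast
        then show ?thesis using residual_sum_right[OF g s(1) w F, of c] by auto
      qed
    qed simp
  qed
  then obtain q where q: "q \<in> subgrad_fields g" "\<And>v. v \<in> X \<Longrightarrow> \<bar>residual w q v\<bar> \<le> 1" by blast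
  have "residual w q v = 0" if v: "v \<in> X" for v
  proof (rule ccontr)
    assume ne: "residual w q v \<noteq> 0"
    define a where "a = 2 / residual w q v"
    have "residual w q (\<lambda>x. a * v x + 0 * v x) = 2"
      using residual_lincomb_right[OF g q(1) w v v, of a 0] ne by (simp add: a_def)
    moreover have "(\<lambda>x. a * v x + 0 * v x) \<in> X" by (rule X_lincomb(1)[OF v v])
    ultimately show False using q(2) by fastforce
  qed
  then show ?thesis using q(1) by blast
qed

section \<open>First variation at the minimizer\<close>

lemma right_slope_measurable:
  assumes "h \<in> borel_measurable M"
  shows "(\<lambda>x. right_slope \<alpha> \<gamma> \<kappa> x (h x)) \<in> borel_measurable M"
proof -
  note [measurable] = assms \<kappa>_measurable log_plus_quotient_measurable[OF assms]
  show ?thesis unfolding right_slope_def by measurable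
qed

lemma dir_subgrad_field:
  assumes g: "g \<in> borel_measurable M" and h: "h \<in> borel_measurable M"
  shows "(\<lambda>x. dir_subgrad \<alpha> \<gamma> \<kappa> x (g x) (h x)) \<in> subgrad_fields g"
  unfolding subgrad_fields_def
proof (intro CollectI conjI)
  note [measurable] = g h \<kappa>_measurable right_slope_measurable[OF norm_measurable[OF g]]
  show "(\<lambda>x. dir_subgrad \<alpha> \<gamma> \<kappa> x (g x) (h x)) \<in> borel_measurable M"
    unfolding dir_subgrad_def sgn_div_norm by measurable
  show "AE x in M. dir_subgrad \<alpha> \<gamma> \<kappa> x (g x) (h x) \<in> subdifferential UNIV (\<Phi> x) (g x)"
    using \<kappa>_pos by eventually_elim (rule dir_subgrad_in[where \<kappa>=\<kappa>, OF \<alpha> \<gamma>])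
qed

text \<open>Minimality is tested at u + T v for step sizes T tending to 0. The energy increment is
  bounded above by the slope at the perturbed gradient times the norm increment, so dividing by T
  gives an inequality that survives dominated convergence.\<close>

lemma minimizer_directional:
  assumes f: "f \<in> L2 \<Omega>" and u: "u \<in> X" and v: "v \<in> X"
    and min: "\<And>v. v \<in> X \<Longrightarrow> primal_functional \<Omega> f \<alpha> \<gamma> \<kappa> u \<le> primal_functional \<Omega> f \<alpha> \<gamma> \<kappa> v"
  shows "\<exists>s\<in>subgrad_fields (G u). 0 \<le> residual (\<lambda>x. u x - f x) s v"
proof
  let ?s = "\<lambda>x. dir_subgrad \<alpha> \<gamma> \<kappa> x (G u x) (G v x)"
  let ?w = "\<lambda>x. u x - f x"
  note g = X_D(3)[OF u] and h = X_D(3)[OF v]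
  show s: "?s \<in> subgrad_fields (G u)"
    by (rule dir_subgrad_field) (use finite_energyD(1)[OF g] finite_energyD(1)[OF h] in auto)
  have w: "?w \<in> L2 \<Omega>" by (rule L2_diff[OF X_D(1)[OF u] f])
  define T where "T n = 1 / real (Suc n)" for n
  have T: "\<And>n. T n > 0" "\<And>n. T n \<le> 1" "T \<longlonglongrightarrow> 0"
    unfolding T_def using LIMSEQ_inverse_real_of_nat by (auto simp: inverse_eq_divide)
  define N where "N n x = norm (G u x + T n *\<^sub>R G v x)" for n x
  define c where "c n x = right_slope \<alpha> \<gamma> \<kappa> x (N n x) * ((N n x - norm (G u x)) / T n)" for n x
  have Nm: "N n \<in> borel_measurable M" for n
    unfolding N_def using finite_energyD(1)[OF g] finite_energyD(1)[OF h] by measurable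
  have cm: "c n \<in> borel_measurable M" for n
    unfolding c_def using Nm finite_energyD(1)[OF g]
    by (intro borel_measurable_times right_slope_measurable borel_measurable_divide borel_measurable_diff
        norm_measurable borel_measurable_const)
  \<comment> \<open>Independent of \<open>n\<close>, since step sizes are at most 1 and the norm is
    1-Lipschitz.\<close>
  let ?b = "\<lambda>x. \<beta> x (norm (G u x) + norm (G v x)) * (norm (G u x) + norm (G v x))"
  have cb: "AE x in M. norm (c n x) \<le> ?b x" for n
    using \<kappa>_pos
  proof eventually_elim
    case (elim x)
    have T': "norm (T n *\<^sub>R G v x) \<le> norm (G v x)"
      using T(1)[of n] T(2)[of n] by (simp add: mult_left_le_one_le)
    have N1: "N n x \<le> norm (G u x) + norm (G v x)"
      unfolding N_def using norm_triangle_ineq[of "G u x" "T n *\<^sub>R G v x"] T' by linarith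
    have "\<bar>N n x - norm (G u x)\<bar> \<le> norm (T n *\<^sub>R G v x)"
      unfolding N_def using norm_triangle_ineq3[of "G u x + T n *\<^sub>R G v x" "G u x"] by simp
    then have "\<bar>N n x - norm (G u x)\<bar> / T n \<le> norm (G v x)"
      using T(1)[of n] by (simp add: pos_divide_le_eq mult.commute)
    then have N2: "\<bar>(N n x - norm (G u x)) / T n\<bar> \<le> norm (G u x) + norm (G v x)"
      using norm_ge_zero[of "G u x"] unfolding abs_divide abs_of_pos[OF T(1)] by linarith
    have S: "\<bar>right_slope \<alpha> \<gamma> \<kappa> x (N n x)\<bar> \<le> \<beta> x (norm (G u x) + norm (G v x))"
      using right_slope_le[where \<kappa>=\<kappa>, OF \<alpha> \<gamma> elim, of "N n x"]
        right_slope_pos[where \<kappa>=\<kappa>, OF \<alpha> \<gamma> elim, of "N n x"]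
        slope_bound_mono[where \<kappa>=\<kappa>, OF \<alpha> \<gamma> elim N1] by simp
    show ?case unfolding c_def real_norm_def abs_mult
      by (rule mult_mono[OF S N2]) (use S in auto)
  qed
  have bi: "integrable M ?b" by (rule integrable_slope_bound_mult[OF g h])
  have ci: "integrable M (c n)" for n
  proof (rule Bochner_Integration.integrable_bound[OF bi cm])
    show "AE x in M. norm (c n x) \<le> norm (?b x)" using cb[of n] by eventually_elim simp
  qed
  have clim: "(\<lambda>n. \<integral>x. c n x \<partial>M) \<longlonglongrightarrow> (\<integral>x. ?s x \<bullet> G v x \<partial>M)"
  proof (rule integral_dominated_convergence[OF _ cm bi _ cb])
    show "(\<lambda>x. ?s x \<bullet> G v x) \<in> borel_measurable M"
      using subgrad_field_integrable_inner[OF s g h] by (rule borel_measurable_integrable)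
    show "AE x in M. (\<lambda>n. c n x) \<longlonglongrightarrow> ?s x \<bullet> G v x"
      using \<kappa>_pos unfolding c_def N_def
      by eventually_elim (rule dir_subgrad_limit[where \<kappa>=\<kappa>, OF \<alpha> \<gamma> _ T])
  qed
  let ?V = "\<integral>x. (v x)\<^sup>2 \<partial>M" and ?W = "\<integral>x. ?w x * v x \<partial>M"
  have ineq: "0 \<le> ?W + T n / 2 * ?V + (\<integral>x. c n x \<partial>M)" for n
  proof -
    let ?u = "\<lambda>x. 1 * u x + T n * v x"
    have uX: "?u \<in> X" and Gu: "AE x in M. G ?u x = 1 *\<^sub>R G u x + T n *\<^sub>R G v x"
      using X_lincomb[OF u v, of 1 "T n"] by auto
    have I1: "integrable M (\<lambda>x. (?w x)\<^sup>2)" "integrable M (\<lambda>x. (v x)\<^sup>2)" "integrable M (\<lambda>x. ?w x * v x)"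
      using w X_D(1)[OF v] L2_integrable_mult[OF w X_D(1)[OF v]] by (auto simp: L2_def)
    have "(\<integral>x. (?u x - f x)\<^sup>2 \<partial>M) = (\<integral>x. (?w x)\<^sup>2 + 2 * T n * (?w x * v x) + (T n)\<^sup>2 * (v x)\<^sup>2 \<partial>M)"
      by (intro Bochner_Integration.integral_cong refl) (simp add: power2_eq_square algebra_simps)
    also have "\<dots> = (\<integral>x. (?w x)\<^sup>2 \<partial>M) + 2 * T n * ?W + (T n)\<^sup>2 * ?V"
      using I1 by simp
    finally have sq: "(L2_norm \<Omega> (\<lambda>x. ?u x - f x))\<^sup>2 = (L2_norm \<Omega> ?w)\<^sup>2 + 2 * T n * ?W + (T n)\<^sup>2 * ?V"
      unfolding L2_norm_sq .
    note gu = X_D(3)[OF uX]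
    have "(\<integral>x. \<phi> x (norm (G ?u x)) \<partial>M) \<le> (\<integral>x. \<phi> x (norm (G u x)) + T n * c n x \<partial>M)"
    proof (rule integral_mono_AE)
      show "integrable M (\<lambda>x. \<phi> x (norm (G ?u x)))" by (rule finite_energyD(4)[OF gu])
      show "integrable M (\<lambda>x. \<phi> x (norm (G u x)) + T n * c n x)"
        using finite_energyD(4)[OF g] ci by simp
      show "AE x in M. \<phi> x (norm (G ?u x)) \<le> \<phi> x (norm (G u x)) + T n * c n x"
        using Gu \<kappa>_pos
      proof eventually_elim
        case (elim x)
        have N: "norm (G ?u x) = N n x" unfolding N_def elim(1) by simp
        have "\<phi> x (N n x) + right_slope \<alpha> \<gamma> \<kappa> x (N n x) * (norm (G u x) - N n x) \<le> \<phi> x (norm (G u x))"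
          by (rule right_slope_subgradient[where \<kappa>=\<kappa>, OF \<alpha> \<gamma> elim(2)]) (auto simp: N_def)
        moreover have "T n * c n x = - (right_slope \<alpha> \<gamma> \<kappa> x (N n x) * (norm (G u x) - N n x))"
        proof -
          have "T n * c n x = right_slope \<alpha> \<gamma> \<kappa> x (N n x) * (N n x - norm (G u x))"
            unfolding c_def using T(1)[of n] by simp
          then show ?thesis by (simp add: algebra_simps)
        qed
        ultimately show ?case unfolding N by linarith
      qed
    qed
    also have "\<dots> = (\<integral>x. \<phi> x (norm (G u x)) \<partial>M) + T n * (\<integral>x. c n x \<partial>M)"
      using finite_energyD(4)[OF g] ci by simp
    finally have ph: "(\<integral>x. \<phi> x (norm (G ?u x)) \<partial>M) \<le> (\<integral>x. \<phi> x (norm (G u x)) \<partial>M) + T n * (\<integral>x. c n x \<partial>M)" .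
    have "0 \<le> T n * (?W + T n / 2 * ?V + (\<integral>x. c n x \<partial>M))"
      using min[OF uX] ph unfolding primal_functional_def sq by (simp add: power2_eq_square algebra_simps)
    then show ?thesis using T(1)[of n] by (simp only: zero_le_mult_iff) linarith
  qed
  have "(\<lambda>n. ?W + T n / 2 * ?V + (\<integral>x. c n x \<partial>M)) \<longlonglongrightarrow> ?W + 0 / 2 * ?V + (\<integral>x. ?s x \<bullet> G v x \<partial>M)"
    by (intro tendsto_intros T(3) clim) simp
  then have "0 \<le> ?W + 0 / 2 * ?V + (\<integral>x. ?s x \<bullet> G v x \<partial>M)"
    by (rule LIMSEQ_le_const) (use ineq in auto)
  then show "0 \<le> residual ?w ?s v" unfolding residual_def by simp
qed

end

section \<open>Duality\<close>

lemma isCont_phi: "isCont (phi \<alpha> \<gamma> \<kappa> x) t"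
  unfolding phi_def log_plus_eq divide_inverse by (intro continuous_intros) auto

text \<open>The supremum may be restricted to rational \<open>t\<close>, so the conjugate is measurable in \<open>x\<close>.\<close>

lemma phi_conj_rational:
  "phi_conj \<alpha> \<gamma> \<kappa> x s = (SUP t\<in>{0..} \<inter> \<rat>. ereal (s * t - phi \<alpha> \<gamma> \<kappa> x t))"
proof (rule antisym)
  let ?S = "SUP t\<in>{0..} \<inter> \<rat>. ereal (s * t - phi \<alpha> \<gamma> \<kappa> x t)"
  show "phi_conj \<alpha> \<gamma> \<kappa> x s \<le> ?S"
    unfolding phi_conj_def
  proof (rule SUP_least)
    fix t :: real assume t: "t \<in> {0..}"
    \<comment> \<open>Approximation from above keeps the rationals in the half-line, also when
      \<open>t = 0\<close>.\<close>
    have "\<forall>n. \<exists>r\<in>\<rat>. t < r \<and> r < t + 1 / real (Suc n)"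
      by (intro allI Rats_dense_in_real) simp
    then obtain r where r: "\<And>n. r n \<in> \<rat>" "\<And>n. t < r n" "\<And>n. r n < t + 1 / real (Suc n)" by metis
    have "(\<lambda>n. t + 1 / real (Suc n)) \<longlonglongrightarrow> t + 0"
      by (intro tendsto_add tendsto_const) (use LIMSEQ_inverse_real_of_nat in \<open>simp add: inverse_eq_divide\<close>)
    then have lim': "(\<lambda>n. t + 1 / real (Suc n)) \<longlonglongrightarrow> t" by simp
    have lim: "r \<longlonglongrightarrow> t"
      by (rule tendsto_sandwich[OF always_eventually always_eventually tendsto_const[of t] lim'])
         (use r(2,3) less_imp_le in blast)+
    have "(\<lambda>n. ereal (s * r n - phi \<alpha> \<gamma> \<kappa> x (r n))) \<longlonglongrightarrow> ereal (s * t - phi \<alpha> \<gamma> \<kappa> x t)"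
      by (intro tendsto_ereal tendsto_diff tendsto_mult tendsto_const lim isCont_tendsto_compose[OF isCont_phi])
    then show "ereal (s * t - phi \<alpha> \<gamma> \<kappa> x t) \<le> ?S"
    proof (rule LIMSEQ_le_const2)
      have "r n \<in> {0..} \<inter> \<rat>" for n using r(1,2)[of n] t by auto
      then show "\<exists>n0. \<forall>n\<ge>n0. ereal (s * r n - phi \<alpha> \<gamma> \<kappa> x (r n)) \<le> ?S"
        by (intro exI allI impI SUP_upper)
    qed
  qed
  show "?S \<le> phi_conj \<alpha> \<gamma> \<kappa> x s"
    unfolding phi_conj_def by (rule SUP_subset_mono) auto
qed

lemma phi_conj_nonneg: "0 \<le> phi_conj \<alpha> \<gamma> \<kappa> x s"
  unfolding phi_conj_def by (rule SUP_upper2[of 0]) auto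

context log_growth_problem
begin

abbreviation \<phi>\<^sub>c where "\<phi>\<^sub>c \<equiv> phi_conj \<alpha> \<gamma> \<kappa>"

lemma phi_conj_measurable:
  assumes "h \<in> borel_measurable M"
  shows "(\<lambda>x. e2ennreal (\<phi>\<^sub>c x (h x))) \<in> borel_measurable M"
proof (rule measurable_compose[OF _ measurable_e2ennreal])
  show "(\<lambda>x. \<phi>\<^sub>c x (h x)) \<in> borel_measurable M"
    unfolding phi_conj_rational
  proof (rule borel_measurable_SUP)
    show "countable ({0..} \<inter> \<rat> :: real set)" by (simp add: countable_rat)
    show "(\<lambda>x. ereal (h x * t - \<phi> x t)) \<in> borel_measurable M" for t
      using assms by (intro borel_measurable_ereal borel_measurable_diff borel_measurable_times
          borel_measurable_const phi_measurable)
  qed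
qed

text \<open>On a selection the Fenchel equality bounds the conjugate by an integrable function,
  despite its exponential growth.\<close>

lemma subgrad_field_conj:
  assumes u: "u \<in> X" and q: "q \<in> subgrad_fields (G u)"
  shows "integrable M (\<lambda>x. q x \<bullet> G u x - \<Phi> x (G u x))"
    and "(\<integral>\<^sup>+x. e2ennreal (\<phi>\<^sub>c x (norm (q x))) \<partial>M) \<le> ennreal (\<integral>x. q x \<bullet> G u x - \<Phi> x (G u x) \<partial>M)"
proof -
  note g = X_D(3)[OF u]
  show int: "integrable M (\<lambda>x. q x \<bullet> G u x - \<Phi> x (G u x))"
    unfolding Phi_def
    by (rule Bochner_Integration.integrable_diff[OF subgrad_field_integrable_inner[OF q g g] finite_energyD(4)[OF g]])
  have le: "AE x in M. \<phi>\<^sub>c x (norm (q x)) \<le> ereal (q x \<bullet> G u x - \<Phi> x (G u x))"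
    using subgrad_fieldsD(2)[OF q] \<kappa>_pos
    by eventually_elim (simp only: phi_conj_le_iff_subgradient[where \<kappa>=\<kappa>, OF \<alpha> \<gamma>])
  have nn: "AE x in M. 0 \<le> q x \<bullet> G u x - \<Phi> x (G u x)"
    using le
  proof eventually_elim
    case (elim x)
    show ?case using order_trans[OF phi_conj_nonneg elim] by (simp only: ereal_less_eq zero_ereal_def)
  qed
  have "(\<integral>\<^sup>+x. e2ennreal (\<phi>\<^sub>c x (norm (q x))) \<partial>M) \<le> (\<integral>\<^sup>+x. ennreal (q x \<bullet> G u x - \<Phi> x (G u x)) \<partial>M)"
  proof (rule nn_integral_mono_AE)
    show "AE x in M. e2ennreal (\<phi>\<^sub>c x (norm (q x))) \<le> ennreal (q x \<bullet> G u x - \<Phi> x (G u x))"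
      using le
    proof eventually_elim
      case (elim x)
      from e2ennreal_mono[OF elim] show ?case by (simp only: e2ennreal_ereal)
    qed
  qed
  also have "\<dots> = ennreal (\<integral>x. q x \<bullet> G u x - \<Phi> x (G u x) \<partial>M)"
    by (rule nn_integral_eq_integral[OF int nn])
  finally show "(\<integral>\<^sup>+x. e2ennreal (\<phi>\<^sub>c x (norm (q x))) \<partial>M) \<le> ennreal (\<integral>x. q x \<bullet> G u x - \<Phi> x (G u x) \<partial>M)" .
qed

text \<open>Residuals tested with test functions identify the divergence, and those tested with
  \<open>X\<close> give integration by parts. Membership in the Orlicz space holds with scaling
  factor 1, since the modular of \<open>q\<close> itself is finite.\<close>

lemma balanced_subgrad_field_in_K:
  assumes u: "u \<in> X" and w: "w \<in> L2 \<Omega>" and q: "q \<in> subgrad_fields (G u)"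
    and bal: "\<And>v. v \<in> X \<Longrightarrow> residual w q v = 0"
  shows "q \<in> K_set \<Omega> \<alpha> \<gamma> \<kappa>" "AE x in M. weak_div \<Omega> q x = w x"
proof -
  note g = X_D(3)[OF u]
  have qint: "integrable M q"
  proof (rule Bochner_Integration.integrable_bound[OF integrable_slope_bound[OF g] subgrad_fieldsD(1)[OF q]])
    show "AE x in M. norm (q x) \<le> norm (\<beta> x (norm (G u x)))"
      using subgrad_fieldsD(3)[OF q] by eventually_elim simp
  qed
  have L: "locally_integrable \<Omega> q" "locally_integrable \<Omega> w"
    using qint L2_integrable[OF finite_M w] by (auto intro: integrable_imp_locally_integrable[OF _ open_domain])
  have ibp: "(\<integral>x. q x \<bullet> G v x \<partial>M) = - (\<integral>x. w x * v x \<partial>M)" if "v \<in> X" for v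
    using bal[OF that] unfolding residual_def by linarith
  have div: "has_weak_div \<Omega> q w"
    unfolding has_weak_div_def
  proof (intro conjI L allI impI)
    fix \<psi> assume \<psi>: "test_function \<Omega> \<psi>"
    note T = test_function_in_X[OF \<psi>]
    have "(\<integral>x. q x \<bullet> classical_grad \<psi> x \<partial>M) = (\<integral>x. q x \<bullet> G \<psi> x \<partial>M)"
    proof (rule integral_cong_AE)
      show "(\<lambda>x. q x \<bullet> classical_grad \<psi> x) \<in> borel_measurable M"
        using test_function_integrable(3)[OF \<psi> open_domain L(1)] by (rule borel_measurable_integrable)
      show "(\<lambda>x. q x \<bullet> G \<psi> x) \<in> borel_measurable M"
        using subgrad_field_integrable_inner[OF q g X_D(3)[OF T(1)]] by (rule borel_measurable_integrable)
      show "AE x in M. q x \<bullet> classical_grad \<psi> x = q x \<bullet> G \<psi> x"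
        using T(2) by eventually_elim simp
    qed
    then show "(\<integral>x. q x \<bullet> classical_grad \<psi> x \<partial>M) = - (\<integral>x. w x * \<psi> x \<partial>M)"
      using ibp[OF T(1)] by simp
  qed
  show ae: "AE x in M. weak_div \<Omega> q x = w x" by (rule weak_div_AE_eq[OF open_domain div])
  have dm: "weak_div \<Omega> q \<in> borel_measurable M"
    by (rule borel_measurable_AE_lebesgue_on[of w]) (use w ae open_domain in \<open>auto simp: L2_def\<close>)
  have "(\<integral>x. q x \<bullet> G v x \<partial>M) = - (\<integral>x. weak_div \<Omega> q x * v x \<partial>M)" if v: "v \<in> X" for v
  proof -
    have "(\<integral>x. weak_div \<Omega> q x * v x \<partial>M) = (\<integral>x. w x * v x \<partial>M)"
    proof (rule integral_cong_AE)
      show "(\<lambda>x. weak_div \<Omega> q x * v x) \<in> borel_measurable M" "(\<lambda>x. w x * v x) \<in> borel_measurable M"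
        using dm w X_D(1)[OF v] by (auto simp: L2_def)
      show "AE x in M. weak_div \<Omega> q x * v x = w x * v x" using ae by eventually_elim simp
    qed
    then show ?thesis using ibp[OF v] by simp
  qed
  moreover have "q \<in> L_phi_conj \<Omega> \<alpha> \<gamma> \<kappa>"
    unfolding L_phi_conj_def
  proof (intro CollectI conjI exI[of _ 1])
    have "(\<integral>\<^sup>+x. e2ennreal (\<phi>\<^sub>c x (norm (q x))) \<partial>M) < \<infinity>"
      using subgrad_field_conj(2)[OF u q] by (rule le_less_trans) simp
    then show "(\<integral>\<^sup>+x. e2ennreal (\<phi>\<^sub>c x (1 * norm (q x))) \<partial>M) < \<infinity>" by simp
  qed (use subgrad_fieldsD(1)[OF q] in auto)
  ultimately show "q \<in> K_set \<Omega> \<alpha> \<gamma> \<kappa>"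
    unfolding K_set_def using w div by blast
qed

text \<open>With w = u - f, the zero residual at \<open>u\<close> turns the integral of
  \<open>q \<bullet> G u\<close> into minus that of w u. The identity w^2 = w u - f w then converts
  the dual value into half the integral of w^2 plus the energy of \<open>G u\<close>. An upper bound
  for the conjugate suffices for this inequality.\<close>

lemma balanced_subgrad_field_dual_ge:
  assumes u: "u \<in> X" and f: "f \<in> L2 \<Omega>" and q: "q \<in> subgrad_fields (G u)"
    and bal: "\<And>v. v \<in> X \<Longrightarrow> residual (\<lambda>x. u x - f x) q v = 0"
  shows "ereal (primal_functional \<Omega> f \<alpha> \<gamma> \<kappa> u) \<le> dual_functional \<Omega> f \<alpha> \<gamma> \<kappa> q"
proof -
  let ?w = "\<lambda>x. u x - f x" and ?d = "weak_div \<Omega> q"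
  note g = X_D(3)[OF u]
  have w: "?w \<in> L2 \<Omega>" by (rule L2_diff[OF X_D(1)[OF u] f])
  have ae: "AE x in M. ?d x = ?w x" by (rule balanced_subgrad_field_in_K(2)[OF u w q bal])
  have dm: "?d \<in> borel_measurable M"
    by (rule borel_measurable_AE_lebesgue_on[of ?w]) (use w ae open_domain in \<open>auto simp: L2_def\<close>)
  let ?H = "\<integral>x. q x \<bullet> G u x - \<Phi> x (G u x) \<partial>M"
  let ?A = "- (1/2) * (L2_norm \<Omega> ?d)\<^sup>2 - (\<integral>x. f x * ?d x \<partial>M)"
  have d2: "(L2_norm \<Omega> ?d)\<^sup>2 = (\<integral>x. (?w x)\<^sup>2 \<partial>M)"
    unfolding L2_norm_sq
  proof (rule integral_cong_AE)
    show "AE x in M. (?d x)\<^sup>2 = (?w x)\<^sup>2" using ae by eventually_elim simp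
  qed (use dm w in \<open>auto simp: L2_def\<close>)
  have fd: "(\<integral>x. f x * ?d x \<partial>M) = (\<integral>x. f x * ?w x \<partial>M)"
  proof (rule integral_cong_AE)
    show "AE x in M. f x * ?d x = f x * ?w x" using ae by eventually_elim simp
  qed (use dm w f in \<open>auto simp: L2_def\<close>)
  have H: "?H = - (\<integral>x. ?w x * u x \<partial>M) - (\<integral>x. \<phi> x (norm (G u x)) \<partial>M)"
  proof -
    have "?H = (\<integral>x. q x \<bullet> G u x \<partial>M) - (\<integral>x. \<phi> x (norm (G u x)) \<partial>M)"
      unfolding Phi_def
      by (rule Bochner_Integration.integral_diff[OF subgrad_field_integrable_inner[OF q g g] finite_energyD(4)[OF g]])
    then show ?thesis using bal[OF u] unfolding residual_def by linarith
  qed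
  have ww: "(\<integral>x. (?w x)\<^sup>2 \<partial>M) = (\<integral>x. ?w x * u x \<partial>M) - (\<integral>x. f x * ?w x \<partial>M)"
  proof -
    have "(\<integral>x. (?w x)\<^sup>2 \<partial>M) = (\<integral>x. ?w x * u x - f x * ?w x \<partial>M)"
      by (intro Bochner_Integration.integral_cong refl) (simp add: power2_eq_square algebra_simps)
    then show ?thesis
      using L2_integrable_mult[OF w X_D(1)[OF u]] L2_integrable_mult[OF f w] by simp
  qed
  have eq: "primal_functional \<Omega> f \<alpha> \<gamma> \<kappa> u = ?A - ?H"
    unfolding primal_functional_def L2_norm_sq[of \<Omega> ?w] d2 fd H ww by simp
  have Hnn: "0 \<le> ?H"
  proof (rule integral_nonneg_AE)
    show "AE x in M. 0 \<le> q x \<bullet> G u x - \<Phi> x (G u x)"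
      using subgrad_fieldsD(2)[OF q]
    proof eventually_elim
      case (elim x)
      then have "\<forall>y. \<Phi> x (G u x) + q x \<bullet> (y - G u x) \<le> \<Phi> x y" by (simp add: subdifferential_def)
      from this[rule_format, of 0] show ?case by simp
    qed
  qed
  have "enn2ereal (\<integral>\<^sup>+x. e2ennreal (\<phi>\<^sub>c x (norm (q x))) \<partial>M) \<le> enn2ereal (ennreal ?H)"
    using subgrad_field_conj(2)[OF u q] by (simp only: less_eq_ennreal.rep_eq)
  also have "\<dots> = ereal ?H" using Hnn by (rule enn2ereal_ennreal)
  finally have "ereal ?A - ereal ?H \<le> dual_functional \<Omega> f \<alpha> \<gamma> \<kappa> q"
    unfolding dual_functional_def by (intro ereal_minus_mono order_refl)
  then show ?thesis unfolding eq by simp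
qed

text \<open>Expanding squares and using the integration by parts in \<open>K_set\<close>, the primal
  minus the dual value is half the integral of \<open>?e\<close> squared plus the integral of
  \<open>?R\<close>, two nonnegative terms. The splitting is legitimate only after all parts are
  known to be integrable.\<close>

lemma dual_ge_primal_imp_optimality:
  assumes u: "u \<in> X" and f: "f \<in> L2 \<Omega>" and p: "p \<in> K_set \<Omega> \<alpha> \<gamma> \<kappa>"
    and ge: "ereal (primal_functional \<Omega> f \<alpha> \<gamma> \<kappa> u) \<le> dual_functional \<Omega> f \<alpha> \<gamma> \<kappa> p"
  shows "AE x in M. weak_div \<Omega> p x = u x - f x"
    and "AE x in M. p x \<in> subdifferential UNIV (\<Phi> x) (G u x)"
proof -
  let ?w = "\<lambda>x. u x - f x" and ?d = "weak_div \<Omega> p"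
  note g = X_D(3)[OF u]
  have w: "?w \<in> L2 \<Omega>" by (rule L2_diff[OF X_D(1)[OF u] f])
  have pm: "p \<in> borel_measurable M" using p by (simp add: K_set_def L_phi_conj_def)
  obtain d0 where d0: "d0 \<in> L2 \<Omega>" "has_weak_div \<Omega> p d0" using p by (auto simp: K_set_def)
  have dae: "AE x in M. ?d x = d0 x" by (rule weak_div_AE_eq[OF open_domain d0(2)])
  have dm: "?d \<in> borel_measurable M"
    by (rule borel_measurable_AE_lebesgue_on[of d0]) (use d0 dae open_domain in \<open>auto simp: L2_def\<close>)
  have d: "?d \<in> L2 \<Omega>"
  proof -
    have "integrable M (\<lambda>x. (?d x)\<^sup>2) \<longleftrightarrow> integrable M (\<lambda>x. (d0 x)\<^sup>2)"
    proof (rule integrable_cong_AE)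
      show "AE x in M. (?d x)\<^sup>2 = (d0 x)\<^sup>2" using dae by eventually_elim simp
    qed (use dm d0 in \<open>auto simp: L2_def\<close>)
    then show ?thesis using d0 dm by (simp add: L2_def)
  qed
  let ?A = "- (1/2) * (L2_norm \<Omega> ?d)\<^sup>2 - (\<integral>x. f x * ?d x \<partial>M)"
  let ?I = "\<integral>\<^sup>+x. e2ennreal (\<phi>\<^sub>c x (norm (p x))) \<partial>M"
  \<comment> \<open>Membership in \<open>K_set\<close> controls only some multiple of
    \<open>p\<close>. The lower bound on the dual value excludes -\<infinity> and so makes the
    modular of \<open>p\<close> itself finite.\<close>
  have fin: "?I \<noteq> \<infinity>"
    using ge unfolding dual_functional_def by auto
  define c where "c x = enn2real (e2ennreal (\<phi>\<^sub>c x (norm (p x))))" for x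
  have Sm: "(\<lambda>x. e2ennreal (\<phi>\<^sub>c x (norm (p x)))) \<in> borel_measurable M"
    by (rule phi_conj_measurable[OF norm_measurable[OF pm]])
  have Sfin: "AE x in M. e2ennreal (\<phi>\<^sub>c x (norm (p x))) \<noteq> \<infinity>"
    by (rule nn_integral_PInf_AE[OF Sm fin])
  have c_enn: "AE x in M. ennreal (c x) = e2ennreal (\<phi>\<^sub>c x (norm (p x)))"
    using Sfin by eventually_elim (simp add: c_def ennreal_enn2real less_top)
  have c_eq: "AE x in M. \<phi>\<^sub>c x (norm (p x)) = ereal (c x)"
    using c_enn
  proof eventually_elim
    case (elim x)
    have "\<phi>\<^sub>c x (norm (p x)) = enn2ereal (e2ennreal (\<phi>\<^sub>c x (norm (p x))))"
      by (rule enn2ereal_e2ennreal[OF phi_conj_nonneg, symmetric])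
    also have "\<dots> = enn2ereal (ennreal (c x))" by (simp only: elim)
    also have "\<dots> = ereal (c x)" by (rule enn2ereal_ennreal) (simp add: c_def)
    finally show ?case .
  qed
  have cm: "c \<in> borel_measurable M"
    unfolding c_def[abs_def] by (rule borel_measurable_enn2real[OF Sm])
  have I_eq: "(\<integral>\<^sup>+x. ennreal (c x) \<partial>M) = ?I" by (rule nn_integral_cong_AE[OF c_enn])
  have ci: "integrable M c"
    by (rule integrableI_nn_integral_finite[OF cm, where x="enn2real ?I"])
       (use I_eq fin in \<open>auto simp: c_def ennreal_enn2real less_top\<close>)
  have I_c: "?I = ennreal (\<integral>x. c x \<partial>M)"
    unfolding I_eq[symmetric] by (rule nn_integral_eq_integral[OF ci]) (simp add: c_def)
  have c_nn: "0 \<le> (\<integral>x. c x \<partial>M)" by (rule integral_nonneg_AE) (simp add: c_def)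
  \<comment> \<open>Fenchel-Young at both \<open>G u\<close> and its negative bounds the modulus of
    the pairing, which gives integrability; otherwise its Bochner integral could be a default
    value.\<close>
  have young: "AE x in M. p x \<bullet> G u x - \<Phi> x (G u x) \<le> c x \<and> - (p x \<bullet> G u x) - \<Phi> x (G u x) \<le> c x"
    using c_eq \<kappa>_pos
  proof eventually_elim
    case (elim x)
    have *: "ereal (p x \<bullet> y - \<Phi> x y) \<le> ereal (c x)" for y
      using phi_conj_ge[where \<kappa>=\<kappa>, OF \<alpha> \<gamma> elim(2), of "p x" y] unfolding elim(1) .
    show ?case using *[of "G u x"] *[of "- G u x"] by (simp add: Phi_def)
  qed
  have \<Phi>i: "integrable M (\<lambda>x. \<Phi> x (G u x))"
    unfolding Phi_def by (rule finite_energyD(4)[OF g])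
  have pGi: "integrable M (\<lambda>x. p x \<bullet> G u x)"
  proof (rule Bochner_Integration.integrable_bound[OF Bochner_Integration.integrable_add[OF ci \<Phi>i]])
    show "(\<lambda>x. p x \<bullet> G u x) \<in> borel_measurable M"
      using pm finite_energyD(1)[OF g] by (rule borel_measurable_inner)
    show "AE x in M. norm (p x \<bullet> G u x) \<le> norm (c x + \<Phi> x (G u x))"
      using young
    proof eventually_elim
      case (elim x)
      then show ?case unfolding real_norm_def by linarith
    qed
  qed
  have pK: "(\<integral>x. p x \<bullet> G u x \<partial>M) = - (\<integral>x. ?d x * u x \<partial>M)"
    using p u by (simp add: K_set_def)
  have "ereal (primal_functional \<Omega> f \<alpha> \<gamma> \<kappa> u) \<le> ereal ?A - enn2ereal (ennreal (\<integral>x. c x \<partial>M))"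
    using ge unfolding dual_functional_def I_c .
  then have main: "primal_functional \<Omega> f \<alpha> \<gamma> \<kappa> u \<le> ?A - (\<integral>x. c x \<partial>M)"
    unfolding enn2ereal_ennreal[OF c_nn] by simp
  let ?R = "\<lambda>x. c x + \<Phi> x (G u x) - p x \<bullet> G u x"
  have Ri: "integrable M ?R" using ci \<Phi>i pGi by simp
  have Rnn: "AE x in M. 0 \<le> ?R x" using young by eventually_elim simp
  have R: "(\<integral>x. ?R x \<partial>M) = (\<integral>x. c x \<partial>M) + (\<integral>x. \<Phi> x (G u x) \<partial>M) + (\<integral>x. ?d x * u x \<partial>M)"
    using ci \<Phi>i pGi pK by simp
  let ?e = "\<lambda>x. ?d x - ?w x"
  have e: "?e \<in> L2 \<Omega>" by (rule L2_diff[OF d w])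
  have ei: "integrable M (\<lambda>x. (?e x)\<^sup>2)" using e by (simp add: L2_def)
  have E: "(\<integral>x. (?e x)\<^sup>2 \<partial>M) = (\<integral>x. (?d x)\<^sup>2 \<partial>M) - 2 * (\<integral>x. ?d x * u x \<partial>M) + 2 * (\<integral>x. f x * ?d x \<partial>M) + (\<integral>x. (?w x)\<^sup>2 \<partial>M)"
  proof -
    have "(\<integral>x. (?e x)\<^sup>2 \<partial>M) = (\<integral>x. (?d x)\<^sup>2 - 2 * (?d x * u x) + 2 * (f x * ?d x) + (?w x)\<^sup>2 \<partial>M)"
      by (intro Bochner_Integration.integral_cong refl) (simp add: power2_eq_square algebra_simps)
    then show ?thesis
      using d w L2_integrable_mult[OF d X_D(1)[OF u]] L2_integrable_mult[OF f d] by (simp add: L2_def)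
  qed
  have nn: "0 \<le> (\<integral>x. (?e x)\<^sup>2 \<partial>M)" "0 \<le> (\<integral>x. ?R x \<partial>M)"
    using Rnn by (auto intro: integral_nonneg_AE)
  have "1/2 * (\<integral>x. (?e x)\<^sup>2 \<partial>M) + (\<integral>x. ?R x \<partial>M) \<le> 0"
    using main unfolding E R primal_functional_def L2_norm_sq Phi_def[symmetric] by (simp add: field_simps)
  then have zero: "(\<integral>x. (?e x)\<^sup>2 \<partial>M) = 0" "(\<integral>x. ?R x \<partial>M) = 0" using nn by linarith+
  have "AE x in M. (?e x)\<^sup>2 = 0"
    using zero(1) by (subst (asm) integral_nonneg_eq_0_iff_AE[OF ei]) auto
  then show "AE x in M. weak_div \<Omega> p x = u x - f x" by eventually_elim simp
  have "AE x in M. ?R x = 0"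
    using zero(2) by (subst (asm) integral_nonneg_eq_0_iff_AE[OF Ri Rnn])
  then show "AE x in M. p x \<in> subdifferential UNIV (\<Phi> x) (G u x)"
    using c_eq \<kappa>_pos
  proof eventually_elim
    case (elim x)
    then show ?case
      using phi_conj_le_iff_subgradient[where \<kappa>=\<kappa>, OF \<alpha> \<gamma> elim(3), of "p x" "G u x"] by simp
  qed
qed

end

theorem proposition4p7:
  fixes \<Omega> :: "(real ^ 'n) set"
    and f \<kappa> u :: "real ^ 'n \<Rightarrow> real"
    and p :: "real ^ 'n \<Rightarrow> real ^ 'n"
    and \<alpha> \<gamma> \<kappa>_lo \<kappa>_hi :: real
  assumes "bounded_lipschitz_domain \<Omega>"
    and "f \<in> L2 \<Omega>"
    and "\<alpha> > 0"
    and "\<kappa> \<in> borel_measurable (lebesgue_on \<Omega>)"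
    and "0 < \<kappa>_lo"
    and "AE x in lebesgue_on \<Omega>. \<kappa>_lo \<le> \<kappa> x \<and> \<kappa> x \<le> \<kappa>_hi"
    and "\<gamma> > 0"
    and "u \<in> X_space \<Omega> \<alpha> \<gamma> \<kappa>"
    and "\<forall>v\<in>X_space \<Omega> \<alpha> \<gamma> \<kappa>.
           primal_functional \<Omega> f \<alpha> \<gamma> \<kappa> u \<le> primal_functional \<Omega> f \<alpha> \<gamma> \<kappa> v"
    and "p \<in> K_set \<Omega> \<alpha> \<gamma> \<kappa>"
    and "\<forall>q\<in>K_set \<Omega> \<alpha> \<gamma> \<kappa>.
           dual_functional \<Omega> f \<alpha> \<gamma> \<kappa> q \<le> dual_functional \<Omega> f \<alpha> \<gamma> \<kappa> p"
  shows "(AE x in lebesgue_on \<Omega>. weak_div \<Omega> p x = u x - f x)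
    \<and> (AE x in lebesgue_on \<Omega>.
          p x \<in> subdifferential UNIV (Phi \<alpha> \<gamma> \<kappa> x) (weak_grad \<Omega> u x))
    \<and> (AE x in lebesgue_on \<Omega>. \<forall>z q :: real ^ 'n.
          q \<in> subdifferential UNIV (Phi \<alpha> \<gamma> \<kappa> x) z \<longleftrightarrow>
            (z \<noteq> 0 \<longrightarrow>
               (\<exists>a\<in>subdifferential {0..} (phi \<alpha> \<gamma> \<kappa> x) (norm z). q = a *\<^sub>R (z /\<^sub>R norm z)))
          \<and> (z = 0 \<longrightarrow> norm q \<le> \<alpha>))"
proof -
  interpret log_growth_problem \<Omega> \<kappa> \<alpha> \<gamma> \<kappa>_lo
  proof
    show "open \<Omega>" "bounded \<Omega>" using assms(1) by (auto simp: bounded_lipschitz_domain_def)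
    show "AE x in lebesgue_on \<Omega>. \<kappa>_lo \<le> \<kappa> x" using assms(6) by eventually_elim simp
  qed (use assms in auto)
  note f = assms(2) and u = assms(8)
  have w: "(\<lambda>x. u x - f x) \<in> L2 \<Omega>" by (rule L2_diff[OF X_D(1)[OF u] f])
  have dir: "\<exists>s\<in>subgrad_fields (G u). 0 \<le> residual (\<lambda>x. u x - f x) s v" if "v \<in> X" for v
    by (rule minimizer_directional[OF f u that]) (use assms(9) in blast)
  obtain q where q: "q \<in> subgrad_fields (G u)" "\<And>v. v \<in> X \<Longrightarrow> residual (\<lambda>x. u x - f x) q v = 0"
    using exists_balanced_subgrad_field[OF X_D(3)[OF u] w dir] by blast
  have "q \<in> K_set \<Omega> \<alpha> \<gamma> \<kappa>" by (rule balanced_subgrad_field_in_K(1)[OF u w q])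
  \<comment> \<open>The field \<open>q\<close> is merely a competitor: maximality transfers its dual
    value to \<open>p\<close>, and no identification of \<open>p\<close> with \<open>q\<close> is
    made.\<close>
  then have "ereal (primal_functional \<Omega> f \<alpha> \<gamma> \<kappa> u) \<le> dual_functional \<Omega> f \<alpha> \<gamma> \<kappa> p"
    by (intro order_trans[OF balanced_subgrad_field_dual_ge[OF u f q]] assms(11)[rule_format])
  note opt = dual_ge_primal_imp_optimality[OF u f assms(10) this]
  \<comment> \<open>The equivalence holds at every point where \<kappa> is positive, so the
    exceptional set depends on neither \<open>z\<close> nor \<open>q\<close>.\<close>
  have "AE x in M. \<forall>z q :: real ^ 'n.
          q \<in> subdifferential UNIV (Phi \<alpha> \<gamma> \<kappa> x) z \<longleftrightarrow>
            (z \<noteq> 0 \<longrightarrow>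
               (\<exists>a\<in>subdifferential {0..} (phi \<alpha> \<gamma> \<kappa> x) (norm z). q = a *\<^sub>R (z /\<^sub>R norm z)))
          \<and> (z = 0 \<longrightarrow> norm q \<le> \<alpha>)"
    using \<kappa>_pos
    by eventually_elim (intro allI subdifferential_Phi_iff[where \<kappa>=\<kappa>, OF \<alpha> \<gamma>])
  with opt show ?thesis by blast
qed

end
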